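(* Suppose that $\sigma^2>0$. Then there exists a non-negative rate function $c$, defined on an open interval containing $0$, continuous, strictly convex, vanishing only at $0$, such that for every $\nu\in\mathcal{M}_{\mathcal{B}}$ and every sufficiently small $\epsilon>0$ (how small may depend on $\nu$), $$\lim_{n\to\infty}\frac1n\log\tilde{\mathbb{P}}\otimes\nu(S_n>n\epsilon)=-c(\epsilon).$$
   Context: Random system. $(\Omega,\mathcal{T},\mathbb{P})$ and $(X,\mathcal{A},m)$ are probability spaces; to each $\omega\in\Omega$ is associated a map $T_\omega:X\to X$, with $(\omega,x)\mapsto T_\omega(x)$ measurable and each $T_\omega$ non-singular with respect to $m$ (i.e. $m(A)=0$ implies $m(T_\omega^{-1}A)=0$). Set $\tilde\Omega=\Omega^{\mathbb{N}}$, with elements $\underline\omega=(\omega_1,\omega_2,\ldots)$, and $\tilde{\mathbb{P}}=\mathbb{P}^{\otimes\mathbb{N}}$. The transfer operator $P_\omega$ of $T_\omega$ acts on $L^1(m)$ and is characterized by $\int_X P_\omega f\, g\,dm=\int_X f\,(g\circ T_\omega)\,dm$ for $f\in L^1(m)$, $g\in L^\infty(m)$. The annealed operators are $Pf(x)=\int_\Omega P_\omega f(x)\,d\mathbb{P}(\omega)$ on $L^1(m)$ and $Ug(x)=\int_\Omega g(T_\omega x)\,d\mathbb{P}(\omega)$ on $L^\infty(m)$. A probability measure $\mu$ on $X$ is stationary if $\mu(A)=\int_\Omega\mu(T_\omega^{-1}A)\,d\mathbb{P}(\omega)$ for all $A\in\mathcal{A}$. Standing assumptions. There is a Banach space $(\mathcal{B},\|\cdot\|)$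 of complex-valued functions such that: (1) $\mathcal{B}$ is compactly embedded in $L^1(m)$; (2) constant functions lie in $\mathcal{B}$; (3) $\mathcal{B}$ is a complex Banach lattice: $|f|,\bar f\in\mathcal{B}$ for all $f\in\mathcal{B}$; (4) $P(\mathcal{B})\subset\mathcal{B}$ and $P$ acts continuously on $\mathcal{B}$; (5) there are $N\ge1$, $\rho<1$, $K\ge0$ with $\|P^Nf\|\le\rho\|f\|+K\|f\|_{L^1(m)}$ for all $f\in\mathcal{B}$; (6) $1$ is a simple isolated eigenvalue of $P$ on $\mathcal{B}$ and there is no other eigenvalue on the unit circle. Then there is a unique stationary probability measure absolutely continuous with respect to $m$, denoted $\mu$, with density $h\in\mathcal{B}$, $Ph=h$. There is also a Banach space $\mathcal{B}_0\subset L^1(m)$ with norm $\|\cdot\|_0$ and a constant $C>0$ with $\|fg\|\le C\|f\|_0\|g\|$ for all $f\in\mathcal{B}_0$, $g\in\mathcal{B}$. Observable. $\varphi\in\mathcal{B}_0$ is a bounded real function with $\int_X\varphi\,d\mu=0$; $X_k(\underline\omega,x)=\varphi(T_{\omega_k}\cdots T_{\omega_1}x)$ (with $X_0=\varphi(x)$), $S_n=\sum_{k=0}^{n-1}X_k$, and $\sigma^2=\lim_{n\to\infty}\frac1n\mathbb{E}_{\tilde{\mathbb{P}}\otimes\mu}(S_n^2)=\int_X\varphi^2\,d\mu+2\sum_{n=1}^\infty\int_X\varphi\,U^n\varphi\,d\mu$ (the limit exists under these assumptions). $\mathcal{M}_{\mathcal{B}}$ is the set of probability measures on $(X,\mathcal{A})$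 that are absolutely continuous with respect to $m$ with density in $\mathcal{B}$. *)

theory Defs
  imports "HOL-Probability.Probability"
begin

section \<open>Random systems and transfer operators\<close>

text \<open>
  Elements of $L^1(m)$ are represented by integrable functions, and two functions represent
  the same element iff they agree almost everywhere. Only the values on \<^term>\<open>space m\<close> matter.
\<close>

definition L1_norm :: "'x measure \<Rightarrow> ('x \<Rightarrow> complex) \<Rightarrow> real" where
  "L1_norm m f = (\<integral>x. norm (f x) \<partial>m)"

definition Linf :: "'x measure \<Rightarrow> ('x \<Rightarrow> complex) set" where
  "Linf m = {g \<in> borel_measurable m. \<exists>C. AE x in m. norm (g x) \<le> C}"

definition is_transfer_operator ::
    "'x measure \<Rightarrow> ('x \<Rightarrow> 'x) \<Rightarrow> (('x \<Rightarrow> complex) \<Rightarrow> 'x \<Rightarrow> complex) \<Rightarrow> bool" where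
  "is_transfer_operator m S L \<longleftrightarrow>
     (\<forall>f. integrable m f \<longrightarrow> integrable m (L f) \<and>
        (\<forall>g \<in> Linf m. (\<integral>x. L f x * g x \<partial>m) = (\<integral>x. f x * g (S x) \<partial>m)))"

text \<open>
  \<open>Pw \<omega>\<close> is the transfer operator of \<open>T \<omega>\<close>. It is determined by \<open>T \<omega>\<close> up to null sets depending
  on \<open>\<omega>\<close>, so the pointwise integral \<open>\<integral>\<omega>. Pw \<omega> f x \<partial>\<Omega>\<close> is meaningful only for versions that are
  jointly measurable in \<open>(\<omega>, x)\<close>; for those it is independent of the version, almost everywhere.
\<close>

locale random_system =
  Omega: prob_space \<Omega> + X: prob_space m
  for \<Omega> :: "'w measure" and m :: "'x measure" +
  fixes T :: "'w \<Rightarrow> 'x \<Rightarrow> 'x"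
    and Pw :: "'w \<Rightarrow> ('x \<Rightarrow> complex) \<Rightarrow> 'x \<Rightarrow> complex"
  assumes T_measurable: "(\<lambda>(\<omega>, x). T \<omega> x) \<in> \<Omega> \<Otimes>\<^sub>M m \<rightarrow>\<^sub>M m"
    and T_nonsingular:
      "\<And>\<omega> A. \<omega> \<in> space \<Omega> \<Longrightarrow> A \<in> null_sets m \<Longrightarrow> T \<omega> -` A \<inter> space m \<in> null_sets m"
    and Pw_transfer: "\<And>\<omega>. \<omega> \<in> space \<Omega> \<Longrightarrow> is_transfer_operator m (T \<omega>) (Pw \<omega>)"
    and Pw_measurable:
      "\<And>f. integrable m f \<Longrightarrow> (\<lambda>(\<omega>, x). Pw \<omega> f x) \<in> borel_measurable (\<Omega> \<Otimes>\<^sub>M m)"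

definition annealed ::
    "'w measure \<Rightarrow> ('w \<Rightarrow> ('x \<Rightarrow> complex) \<Rightarrow> 'x \<Rightarrow> complex) \<Rightarrow> ('x \<Rightarrow> complex) \<Rightarrow> 'x \<Rightarrow> complex" where
  "annealed \<Omega> Pw f = (\<lambda>x. \<integral>\<omega>. Pw \<omega> f x \<partial>\<Omega>)"

definition stationary :: "'w measure \<Rightarrow> 'x measure \<Rightarrow> ('w \<Rightarrow> 'x \<Rightarrow> 'x) \<Rightarrow> 'x measure \<Rightarrow> bool" where
  "stationary \<Omega> m T \<mu> \<longleftrightarrow> prob_space \<mu> \<and> sets \<mu> = sets m \<and>
     (\<forall>A \<in> sets m. measure \<mu> A = (\<integral>\<omega>. measure \<mu> (T \<omega> -` A \<inter> space m) \<partial>\<Omega>))"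


section \<open>Banach spaces of functions\<close>

text \<open>
  A Banach space whose elements are elements of $L^1(m)$: the carrier \<open>B\<close> contains all measurable
  representatives, and \<open>nrm\<close> is a norm modulo equality almost everywhere.
\<close>

locale banach_function_space =
  fixes m :: "'x measure" and B :: "('x \<Rightarrow> complex) set" and nrm :: "('x \<Rightarrow> complex) \<Rightarrow> real"
  assumes B_integrable: "\<And>f. f \<in> B \<Longrightarrow> integrable m f"
    and B_AE: "\<And>f g. f \<in> B \<Longrightarrow> g \<in> borel_measurable m \<Longrightarrow> (AE x in m. f x = g x) \<Longrightarrow> g \<in> B"
    and B_zero: "(\<lambda>x. 0) \<in> B"
    and B_add: "\<And>f g. f \<in> B \<Longrightarrow> g \<in> B \<Longrightarrow> (\<lambda>x. f x + g x) \<in> B"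
    and B_scale: "\<And>f c. f \<in> B \<Longrightarrow> (\<lambda>x. c * f x) \<in> B"
    and nrm_nonneg: "\<And>f. f \<in> B \<Longrightarrow> 0 \<le> nrm f"
    and nrm_zero: "\<And>f. f \<in> B \<Longrightarrow> nrm f = 0 \<longleftrightarrow> (AE x in m. f x = 0)"
    and nrm_triangle: "\<And>f g. f \<in> B \<Longrightarrow> g \<in> B \<Longrightarrow> nrm (\<lambda>x. f x + g x) \<le> nrm f + nrm g"
    and nrm_scale: "\<And>f c. f \<in> B \<Longrightarrow> nrm (\<lambda>x. c * f x) = norm c * nrm f"
    and B_complete: "\<And>u :: nat \<Rightarrow> 'x \<Rightarrow> complex. (\<And>n. u n \<in> B) \<Longrightarrow>
          (\<forall>e>0. \<exists>M. \<forall>i\<ge>M. \<forall>j\<ge>M. nrm (\<lambda>x. u i x - u j x) < e) \<Longrightarrow>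
          \<exists>f\<in>B. (\<lambda>n. nrm (\<lambda>x. u n x - f x)) \<longlonglongrightarrow> 0"

definition compactly_embedded_L1 ::
    "'x measure \<Rightarrow> ('x \<Rightarrow> complex) set \<Rightarrow> (('x \<Rightarrow> complex) \<Rightarrow> real) \<Rightarrow> bool" where
  "compactly_embedded_L1 m B nrm \<longleftrightarrow>
     (\<exists>C. \<forall>f\<in>B. L1_norm m f \<le> C * nrm f) \<and>
     (\<forall>u :: nat \<Rightarrow> 'x \<Rightarrow> complex. (\<forall>n. u n \<in> B) \<and> (\<exists>C. \<forall>n. nrm (u n) \<le> C) \<longrightarrow>
        (\<exists>r f. strict_mono (r :: nat \<Rightarrow> nat) \<and> integrable m f \<and>
               (\<lambda>n. L1_norm m (\<lambda>x. u (r n) x - f x)) \<longlonglongrightarrow> 0))"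


section \<open>Spectral notions for an operator on a space of functions modulo null sets\<close>

definition eigenvalue ::
    "'x measure \<Rightarrow> ('x \<Rightarrow> complex) set \<Rightarrow> (('x \<Rightarrow> complex) \<Rightarrow> 'x \<Rightarrow> complex) \<Rightarrow> complex \<Rightarrow> bool" where
  "eigenvalue m B L z \<longleftrightarrow>
     (\<exists>f\<in>B. \<not> (AE x in m. f x = 0) \<and> (AE x in m. L f x = z * f x))"

text \<open>Simple means algebraically simple: the generalized eigenspace is one-dimensional.\<close>

definition simple_eigenvalue ::
    "'x measure \<Rightarrow> ('x \<Rightarrow> complex) set \<Rightarrow> (('x \<Rightarrow> complex) \<Rightarrow> 'x \<Rightarrow> complex) \<Rightarrow> complex \<Rightarrow> bool" where
  "simple_eigenvalue m B L z \<longleftrightarrow>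
     (\<exists>h\<in>B. \<not> (AE x in m. h x = 0) \<and> (AE x in m. L h x = z * h x) \<and>
        (\<forall>k. \<forall>f\<in>B. (AE x in m. ((\<lambda>g y. L g y - z * g y) ^^ k) f x = 0) \<longrightarrow>
               (\<exists>c. AE x in m. f x = c * h x)))"

definition in_resolvent_set ::
    "'x measure \<Rightarrow> ('x \<Rightarrow> complex) set \<Rightarrow> (('x \<Rightarrow> complex) \<Rightarrow> real) \<Rightarrow>
     (('x \<Rightarrow> complex) \<Rightarrow> 'x \<Rightarrow> complex) \<Rightarrow> complex \<Rightarrow> bool" where
  "in_resolvent_set m B nrm L z \<longleftrightarrow>
     (\<forall>g\<in>B. \<exists>f\<in>B. AE x in m. z * f x - L f x = g x) \<and>
     (\<exists>C. \<forall>f\<in>B. nrm f \<le> C * nrm (\<lambda>x. z * f x - L f x))"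

definition isolated_in_spectrum ::
    "'x measure \<Rightarrow> ('x \<Rightarrow> complex) set \<Rightarrow> (('x \<Rightarrow> complex) \<Rightarrow> real) \<Rightarrow>
     (('x \<Rightarrow> complex) \<Rightarrow> 'x \<Rightarrow> complex) \<Rightarrow> complex \<Rightarrow> bool" where
  "isolated_in_spectrum m B nrm L z \<longleftrightarrow> \<not> in_resolvent_set m B nrm L z \<and>
     (\<exists>r>0. \<forall>w. 0 < dist w z \<and> dist w z < r \<longrightarrow> in_resolvent_set m B nrm L w)"


section \<open>Standing assumptions\<close>

locale spectral_random_system =
  random_system \<Omega> m T Pw + banach_function_space m B nrm
  for \<Omega> :: "'w measure" and m :: "'x measure" and T Pw B nrm +
  assumes compact_embedding: "compactly_embedded_L1 m B nrm"
    and constants: "(\<lambda>x. c) \<in> B"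
    and lattice: "f \<in> B \<Longrightarrow> (\<lambda>x. complex_of_real (norm (f x))) \<in> B"
                 "f \<in> B \<Longrightarrow> (\<lambda>x. cnj (f x)) \<in> B"
    and P_invariant: "f \<in> B \<Longrightarrow> annealed \<Omega> Pw f \<in> B"
    and P_bounded: "\<exists>C. \<forall>f\<in>B. nrm (annealed \<Omega> Pw f) \<le> C * nrm f"
    and lasota_yorke: "\<exists>N \<rho> K. 1 \<le> N \<and> \<rho> < 1 \<and> 0 \<le> K \<and>
          (\<forall>f\<in>B. nrm ((annealed \<Omega> Pw ^^ N) f) \<le> \<rho> * nrm f + K * L1_norm m f)"
    and simple: "simple_eigenvalue m B (annealed \<Omega> Pw) 1"
    and isolated: "isolated_in_spectrum m B nrm (annealed \<Omega> Pw) 1"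
    and no_other: "norm z = 1 \<Longrightarrow> eigenvalue m B (annealed \<Omega> Pw) z \<Longrightarrow> z = 1"

locale multiplier_space = banach_function_space m B0 nrm0
  for m :: "'x measure" and B nrm B0 nrm0 +
  assumes multiplier: "\<exists>C>0. \<forall>f\<in>B0. \<forall>g\<in>B.
    (\<lambda>x. f x * g x) \<in> B \<and> nrm (\<lambda>x. f x * g x) \<le> C * nrm0 f * nrm g"

definition measures_with_density_in :: "'x measure \<Rightarrow> ('x \<Rightarrow> complex) set \<Rightarrow> 'x measure set" where
  "measures_with_density_in m B = {\<nu>. prob_space \<nu> \<and>
     (\<exists>h :: 'x \<Rightarrow> real. (\<forall>x\<in>space m. 0 \<le> h x) \<and> (\<lambda>x. complex_of_real (h x)) \<in> B \<and>
        \<nu> = density m (\<lambda>x. ennreal (h x)))}"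


section \<open>Birkhoff sums and their variance\<close>

definition noise :: "'w measure \<Rightarrow> (nat \<Rightarrow> 'w) measure" where
  "noise \<Omega> = Pi\<^sub>M UNIV (\<lambda>_. \<Omega>)"

text \<open>
  Sequences are indexed from 0, so \<open>w k\<close> is the noise usually written $\omega_{k+1}$ and
  \<open>orbit T w x k\<close> is $T_{\omega_k} \cdots T_{\omega_1} x$.
\<close>

primrec orbit :: "('w \<Rightarrow> 'x \<Rightarrow> 'x) \<Rightarrow> (nat \<Rightarrow> 'w) \<Rightarrow> 'x \<Rightarrow> nat \<Rightarrow> 'x" where
  "orbit T w x 0 = x"
| "orbit T w x (Suc k) = T (w k) (orbit T w x k)"

definition birkhoff_sum ::
    "('w \<Rightarrow> 'x \<Rightarrow> 'x) \<Rightarrow> ('x \<Rightarrow> real) \<Rightarrow> nat \<Rightarrow> (nat \<Rightarrow> 'w) \<times> 'x \<Rightarrow> real" where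
  "birkhoff_sum T \<phi> n = (\<lambda>(w, x). \<Sum>k<n. \<phi> (orbit T w x k))"

definition asymptotic_variance ::
    "'w measure \<Rightarrow> ('w \<Rightarrow> 'x \<Rightarrow> 'x) \<Rightarrow> 'x measure \<Rightarrow> ('x \<Rightarrow> real) \<Rightarrow> real" where
  "asymptotic_variance \<Omega> T \<mu> \<phi> =
     lim (\<lambda>n. (1 / real n) * (\<integral>p. (birkhoff_sum T \<phi> n p)\<^sup>2 \<partial>(noise \<Omega> \<Otimes>\<^sub>M \<mu>)))"

definition strictly_convex_on :: "real set \<Rightarrow> (real \<Rightarrow> real) \<Rightarrow> bool" where
  "strictly_convex_on I c \<longleftrightarrow> convex I \<and>
     (\<forall>x\<in>I. \<forall>y\<in>I. \<forall>t. x \<noteq> y \<and> 0 < t \<and> t < 1 \<longrightarrow>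
        c ((1 - t) * x + t * y) < (1 - t) * c x + t * c y)"

end

theory Submission
  imports Defs "HOL-Complex_Analysis.Complex_Analysis" "HOL-Library.Function_Algebras"
begin

text \<open>
  Write \<open>P\<close> for the annealed operator, \<open>h\<close> for the density of \<open>\<mu>\<close>, and let
  \<open>P\<^sub>z f = P (exp (z \<phi>) f)\<close> be the twisted operator. Iterating the duality between transfer and
  Koopman operators, and integrating out one coordinate of the noise at a time, gives
  \<open>E\<^sub>\<nu> exp (z S\<^sub>n) = \<integral> P\<^sub>z\<^sup>n k dm\<close> when \<open>\<nu>\<close> has density \<open>k\<close> (\<open>twisted_moment\<close>). The theorem is a
  statement about the exponential growth of these moments for \<open>z\<close> near 0, followed by a Legendre
  transform.

  Growth at \<open>z = 0\<close>. On the functions of integral 0 there is no eigenvector of \<open>P\<close> with an eigenvalue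
  of modulus 1. The Lasota-Yorke inequality turns convergence in \<open>L\<^sup>1\<close> of approximate eigenvectors
  into convergence in \<open>B\<close>, so by compactness \<open>1 - w P\<close> is bounded below there, uniformly in
  \<open>\<bar>w\<bar> = 1\<close> (\<open>circle_bound_of_no_peripheral_eigenvalue\<close>). An averaging over roots of unity upgrades
  this to \<open>n \<parallel>P\<^sup>n f\<parallel> \<le> D \<parallel>f\<parallel>\<close> (\<open>power_decay_of_circle_bound\<close>), hence some power of \<open>P\<close> contracts.

  Growth for small \<open>z\<close>. Since \<open>\<phi>\<close> is a multiplier, \<open>P\<^sub>z\<close> is close to \<open>P\<close> in operator norm. For an
  operator \<open>L\<close> close to \<open>P\<close> the normalised map \<open>f \<mapsto> L f / \<integral> L f dm\<close> is a contraction of a ball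
  around \<open>h\<close> in the affine hyperplane of functions of integral 1 (\<open>perturbed_ratios\<close>). So the
  quotients of consecutive moments converge exponentially fast, uniformly for complex \<open>z\<close> near 0,
  and the limit does not depend on the initial density. The moments are entire functions of \<open>z\<close>;
  by Weierstrass' theorem the limit \<open>G (z)\<close> of \<open>1/n log E exp (z S\<^sub>n)\<close> is holomorphic and the limit may
  be differentiated term by term, which gives \<open>G' (0) = 0\<close> and identifies \<open>G'' (0)\<close> with the asymptotic
  variance (\<open>analytic_pressure\<close>).

  Large deviations. Near 0 the real function \<open>\<Lambda> (\<theta>) = G (\<theta>)\<close> is strictly convex because its second
  derivative is positive at 0. Its Legendre transform is the rate function. Chebyshev's inequality
  gives the upper bound, and the usual change of measure gives the lower bound; only exponential
  moments near the tilted parameter enter (\<open>large_deviations\<close>). The radius within which the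
  contraction argument applies to \<open>P\<^sub>z\<close> may shrink as the norm of \<open>k - h\<close> grows, which is why the range
  of \<open>\<epsilon>\<close> depends on \<open>\<nu>\<close>.
\<close>

section \<open>A spectral gap from a Lasota-Yorke inequality\<close>

text \<open>
  The vectors below are classes of functions modulo null sets, and the arguments use several norms on
  one space as well as one norm on a subspace. For this reason the space is a subset \<open>V\<close> of an
  ambient vector space and its norm \<open>p\<close> is a parameter, not part of a type class.
\<close>

locale normed_subspace = vector_space scale
  for scale :: "complex \<Rightarrow> 'v::ab_group_add \<Rightarrow> 'v" (infixr "*c" 75) +
  fixes V :: "'v set" and p :: "'v \<Rightarrow> real"
  assumes zero_mem: "0 \<in> V"
    and add_mem: "x \<in> V \<Longrightarrow> y \<in> V \<Longrightarrow> x + y \<in> V"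
    and scale_mem: "x \<in> V \<Longrightarrow> c *c x \<in> V"
    and norm_add: "x \<in> V \<Longrightarrow> y \<in> V \<Longrightarrow> p (x + y) \<le> p x + p y"
    and norm_scale: "x \<in> V \<Longrightarrow> p (c *c x) = cmod c * p x"
    and norm_zeroD: "x \<in> V \<Longrightarrow> p x = 0 \<Longrightarrow> x = 0"
begin

lemma uminus_mem: "x \<in> V \<Longrightarrow> - x \<in> V"
  using scale_mem[of x "-1"] by (simp add: scale_minus_left)

lemma diff_mem: "x \<in> V \<Longrightarrow> y \<in> V \<Longrightarrow> x - y \<in> V"
  using add_mem[of x "- y"] uminus_mem[of y] by simp

lemma sum_mem: "(\<And>i. i \<in> I \<Longrightarrow> f i \<in> V) \<Longrightarrow> (\<Sum>i\<in>I. f i) \<in> V"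
  by (induction I rule: infinite_finite_induct) (auto intro: add_mem zero_mem)

lemmas mem = zero_mem add_mem scale_mem uminus_mem diff_mem sum_mem

lemma norm_zero [simp]: "p 0 = 0"
  using norm_scale[OF zero_mem, of 0] by simp

lemma norm_uminus: "x \<in> V \<Longrightarrow> p (- x) = p x"
  using norm_scale[of x "-1"] by (simp add: scale_minus_left)

lemma norm_nonneg: "x \<in> V \<Longrightarrow> 0 \<le> p x"
  using norm_add[of x "- x"] by (simp add: norm_uminus uminus_mem)

lemma norm_diff: "x \<in> V \<Longrightarrow> y \<in> V \<Longrightarrow> p (x - y) \<le> p x + p y"
  using norm_add[of x "- y"] by (simp add: norm_uminus uminus_mem)

lemma norm_triangle_diff: "x \<in> V \<Longrightarrow> y \<in> V \<Longrightarrow> p x \<le> p y + p (x - y)"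
  using norm_add[of y "x - y"] by (simp add: mem)

lemma norm_sum: "(\<And>i. i \<in> I \<Longrightarrow> f i \<in> V) \<Longrightarrow> p (\<Sum>i\<in>I. f i) \<le> (\<Sum>i\<in>I. p (f i))"
proof (induction I rule: infinite_finite_induct)
  case (insert i I)
  then show ?case using norm_add[of "f i" "\<Sum>i\<in>I. f i"] by (auto simp: sum_mem)
qed auto

definition operator :: "('v \<Rightarrow> 'v) \<Rightarrow> real \<Rightarrow> bool" where
  "operator L C \<longleftrightarrow> (\<forall>x\<in>V. L x \<in> V \<and> p (L x) \<le> C * p x) \<and>
     (\<forall>x\<in>V. \<forall>y\<in>V. L (x + y) = L x + L y) \<and> (\<forall>c. \<forall>x\<in>V. L (c *c x) = c *c L x)"

lemma
  assumes "operator L C" and x: "x \<in> V"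
  shows operator_mem: "L x \<in> V" and operator_bound: "p (L x) \<le> C * p x"
    and operator_scale: "L (c *c x) = c *c L x"
    and operator_add: "y \<in> V \<Longrightarrow> L (x + y) = L x + L y"
  using assms unfolding operator_def by auto

lemma operator_zero: "operator L C \<Longrightarrow> L 0 = 0"
  using operator_scale[of L C 0 0] zero_mem by simp

lemma operator_uminus: "operator L C \<Longrightarrow> x \<in> V \<Longrightarrow> L (- x) = - L x"
  using operator_scale[of L C x "-1"] by (simp add: scale_minus_left)

lemma operator_diff: "operator L C \<Longrightarrow> x \<in> V \<Longrightarrow> y \<in> V \<Longrightarrow> L (x - y) = L x - L y"
  using operator_add[of L C x "- y"] by (simp add: operator_uminus uminus_mem)

lemma operator_sum:
  "operator L C \<Longrightarrow> (\<And>i. i \<in> I \<Longrightarrow> f i \<in> V) \<Longrightarrow> L (\<Sum>i\<in>I. f i) = (\<Sum>i\<in>I. L (f i))"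
  by (induction I rule: infinite_finite_induct)
    (auto simp: operator_zero operator_add sum_mem)

lemma operator_mono:
  assumes "operator L C" "C \<le> C'"
  shows "operator L C'"
  unfolding operator_def
proof (intro conjI ballI allI)
  fix x assume x: "x \<in> V"
  show "p (L x) \<le> C' * p x"
    using operator_bound[OF assms(1) x] mult_right_mono[OF assms(2) norm_nonneg[OF x]] by linarith
qed (use assms(1) in \<open>auto simp: operator_def\<close>)

lemma operator_funpow:
  assumes "operator L C" "0 \<le> C"
  shows "operator (L ^^ n) (C ^ n)"
proof (induction n)
  case 0 show ?case by (simp add: operator_def)
next
  case (Suc n)
  have "p (L ((L ^^ n) x)) \<le> C * C ^ n * p x" if "x \<in> V" for x
    using operator_bound[OF assms(1), of "(L ^^ n) x"] operator_mem[OF Suc that]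
      mult_left_mono[OF operator_bound[OF Suc that] assms(2)] by (simp add: mult.assoc)
  with Suc assms(1) show ?case unfolding operator_def by auto
qed

lemma funpow_mem: "operator L C \<Longrightarrow> x \<in> V \<Longrightarrow> (L ^^ n) x \<in> V"
  by (induction n) (auto simp: operator_mem)

lemma sum_roots_of_unity:
  fixes n a :: nat
  assumes "1 \<le> n"
  shows "(\<Sum>l<n. exp (2 * of_real pi * \<i> * of_nat l / of_nat n) ^ a)
    = (if n dvd a then of_nat n else (0::complex))"
proof -
  let ?z = "exp (2 * of_real pi * \<i> * of_nat a / of_nat n) :: complex"
  have pw: "exp (2 * of_real pi * \<i> * of_nat l / of_nat n) ^ a = ?z ^ l" for l
    by (simp add: exp_of_nat_mult[symmetric] mult_ac)
  have "?z ^ n = 1"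
    using assms by (simp add: exp_of_nat_mult[symmetric])
      (metis complex_root_unity_eq_1 mult.assoc mult.commute exp_of_nat2_mult exp_two_pi_i power_one)
  moreover have "?z = 1 \<longleftrightarrow> n dvd a"
    by (rule complex_root_unity_eq_1[OF assms])
  ultimately show ?thesis
    unfolding pw by (auto simp: sum_gp_strict)
qed

text \<open>
  Let \<open>S\<^sub>w = (\<Sum>j<n. w\<^sup>j P\<^sup>j)\<close>. The telescoping identity \<open>(1 - w P) S\<^sub>w = 1 - w\<^sup>n P\<^sup>n\<close> and the lower bound
  for \<open>1 - w P\<close> show that \<open>S\<^sub>w\<close>, and therefore \<open>S\<^sub>w\<^sup>2\<close>, is bounded independently of \<open>n\<close> and \<open>w\<close>. In the
  square, \<open>P\<^sup>n\<^sup>-\<^sup>1\<close> has coefficient \<open>n w\<^sup>n\<^sup>-\<^sup>1\<close>, and averaging over the \<open>n\<close>-th roots of unity \<open>w\<close> extracts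
  this single term. Hence \<open>n P\<^sup>n\<^sup>-\<^sup>1\<close> is bounded.
\<close>

lemma power_decay_of_circle_bound:
  assumes P: "operator P C" and A0: "0 \<le> A" and A: "\<And>n x. x \<in> V \<Longrightarrow> p ((P ^^ n) x) \<le> A * p x"
    and c: "c > 0" "\<And>z x. cmod z = 1 \<Longrightarrow> x \<in> V \<Longrightarrow> c * p x \<le> p (x - z *c P x)"
  shows "\<exists>D. \<forall>n. \<forall>x\<in>V. real (Suc n) * p ((P ^^ n) x) \<le> D * p x"
proof (intro exI allI ballI)
  fix k :: nat and x assume x: "x \<in> V"
  define n where "n = Suc k"
  define S where "S = (\<lambda>w y. \<Sum>j<n. w ^ j *c (P ^^ j) y)"
  define E where "E = (1 + A) / c"
  have S_mem: "S w y \<in> V" if "y \<in> V" for w y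
    unfolding S_def using that by (intro mem funpow_mem[OF P])
  have S_bound: "p (S w y) \<le> E * p y" if w: "cmod w = 1" and y: "y \<in> V" for w y
  proof -
    have Pm: "(P ^^ j) y \<in> V" for j by (rule funpow_mem[OF P y])
    have "w *c P (S w y) = (\<Sum>j<n. w ^ Suc j *c (P ^^ Suc j) y)"
      unfolding S_def using Pm
      by (simp add: operator_sum[OF P] operator_scale[OF P] mem scale_sum_right)
    then have "S w y - w *c P (S w y) = (\<Sum>j<n. w ^ j *c (P ^^ j) y - w ^ Suc j *c (P ^^ Suc j) y)"
      unfolding S_def by (simp only: sum_subtractf)
    also have "\<dots> = y - w ^ n *c (P ^^ n) y"
      using sum_lessThan_telescope'[of "\<lambda>j. w ^ j *c (P ^^ j) y" n] by simp
    finally have eq: "S w y - w *c P (S w y) = y - w ^ n *c (P ^^ n) y" .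
    have "p (y - w ^ n *c (P ^^ n) y) \<le> p y + p (w ^ n *c (P ^^ n) y)"
      by (intro norm_diff mem y Pm)
    also have "\<dots> \<le> (1 + A) * p y"
      using A[OF y, of n] by (simp add: norm_scale[OF Pm] norm_power w algebra_simps)
    finally have "c * p (S w y) \<le> (1 + A) * p y"
      using c(2)[OF w S_mem[OF y], of w] by (simp add: eq)
    then show ?thesis using \<open>c > 0\<close> unfolding E_def by (simp add: field_simps)
  qed
  have "0 \<le> E" using A0 c(1) by (simp add: E_def)
  then have SS: "p (S w (S w x)) \<le> E\<^sup>2 * p x" if "cmod w = 1" for w
    using order_trans[OF S_bound[OF that S_mem[OF x]] mult_left_mono[OF S_bound[OF that x]]]
    by (simp add: power2_eq_square mult.assoc)
  define w where "w = (\<lambda>l. exp (2 * of_real pi * \<i> * of_nat l / of_nat n) :: complex)"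
  have w1: "cmod (w l) = 1" for l
    unfolding w_def by (simp add: norm_exp_eq_Re)
  have SS_eq: "S v (S v x) = (\<Sum>i<n. \<Sum>j<n. v ^ (i + j) *c (P ^^ (i + j)) x)" for v
  proof -
    have "(P ^^ i) (S v x) = (\<Sum>j<n. v ^ j *c (P ^^ (i + j)) x)" for i
      unfolding S_def by (induction i)
        (auto simp: operator_sum[OF P] operator_scale[OF P] mem funpow_mem[OF P x])
    moreover have "S v (S v x) = (\<Sum>i<n. v ^ i *c (P ^^ i) (S v x))"
      by (simp only: S_def)
    ultimately show ?thesis by (simp add: scale_sum_right power_add)
  qed
  have "(\<Sum>l<n. w l *c S (w l) (S (w l) x)) = (\<Sum>i<n. \<Sum>j<n. (\<Sum>l<n. w l ^ (Suc (i + j))) *c (P ^^ (i + j)) x)"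
  proof -
    let ?g = "\<lambda>l i j. w l ^ Suc (i + j) *c (P ^^ (i + j)) x"
    have "(\<Sum>l<n. w l *c S (w l) (S (w l) x)) = (\<Sum>l<n. \<Sum>i<n. \<Sum>j<n. ?g l i j)"
      unfolding SS_eq by (simp add: scale_sum_right)
    also have "\<dots> = (\<Sum>i<n. \<Sum>l<n. \<Sum>j<n. ?g l i j)" by (rule sum.swap)
    also have "\<dots> = (\<Sum>i<n. \<Sum>j<n. \<Sum>l<n. ?g l i j)" by (intro sum.cong refl sum.swap)
    finally show ?thesis by (simp only: scale_sum_left)
  qed
  also have "\<dots> = (\<Sum>i<n. \<Sum>j<n. if j = k - i then of_nat n *c (P ^^ k) x else 0)"
  proof (intro sum.cong refl)
    fix i j assume ij: "i \<in> {..<n}" "j \<in> {..<n}"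
    (* The exponent i + j + 1 lies between 1 and 2 n - 1, so n divides it only if it equals n. *)
    have "n dvd Suc (i + j) \<longleftrightarrow> i + j = k"
    proof
      assume "n dvd Suc (i + j)"
      then obtain a where a: "Suc (i + j) = n * a" ..
      have "n * a < n * 2" unfolding a[symmetric] using ij by simp
      then have "a < 2" by simp
      moreover have "a \<noteq> 0" using a by (cases a) auto
      ultimately have "a = 1" by auto
      then show "i + j = k" using a by (simp add: n_def)
    qed (simp add: n_def)
    also have "\<dots> \<longleftrightarrow> j = k - i" using ij by (auto simp: n_def)
    finally show "(\<Sum>l<n. w l ^ (Suc (i + j))) *c (P ^^ (i + j)) x
        = (if j = k - i then of_nat n *c (P ^^ k) x else 0)"
      using ij unfolding w_def by (subst sum_roots_of_unity) (auto simp: n_def)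
  qed
  also have "\<dots> = (of_nat n * of_nat n) *c (P ^^ k) x"
  proof -
    have "(\<Sum>j<n. if j = k - i then of_nat n *c (P ^^ k) x else 0) = of_nat n *c (P ^^ k) x" for i
      by (simp add: sum.delta) (simp add: n_def less_Suc_eq_le)
    then show ?thesis by (simp add: sum_constant_scale)
  qed
  finally have "p ((of_nat n * of_nat n) *c (P ^^ k) x) = p (\<Sum>l<n. w l *c S (w l) (S (w l) x))" by simp
  also have "\<dots> \<le> (\<Sum>l<n. p (w l *c S (w l) (S (w l) x)))"
    by (intro norm_sum mem S_mem x)
  also have "\<dots> \<le> (\<Sum>l<n. E\<^sup>2 * p x)"
    by (intro sum_mono) (simp add: norm_scale S_mem x w1 SS)
  also have "\<dots> = real n * (E\<^sup>2 * p x)" by simp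
  finally show "real (Suc k) * p ((P ^^ k) x) \<le> E\<^sup>2 * p x"
    by (simp add: norm_scale funpow_mem[OF P x] norm_mult n_def mult.assoc del: of_nat_Suc)
qed

text \<open>
  Iterating the inequality along multiples of \<open>N\<close> produces a geometric series in \<open>\<rho>\<close>, because the weak
  norm \<open>q\<close> does not increase under \<open>P\<close>; the remaining fewer than \<open>N\<close> steps cost a constant factor.
\<close>

lemma power_bounded_of_lasota_yorke:
  assumes P: "operator P C" and N: "1 \<le> N"
    and LY: "0 \<le> \<rho>" "\<rho> < 1" "0 \<le> K" "\<And>x. x \<in> V \<Longrightarrow> p ((P ^^ N) x) \<le> \<rho> * p x + K * q x"
    and q: "\<And>x. x \<in> V \<Longrightarrow> 0 \<le> q x" "\<And>x. x \<in> V \<Longrightarrow> q x \<le> Cq * p x"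
      "\<And>x. x \<in> V \<Longrightarrow> q (P x) \<le> q x"
  shows "\<exists>A\<ge>0. \<forall>n. \<forall>x\<in>V. p ((P ^^ n) x) \<le> A * p x"
proof -
  define C' where "C' = max C 1"
  have P': "operator P C'" using operator_mono[OF P, of C'] by (simp add: C'_def)
  have C1: "1 \<le> C'" by (simp add: C'_def)
  define D where "D = 1 + K * \<bar>Cq\<bar> / (1 - \<rho>)"
  have D0: "0 \<le> D" using LY by (simp add: D_def)
  have q_pow: "q ((P ^^ n) x) \<le> q x" if "x \<in> V" for n x
  proof (induction n)
    case (Suc n) then show ?case using q(3)[OF funpow_mem[OF P that, of n]] by simp
  qed simp
  have multiples: "p ((P ^^ (N * j)) x) \<le> p x + K * q x / (1 - \<rho>)" if x: "x \<in> V" for x j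
  proof (induction j)
    case 0 show ?case using q(1)[OF x] LY by simp
  next
    case (Suc j)
    let ?y = "(P ^^ (N * j)) x" and ?X = "p x + K * q x / (1 - \<rho>)"
    have "p ((P ^^ (N * Suc j)) x) = p ((P ^^ N) ?y)"
      by (simp add: funpow_add)
    also have "\<dots> \<le> \<rho> * p ?y + K * q ?y" by (intro LY funpow_mem[OF P x])
    also have "\<dots> \<le> \<rho> * ?X + K * q x"
      by (intro add_mono mult_left_mono Suc LY q_pow x)
    also have "\<dots> = \<rho> * p x + K * q x / (1 - \<rho>)" using LY by (simp add: field_simps)
    also have "\<dots> \<le> ?X" using mult_right_mono[of \<rho> 1 "p x"] LY norm_nonneg[OF x] by simp
    finally show ?case .
  qed
  have mult': "p ((P ^^ (N * j)) x) \<le> D * p x" if x: "x \<in> V" for x j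
  proof -
    have "q x \<le> \<bar>Cq\<bar> * p x"
      using q(2)[OF x] mult_right_mono[OF abs_ge_self[of Cq] norm_nonneg[OF x]] by linarith
    then have "K * q x / (1 - \<rho>) \<le> K * (\<bar>Cq\<bar> * p x) / (1 - \<rho>)"
      using LY by (intro divide_right_mono mult_left_mono) auto
    then show ?thesis using multiples[OF x, of j] by (simp add: D_def algebra_simps)
  qed
  have "p ((P ^^ n) x) \<le> D * C' ^ N * p x" if x: "x \<in> V" for n x
  proof -
    have "(P ^^ n) x = (P ^^ (N * (n div N))) ((P ^^ (n mod N)) x)"
      by (metis comp_apply funpow_add mult_div_mod_eq)
    then have "p ((P ^^ n) x) \<le> D * p ((P ^^ (n mod N)) x)"
      using mult'[OF funpow_mem[OF P x]] by simp
    also have "\<dots> \<le> D * (C' ^ (n mod N) * p x)"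
      using C1 by (intro mult_left_mono D0 operator_bound[OF operator_funpow[OF P']] x) auto
    also have "\<dots> \<le> D * (C' ^ N * p x)"
      using C1 N by (intro mult_left_mono mult_right_mono D0 norm_nonneg x power_increasing) auto
    finally show ?thesis by simp
  qed
  then show ?thesis using D0 C1 by (intro exI[of _ "D * C' ^ N"]) auto
qed

text \<open>
  If the bound failed there would be unit vectors \<open>v\<^sub>k\<close> with \<open>v\<^sub>k - \<zeta> P v\<^sub>k\<close> tending to 0 for some
  \<open>\<bar>\<zeta>\<bar> = 1\<close>, and after passing to a subsequence \<open>v\<^sub>k\<close> would be a Cauchy sequence for the weak norm.
  Since \<open>v\<^sub>k\<close> is close to \<open>\<zeta>\<^sup>N P\<^sup>N v\<^sub>k\<close>, the Lasota-Yorke inequality applied to \<open>v\<^sub>i - v\<^sub>j\<close> can be solved for the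
  strong norm (fact \<open>close\<close>), so \<open>v\<^sub>k\<close> is a Cauchy sequence for the strong norm too. Its limit is a
  unit eigenvector.
\<close>

lemma circle_bound_of_no_peripheral_eigenvalue:
  assumes P: "operator P C" and N: "1 \<le> N" and A: "0 \<le> A" "\<And>n x. x \<in> V \<Longrightarrow> p ((P ^^ n) x) \<le> A * p x"
    and LY: "\<rho> < 1" "0 \<le> K" "\<And>x. x \<in> V \<Longrightarrow> p ((P ^^ N) x) \<le> \<rho> * p x + K * q x"
    and compact: "\<And>u :: nat \<Rightarrow> 'v. (\<And>n. u n \<in> V) \<Longrightarrow> (\<And>n. p (u n) \<le> 1) \<Longrightarrow>
      \<exists>r. strict_mono r \<and> (\<forall>e>0. \<exists>M. \<forall>i\<ge>M. \<forall>j\<ge>M. q (u (r i) - u (r (j::nat))) < e)"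
    and complete: "\<And>u :: nat \<Rightarrow> 'v. (\<And>n. u n \<in> V) \<Longrightarrow>
      (\<forall>e>0. \<exists>M. \<forall>i\<ge>M. \<forall>j\<ge>M. p (u i - u j) < e) \<Longrightarrow> \<exists>x\<in>V. (\<lambda>n. p (u n - x)) \<longlonglongrightarrow> 0"
    and no_eig: "\<And>z x. cmod z = 1 \<Longrightarrow> x \<in> V \<Longrightarrow> P x = z *c x \<Longrightarrow> x = 0"
  shows "\<exists>c>0. \<forall>z. \<forall>x\<in>V. cmod z = 1 \<longrightarrow> c * p x \<le> p (x - z *c P x)"
proof (rule ccontr)
  have P_mem: "P x \<in> V" and Pn_mem: "(P ^^ n) x \<in> V" if "x \<in> V" for x n
    using operator_mem[OF P] funpow_mem[OF P] that by auto
  assume contra: "\<not> ?thesis"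
  have "\<exists>z u. cmod z = 1 \<and> u \<in> V \<and> p u = 1 \<and> p (u - z *c P u) < inverse (Suc k)" for k :: nat
  proof -
    obtain z x where zx: "cmod z = 1" "x \<in> V" "p (x - z *c P x) < inverse (Suc k) * p x"
      using contra[simplified, rule_format, of "inverse (Suc k)"] by force
    then have px: "p x > 0"
      using norm_nonneg[of "x - z *c P x"] by (simp add: mem P_mem zero_less_mult_iff
        less_le_trans[of 0 "inverse (Suc k)"] del: of_nat_Suc)
        (smt (verit) norm_nonneg mult_nonneg_nonpos inverse_nonnegative_iff_nonnegative of_nat_0_le_iff)
    define u where "u = complex_of_real (inverse (p x)) *c x"
    have "u - z *c P u = complex_of_real (inverse (p x)) *c (x - z *c P x)"
      unfolding u_def using zx by (simp add: operator_scale[OF P] scale_right_diff_distrib mult.commute)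
    then have "p (u - z *c P u) = inverse (p x) * p (x - z *c P x)"
      using px zx by (simp add: norm_scale mem P_mem norm_inverse)
    also have "\<dots> < inverse (Suc k)"
      using zx(3) px by (simp add: field_simps)
    finally have "p (u - z *c P u) < inverse (Suc k)" .
    moreover have "u \<in> V" "p u = 1" using px zx by (auto simp: u_def mem norm_scale norm_inverse)
    ultimately show ?thesis using zx by blast
  qed
  then obtain z u where z: "\<And>k. cmod (z k) = 1" and u: "\<And>k. u k \<in> V" "\<And>k. p (u k) = 1"
    and zu: "\<And>k. p (u k - z k *c P (u k)) < inverse (Suc k)" by metis
  obtain \<zeta> r1 where \<zeta>: "cmod \<zeta> = 1" and r1: "strict_mono r1" and lim_z: "(z \<circ> r1) \<longlonglongrightarrow> \<zeta>"
  proof -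
    have "seq_compact (sphere (0::complex) 1)" by (intro compact_imp_seq_compact) simp
    then show ?thesis using that z unfolding seq_compact_def by (force simp: dist_norm)
  qed
  have "\<exists>r :: nat \<Rightarrow> nat. strict_mono r \<and> (\<forall>e>0. \<exists>M. \<forall>i\<ge>M. \<forall>j\<ge>M. q (u (r1 (r i)) - u (r1 (r j))) < e)"
    by (rule compact) (simp_all add: u)
  then obtain r2 :: "nat \<Rightarrow> nat" where r2: "strict_mono r2"
    and qC: "\<forall>e>0. \<exists>M. \<forall>i\<ge>M. \<forall>j\<ge>M. q (u (r1 (r2 i)) - u (r1 (r2 j))) < e"
    by blast
  define v where "v = (\<lambda>k. u (r1 (r2 k)))"
  have v: "v k \<in> V" "p (v k) = 1" for k using u by (auto simp: v_def)
  have r12: "strict_mono (\<lambda>k. r1 (r2 k))" using strict_mono_o[OF r1 r2] by (simp add: o_def)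
  have lim_z': "(\<lambda>k. z (r1 (r2 k))) \<longlonglongrightarrow> \<zeta>"
    using LIMSEQ_subseq_LIMSEQ[OF lim_z r2] by (simp add: o_def)
  define d where "d = (\<lambda>k. p (v k - \<zeta> *c P (v k)))"
  have d0: "0 \<le> d k" for k unfolding d_def using v by (intro norm_nonneg mem P_mem)
  have "d \<longlonglongrightarrow> 0"
  proof (rule tendsto_sandwich[of "\<lambda>_. 0" _ _ "\<lambda>k. inverse (real (Suc (r1 (r2 k)))) + cmod (z (r1 (r2 k)) - \<zeta>) * C"])
    show "\<forall>\<^sub>F k in sequentially. d k \<le> inverse (real (Suc (r1 (r2 k)))) + cmod (z (r1 (r2 k)) - \<zeta>) * C"
    proof (intro always_eventually allI)
      fix k
      let ?z = "z (r1 (r2 k))"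
      have eq: "v k - \<zeta> *c P (v k) = (v k - ?z *c P (v k)) + (?z - \<zeta>) *c P (v k)"
        by (simp add: scale_left_diff_distrib)
      have "d k \<le> p (v k - ?z *c P (v k)) + p ((?z - \<zeta>) *c P (v k))"
        unfolding d_def by (subst eq) (intro norm_add mem P_mem v)
      moreover have "p ((?z - \<zeta>) *c P (v k)) \<le> cmod (?z - \<zeta>) * C"
        using operator_bound[OF P v(1), of k] v by (simp add: norm_scale P_mem mult_left_mono)
      moreover have "p (v k - ?z *c P (v k)) < inverse (real (Suc (r1 (r2 k))))"
        using zu unfolding v_def by simp
      ultimately show "d k \<le> inverse (real (Suc (r1 (r2 k)))) + cmod (?z - \<zeta>) * C" by simp
    qed
    have a1: "(\<lambda>k. inverse (real (Suc (r1 (r2 k))))) \<longlonglongrightarrow> 0"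
      using LIMSEQ_subseq_LIMSEQ[OF LIMSEQ_inverse_real_of_nat r12] by (simp only: o_def)
    have a2: "(\<lambda>k. cmod (z (r1 (r2 k)) - \<zeta>)) \<longlonglongrightarrow> 0"
      using lim_z' by (simp add: tendsto_norm_zero_iff LIM_zero_iff)
    show "(\<lambda>k. inverse (real (Suc (r1 (r2 k)))) + cmod (z (r1 (r2 k)) - \<zeta>) * C) \<longlonglongrightarrow> 0"
      using tendsto_add[OF a1 tendsto_mult_left_zero[OF a2, of C]] by simp
  qed (use d0 in auto)
  have iterate: "p (x - \<zeta> ^ n *c (P ^^ n) x) \<le> real n * A * p (x - \<zeta> *c P x)" if x: "x \<in> V" for x n
  proof (induction n)
    case (Suc n)
    let ?y = "x - \<zeta> *c P x"
    have y: "?y \<in> V" by (intro mem P_mem x)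
    have "(P ^^ n) ?y = (P ^^ n) x - \<zeta> *c (P ^^ Suc n) x"
    proof -
      have "operator P (max C 0)" using operator_mono[OF P, of "max C 0"] by simp
      then have Pn: "operator (P ^^ n) (max C 0 ^ n)" by (rule operator_funpow) simp
      show ?thesis using x
        by (simp add: operator_diff[OF Pn] operator_scale[OF Pn] mem P_mem funpow_Suc_right del: funpow.simps)
    qed
    then have eq: "x - \<zeta> ^ Suc n *c (P ^^ Suc n) x = (x - \<zeta> ^ n *c (P ^^ n) x) + \<zeta> ^ n *c (P ^^ n) ?y"
      by (simp add: scale_right_diff_distrib mult.commute)
    have "p (x - \<zeta> ^ Suc n *c (P ^^ Suc n) x)
        \<le> p (x - \<zeta> ^ n *c (P ^^ n) x) + p (\<zeta> ^ n *c (P ^^ n) ?y)"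
      by (subst eq) (intro norm_add mem Pn_mem x y)
    also have "p (\<zeta> ^ n *c (P ^^ n) ?y) \<le> A * p ?y"
      using A(2)[OF y, of n] by (simp add: norm_scale Pn_mem[OF y] norm_power \<zeta>)
    finally show ?case using Suc by (simp add: algebra_simps)
  qed simp
  define e where "e = (\<lambda>k. p (v k - \<zeta> ^ N *c (P ^^ N) (v k)))"
  have e: "e \<longlonglongrightarrow> 0"
  proof (rule tendsto_sandwich[of "\<lambda>_. 0" _ _ "\<lambda>k. real N * A * d k"])
    show "(\<lambda>k. real N * A * d k) \<longlonglongrightarrow> 0" using \<open>d \<longlonglongrightarrow> 0\<close> by (auto intro!: tendsto_eq_intros)
  qed (use iterate v norm_nonneg mem Pn_mem in \<open>auto simp: e_def d_def intro!: always_eventually\<close>)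
  have close: "(1 - \<rho>) * p (v i - v j) \<le> e i + e j + K * q (v i - v j)" for i j
  proof -
    let ?x = "v i - v j"
    have x: "?x \<in> V" by (intro mem v)
    have "operator P (max C 0)" using operator_mono[OF P, of "max C 0"] by simp
    then have PN: "operator (P ^^ N) (max C 0 ^ N)" by (rule operator_funpow) simp
    let ?f = "\<lambda>k. v k - \<zeta> ^ N *c (P ^^ N) (v k)"
    have f: "?f k \<in> V" for k by (intro mem Pn_mem v)
    have eq: "?x = (?f i - ?f j) + \<zeta> ^ N *c (P ^^ N) ?x"
      using v by (simp add: operator_diff[OF PN] scale_right_diff_distrib)
    have "p ?x \<le> p (?f i - ?f j) + p (\<zeta> ^ N *c (P ^^ N) ?x)"
      by (subst eq) (intro norm_add mem Pn_mem x f v)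
    also have "p (?f i - ?f j) \<le> e i + e j" unfolding e_def by (intro norm_diff f)
    also have "p (\<zeta> ^ N *c (P ^^ N) ?x) = p ((P ^^ N) ?x)"
      by (simp add: norm_scale Pn_mem[OF x] norm_power \<zeta>)
    also have "\<dots> \<le> \<rho> * p ?x + K * q ?x" by (rule LY(3)[OF x])
    finally show ?thesis by (simp add: algebra_simps)
  qed
  have "\<exists>x\<in>V. (\<lambda>n. p (v n - x)) \<longlonglongrightarrow> 0"
  proof (rule complete[OF v(1)], intro allI impI)
    fix \<epsilon> :: real assume "\<epsilon> > 0"
    define \<delta> where "\<delta> = (1 - \<rho>) * \<epsilon> / (3 + K)"
    have \<delta>: "\<delta> > 0" using LY \<open>\<epsilon> > 0\<close> by (simp add: \<delta>_def)
    obtain M1 where M1: "\<And>i j. i \<ge> M1 \<Longrightarrow> j \<ge> M1 \<Longrightarrow> q (v i - v j) < \<delta>"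
      using qC \<delta> unfolding v_def by meson
    obtain M2 where M2: "\<And>i. i \<ge> M2 \<Longrightarrow> e i < \<delta>"
      using order_tendstoD(2)[OF e \<delta>] unfolding eventually_sequentially by blast
    have "p (v i - v j) < \<epsilon>" if "i \<ge> max M1 M2" "j \<ge> max M1 M2" for i j
    proof -
      have "K * q (v i - v j) \<le> K * \<delta>" using M1[of i j] that LY by (intro mult_left_mono) auto
      then have "(1 - \<rho>) * p (v i - v j) \<le> 2 * \<delta> + K * \<delta>"
        using close[of i j] M2[of i] M2[of j] that by simp
      also have "\<dots> < (3 + K) * \<delta>" using \<delta> by (simp add: algebra_simps)
      also have "\<dots> = (1 - \<rho>) * \<epsilon>" using LY by (simp add: \<delta>_def)
      finally show ?thesis using LY by simp
    qed
    then show "\<exists>M. \<forall>i\<ge>M. \<forall>j\<ge>M. p (v i - v j) < \<epsilon>" by blast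
  qed
  then obtain x where x: "x \<in> V" and lim: "(\<lambda>n. p (v n - x)) \<longlonglongrightarrow> 0" by blast
  have "p (x - \<zeta> *c P x) \<le> 0"
  proof (rule tendsto_le[OF sequentially_bot])
    show "(\<lambda>n. p (v n - x) + d n + C * p (v n - x)) \<longlonglongrightarrow> 0"
      using lim \<open>d \<longlonglongrightarrow> 0\<close> by (auto intro!: tendsto_eq_intros)
    show "\<forall>\<^sub>F n in sequentially. p (x - \<zeta> *c P x) \<le> p (v n - x) + d n + C * p (v n - x)"
    proof (intro always_eventually allI)
      fix n
      have D: "v n - x \<in> V" "v n - \<zeta> *c P (v n) \<in> V" by (intro mem P_mem v x)+
      have eq: "x - \<zeta> *c P x = ((v n - \<zeta> *c P (v n)) - (v n - x)) + \<zeta> *c P (v n - x)"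
        using v x by (simp add: operator_diff[OF P] scale_right_diff_distrib)
      have "p (x - \<zeta> *c P x) \<le> p ((v n - \<zeta> *c P (v n)) - (v n - x)) + p (\<zeta> *c P (v n - x))"
        by (subst eq) (intro norm_add mem P_mem D)
      moreover have "p ((v n - \<zeta> *c P (v n)) - (v n - x)) \<le> d n + p (v n - x)"
        unfolding d_def by (intro norm_diff D)
      moreover have "p (\<zeta> *c P (v n - x)) \<le> C * p (v n - x)"
        using operator_bound[OF P D(1)] D by (simp add: norm_scale P_mem \<zeta>)
      ultimately show "p (x - \<zeta> *c P x) \<le> p (v n - x) + d n + C * p (v n - x)" by simp
    qed
  qed auto
  then have "p (x - \<zeta> *c P x) = 0" using norm_nonneg[of "x - \<zeta> *c P x"] x by (simp add: mem P_mem)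
  then have "x - \<zeta> *c P x = 0" using norm_zeroD[of "x - \<zeta> *c P x"] x by (simp add: mem P_mem)
  then have fixp: "x = \<zeta> *c P x" by simp
  have "\<zeta> \<noteq> 0" using \<zeta> by auto
  then have "P x = inverse \<zeta> *c x"
    by (subst (2) fixp) simp
  then have "x = 0" using no_eig[of "inverse \<zeta>" x] \<zeta> x by (simp add: norm_inverse)
  then have "(\<lambda>n. p (v n)) \<longlonglongrightarrow> 0" using lim by simp
  then show False using LIMSEQ_unique[of "\<lambda>n. p (v n)" 0 1] by (simp add: v)
qed

end

section \<open>Perturbation of the leading eigenvalue\<close>

definition growth :: "('v \<Rightarrow> complex) \<Rightarrow> ('v \<Rightarrow> 'v) \<Rightarrow> 'v \<Rightarrow> nat \<Rightarrow> complex" where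
  "growth \<psi> L x n = \<psi> ((L ^^ Suc n) x) / \<psi> ((L ^^ n) x)"

text \<open>
  The bound \<open>1/2\<close> keeps all growth factors inside a disc on which the principal logarithm is
  holomorphic and Lipschitz continuous.
\<close>

definition controlled_growth ::
    "('v \<Rightarrow> complex) \<Rightarrow> ('v \<Rightarrow> 'v) \<Rightarrow> real \<Rightarrow> 'v \<Rightarrow> 'v \<Rightarrow> bool" where
  "controlled_growth \<psi> L t x y \<longleftrightarrow> (\<forall>n. \<psi> ((L ^^ n) x) \<noteq> 0 \<and> cmod (growth \<psi> L x n - 1) \<le> 1 / 2 \<and>
     cmod (growth \<psi> L x (Suc n) - growth \<psi> L x n) \<le> t ^ n \<and>
     cmod (growth \<psi> L x n - growth \<psi> L y n) \<le> t ^ n)"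

context normed_subspace
begin

definition affine_ball :: "('v \<Rightarrow> complex) \<Rightarrow> 'v \<Rightarrow> real \<Rightarrow> 'v set" where
  "affine_ball \<psi> h R = {x \<in> V. \<psi> x = 1 \<and> p (x - h) \<le> R}"

definition operator_near :: "('v \<Rightarrow> 'v) \<Rightarrow> real \<Rightarrow> ('v \<Rightarrow> 'v) \<Rightarrow> bool" where
  "operator_near P \<eta> L \<longleftrightarrow> (\<exists>C. operator L C) \<and> (\<forall>x\<in>V. p (L x - P x) \<le> \<eta> * p x)"

text \<open>
  The normalised map \<open>F x = L x / \<psi> (L x)\<close> sends the affine ball around the fixed point \<open>h\<close> into itself
  and contracts it: this holds with factor \<open>r\<close> for \<open>L = P\<close>, since differences of points of the ball
  lie in the kernel of \<open>\<psi>\<close>, and all error terms vanish with \<open>\<eta>\<close>. Linearity gives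
  \<open>L\<^sup>n x = \<psi> (L\<^sup>n x) F\<^sup>n x\<close>, so the growth factor at step \<open>n\<close> is \<open>\<psi> (L (F\<^sup>n x))\<close>, and the contraction of \<open>F\<close>
  controls it. Comparing \<open>x\<close> with \<open>F x\<close> compares consecutive growth factors.
\<close>

lemma perturbed_ratios_of_contraction:
  assumes P: "operator P C" and h: "h \<in> V" "P h = h" "\<psi> h = (1::complex)"
    and \<psi>: "\<And>x y. x \<in> V \<Longrightarrow> y \<in> V \<Longrightarrow> \<psi> (x + y) = \<psi> x + \<psi> y"
      "\<And>a x. x \<in> V \<Longrightarrow> \<psi> (a *c x) = a * \<psi> x" "\<And>x. x \<in> V \<Longrightarrow> cmod (\<psi> x) \<le> c * p x"
    and c: "0 \<le> c" and \<psi>P: "\<And>x. x \<in> V \<Longrightarrow> \<psi> (P x) = \<psi> x"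
    and r: "0 \<le> r" "r < 1" "\<And>x. x \<in> V \<Longrightarrow> \<psi> x = 0 \<Longrightarrow> p (P x) \<le> r * p x"
    and R: "0 < R" and t: "r < t"
  shows "\<exists>\<eta>>0. \<forall>L. operator_near P \<eta> L \<longrightarrow>
    (\<forall>x\<in>affine_ball \<psi> h R. \<forall>y\<in>affine_ball \<psi> h R. controlled_growth \<psi> L t x y)"
proof -
  have t0: "0 < t" using r t by linarith
  define W where "W = p h + R"
  have W: "0 \<le> W" "p h \<le> W" using norm_nonneg[OF h(1)] R by (auto simp: W_def)
  have \<psi>_diff: "\<psi> (x - y) = \<psi> x - \<psi> y" if "x \<in> V" "y \<in> V" for x y
    using \<psi>(1)[of x "- y"] \<psi>(2)[of y "-1"] that by (simp add: scale_minus_left uminus_mem)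
  have lim1: "((\<lambda>\<eta>. c * \<eta> * W) \<longlongrightarrow> c * 0 * W) (at_right 0)"
    and lim2: "((\<lambda>\<eta>. (r * R + \<eta> * W + (c * \<eta> * W) * p h) / (1 - c * \<eta> * W)) \<longlongrightarrow>
      (r * R + 0 * W + (c * 0 * W) * p h) / (1 - c * 0 * W)) (at_right 0)"
    and lim3: "((\<lambda>\<eta>. (r + \<eta>) / (1 - c * \<eta> * W) + 4 * (c * \<eta>) * ((1 + \<eta>) * W)) \<longlongrightarrow>
      (r + 0) / (1 - c * 0 * W) + 4 * (c * 0) * ((1 + 0) * W)) (at_right 0)"
    and lim4: "((\<lambda>\<eta>. c * \<eta> * (2 * R)) \<longlongrightarrow> c * 0 * (2 * R)) (at_right (0::real))"
    by (intro tendsto_intros; simp)+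
  (* In order: growth factors are close to 1, F preserves the ball, F contracts by t, and the
     growth factors of two points of the ball differ by at most 1 at the first step. *)
  have "\<forall>\<^sub>F \<eta> in at_right 0. \<eta> > 0 \<and> c * \<eta> * W < 1 / 2 \<and>
      (r * R + \<eta> * W + (c * \<eta> * W) * p h) / (1 - c * \<eta> * W) < R \<and>
      (r + \<eta>) / (1 - c * \<eta> * W) + 4 * (c * \<eta>) * ((1 + \<eta>) * W) < t \<and> c * \<eta> * (2 * R) < 1"
    using r R t
    by (intro eventually_conj order_tendstoD(2)[OF lim1] order_tendstoD(2)[OF lim2]
      order_tendstoD(2)[OF lim3] order_tendstoD(2)[OF lim4] eventually_at_right_less) auto
  then obtain \<eta> where \<eta>: "\<eta> > 0" and \<kappa>: "c * \<eta> * W < 1 / 2"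
    and ball: "(r * R + \<eta> * W + (c * \<eta> * W) * p h) / (1 - c * \<eta> * W) < R"
    and contr: "(r + \<eta>) / (1 - c * \<eta> * W) + 4 * (c * \<eta>) * ((1 + \<eta>) * W) < t"
    and \<eta>R: "c * \<eta> * (2 * R) < 1"
    by (auto dest!: eventually_happens)
  define \<kappa> where "\<kappa> = c * \<eta> * W"
  have \<kappa>0: "0 \<le> \<kappa>" "\<kappa> < 1 / 2" using c \<eta> W \<kappa> by (auto simp: \<kappa>_def)
  show ?thesis
  proof (rule exI[of _ \<eta>], intro conjI allI impI)
    fix L assume "operator_near P \<eta> L"
    then obtain C' where L: "operator L C'" and close: "\<forall>x\<in>V. p (L x - P x) \<le> \<eta> * p x"
      by (auto simp: operator_near_def)
    have L_mem: "L x \<in> V" and P_mem: "P x \<in> V" if "x \<in> V" for x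
      using operator_mem[OF L that] operator_mem[OF P that] by auto
    define X where "X = affine_ball \<psi> h R"
    define F where "F = (\<lambda>x. (1 / \<psi> (L x)) *c L x)"
    have X_norm: "x \<in> V" "p x \<le> W" "\<psi> x = 1" "p (x - h) \<le> R" if "x \<in> X" for x
      using that norm_triangle_diff[of x h] h by (auto simp: X_def affine_ball_def W_def)
    have \<psi>D: "cmod (\<psi> (L x) - \<psi> x) \<le> c * \<eta> * p x" if x: "x \<in> V" for x
    proof -
      have "cmod (\<psi> (L x) - \<psi> x) = cmod (\<psi> (L x - P x))"
        using x by (simp add: \<psi>_diff \<psi>P L_mem P_mem)
      also have "\<dots> \<le> c * p (L x - P x)" by (intro \<psi> mem L_mem P_mem x)
      also have "\<dots> \<le> c * (\<eta> * p x)" using close x c by (intro mult_left_mono) auto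
      finally show ?thesis by simp
    qed
    have s_close: "cmod (\<psi> (L x) - 1) \<le> \<kappa>" if x: "x \<in> X" for x
    proof -
      have "cmod (\<psi> (L x) - 1) \<le> c * \<eta> * p x" using \<psi>D[of x] X_norm[OF x] by simp
      also have "\<dots> \<le> \<kappa>" unfolding \<kappa>_def using c \<eta> X_norm[OF x] by (intro mult_left_mono) auto
      finally show ?thesis .
    qed
    have s_low: "1 - \<kappa> \<le> cmod (\<psi> (L x))" if x: "x \<in> X" for x
      using s_close[OF x] norm_triangle_ineq3[of "\<psi> (L x)" 1] by simp
    have s_half: "1 / 2 < cmod (\<psi> (L x))" if x: "x \<in> X" for x
      using s_low[OF x] \<kappa>0 by simp
    have s_inv: "cmod (1 / \<psi> (L x)) \<le> 1 / (1 - \<kappa>)" if x: "x \<in> X" for x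
      unfolding norm_divide using s_low[OF x] \<kappa>0 by (auto intro!: divide_left_mono mult_pos_pos)
    have s_inv2: "cmod (1 / \<psi> (L x)) \<le> 2" if x: "x \<in> X" for x
    proof -
      have "1 / cmod (\<psi> (L x)) \<le> 1 / (1 / 2)"
        using s_half[OF x] by (intro divide_left_mono mult_pos_pos) auto
      then show ?thesis by (simp add: norm_divide)
    qed
    have F_mem: "F x \<in> X" if x: "x \<in> X" for x
    proof -
      let ?s = "\<psi> (L x)"
      note x' = X_norm[OF x]
      have s0: "?s \<noteq> 0" using s_half[OF x] by auto
      have F: "F x \<in> V" unfolding F_def by (intro mem L_mem x')
      have "\<psi> (F x) = 1" unfolding F_def using s0 x' by (simp add: \<psi> L_mem)
      moreover have "p (F x - h) \<le> R"
      proof -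
        have eq: "F x - h = (1 / ?s) *c ((P (x - h) + (L x - P x)) + (1 - ?s) *c h)"
          unfolding F_def using s0 x' h
          by (simp add: operator_diff[OF P] scale_left_diff_distrib scale_right_diff_distrib)
        have "p (F x - h) = cmod (1 / ?s) * p ((P (x - h) + (L x - P x)) + (1 - ?s) *c h)"
          unfolding eq by (intro norm_scale mem P_mem L_mem x' h)
        also have "\<dots> \<le> (1 / (1 - \<kappa>)) * (r * R + \<eta> * W + \<kappa> * p h)"
        proof (intro mult_mono s_inv x)
          have "p ((P (x - h) + (L x - P x)) + (1 - ?s) *c h) \<le> p (P (x - h) + (L x - P x)) + p ((1 - ?s) *c h)"
            by (intro norm_add mem P_mem L_mem x' h)
          also have "p (P (x - h) + (L x - P x)) \<le> p (P (x - h)) + p (L x - P x)"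
            by (intro norm_add mem P_mem L_mem x' h)
          also have "p (L x - P x) \<le> \<eta> * W"
            using close x' \<eta> by (intro order_trans[OF _ mult_left_mono[OF x'(2)]]) auto
          also have "p (P (x - h)) \<le> r * R"
            using r(3)[of "x - h"] x' h
            by (intro order_trans[OF _ mult_left_mono[OF x'(4) r(1)]]) (simp add: \<psi>_diff mem)
          also have "p ((1 - ?s) *c h) \<le> \<kappa> * p h"
            using s_close[OF x] norm_nonneg[OF h(1)]
            by (simp add: norm_scale h norm_minus_commute mult_right_mono)
          finally show "p ((P (x - h) + (L x - P x)) + (1 - ?s) *c h) \<le> r * R + \<eta> * W + \<kappa> * p h" by simp
        qed (use \<kappa>0 in \<open>auto intro!: norm_nonneg mem P_mem L_mem x' h\<close>)
        also have "\<dots> \<le> R" using ball unfolding \<kappa>_def by simp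
        finally show ?thesis .
      qed
      ultimately show ?thesis using F by (simp add: X_def affine_ball_def)
    qed
    have F_contr: "p (F x - F y) \<le> t * p (x - y)" if xy: "x \<in> X" "y \<in> X" for x y
    proof -
      let ?s = "\<psi> (L x)" and ?s' = "\<psi> (L y)"
      note x' = X_norm[OF xy(1)] and y' = X_norm[OF xy(2)]
      have s0: "?s \<noteq> 0" "?s' \<noteq> 0" using s_half xy by force+
      have xyV: "x - y \<in> V" by (intro mem x' y')
      have nn: "0 \<le> p (x - y)" by (rule norm_nonneg[OF xyV])
      have eq: "F x - F y = (1 / ?s) *c L (x - y) + (1 / ?s - 1 / ?s') *c L y"
        unfolding F_def using x' y'
        by (simp add: operator_diff[OF L] scale_left_diff_distrib scale_right_diff_distrib)
      have "p (F x - F y) \<le> p ((1 / ?s) *c L (x - y)) + p ((1 / ?s - 1 / ?s') *c L y)"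
        unfolding eq by (intro norm_add mem L_mem x' y')
      also have "p ((1 / ?s) *c L (x - y)) \<le> (1 / (1 - \<kappa>)) * ((r + \<eta>) * p (x - y))"
      proof -
        have "p (L (x - y)) \<le> p (P (x - y)) + p (L (x - y) - P (x - y))"
          by (intro norm_triangle_diff L_mem P_mem xyV)
        also have "\<dots> \<le> r * p (x - y) + \<eta> * p (x - y)"
          using close xyV x' y' by (intro add_mono r) (auto simp: \<psi>_diff)
        finally have "p (L (x - y)) \<le> (r + \<eta>) * p (x - y)" by (simp add: algebra_simps)
        then show ?thesis
          unfolding norm_scale[OF L_mem[OF xyV]] using \<kappa>0
          by (intro mult_mono s_inv xy norm_nonneg L_mem xyV) auto
      qed
      also have "p ((1 / ?s - 1 / ?s') *c L y) \<le> (4 * (c * \<eta> * p (x - y))) * ((1 + \<eta>) * W)"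
      proof -
        have "cmod (?s' - ?s) \<le> c * \<eta> * p (x - y)"
          using \<psi>D[OF xyV] x' y' by (simp add: operator_diff[OF L] \<psi>_diff L_mem norm_minus_commute)
        have "1 / ?s - 1 / ?s' = (?s' - ?s) * (1 / ?s) * (1 / ?s')"
          using s0 by (simp add: field_simps)
        then have "cmod (1 / ?s - 1 / ?s') = cmod (?s' - ?s) * cmod (1 / ?s) * cmod (1 / ?s')"
          by (simp only: norm_mult)
        also have "\<dots> \<le> (c * \<eta> * p (x - y)) * 2 * 2"
          using \<open>cmod (?s' - ?s) \<le> _\<close> c \<eta> nn by (intro mult_mono s_inv2 xy) auto
        finally have A: "cmod (1 / ?s - 1 / ?s') \<le> 4 * (c * \<eta> * p (x - y))" by simp
        have "p (P y) \<le> W"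
        proof -
          have "P y = h + P (y - h)" using y' h by (simp add: operator_diff[OF P])
          then have "p (P y) \<le> p h + p (P (y - h))"
            using norm_add[OF h(1) P_mem[OF diff_mem[OF y'(1) h(1)]]] by simp
          also have "p (P (y - h)) \<le> p (y - h)"
            using r(3)[of "y - h"] mult_right_mono[of r 1 "p (y - h)"] norm_nonneg[of "y - h"] r(2) y' h
            by (simp add: \<psi>_diff mem)
          finally show ?thesis using y' by (simp add: W_def)
        qed
        moreover have "p (L y - P y) \<le> \<eta> * W"
          using close y' \<eta> by (intro order_trans[OF _ mult_left_mono[OF y'(2)]]) auto
        ultimately have "p (L y) \<le> (1 + \<eta>) * W"
          using norm_triangle_diff[OF L_mem[OF y'(1)] P_mem[OF y'(1)]] by (simp add: algebra_simps)
        with A show ?thesis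
          unfolding norm_scale[OF L_mem[OF y'(1)]] using c \<eta> nn
          by (intro mult_mono norm_nonneg L_mem y') auto
      qed
      finally have "p (F x - F y) \<le> ((r + \<eta>) / (1 - \<kappa>) + 4 * (c * \<eta>) * ((1 + \<eta>) * W)) * p (x - y)"
        by (simp add: algebra_simps add_divide_distrib)
      also have "\<dots> \<le> t * p (x - y)" using contr nn unfolding \<kappa>_def by (intro mult_right_mono) auto
      finally show ?thesis .
    qed
    have Fn_mem: "(F ^^ n) x \<in> X" if "x \<in> X" for n x
      using that by (induction n) (auto simp: F_mem)
    have Fn_contr: "p ((F ^^ n) x - (F ^^ n) y) \<le> t ^ n * p (x - y)" if "x \<in> X" "y \<in> X" for n x y
    proof (induction n)
      case (Suc n)
      have "p ((F ^^ Suc n) x - (F ^^ Suc n) y) \<le> t * p ((F ^^ n) x - (F ^^ n) y)"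
        using F_contr[OF Fn_mem Fn_mem, OF that] by simp
      also have "\<dots> \<le> t * (t ^ n * p (x - y))" using t0 by (intro mult_left_mono Suc) auto
      finally show ?case by simp
    qed simp
    have Fn_eq: "\<psi> ((L ^^ n) x) \<noteq> 0 \<and> (L ^^ n) x = \<psi> ((L ^^ n) x) *c (F ^^ n) x" if x: "x \<in> X" for n x
    proof (induction n)
      case 0 then show ?case using X_norm[OF x] by simp
    next
      case (Suc n)
      let ?a = "\<psi> ((L ^^ n) x)" and ?y = "(F ^^ n) x"
      have y: "?y \<in> X" "?y \<in> V" using Fn_mem[OF x] X_norm by auto
      have s0: "\<psi> (L ?y) \<noteq> 0" using s_half[OF y(1)] by auto
      have eq: "(L ^^ Suc n) x = ?a *c L ?y"
        using Suc y by (metis comp_apply funpow.simps(2) operator_scale[OF L])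
      then have "\<psi> ((L ^^ Suc n) x) = ?a * \<psi> (L ?y)" by (simp add: \<psi> L_mem y)
      then show ?case using Suc s0 unfolding eq by (simp add: F_def)
    qed
    have ratio: "growth \<psi> L x n = \<psi> (L ((F ^^ n) x))" if x: "x \<in> X" for n x
    proof -
      have y: "(F ^^ n) x \<in> V" using Fn_mem[OF x] X_norm by auto
      have "(L ^^ Suc n) x = \<psi> ((L ^^ n) x) *c L ((F ^^ n) x)"
        using Fn_eq[OF x, of n] y by (metis comp_apply funpow.simps(2) operator_scale[OF L])
      then have "\<psi> ((L ^^ Suc n) x) = \<psi> ((L ^^ n) x) * \<psi> (L ((F ^^ n) x))" using y by (simp add: \<psi> L_mem)
      then show ?thesis using Fn_eq[OF x, of n] by (simp add: growth_def)
    qed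
    have ratio_diff: "cmod (\<psi> (L ((F ^^ n) x)) - \<psi> (L ((F ^^ n) y))) \<le> t ^ n" if xy: "x \<in> X" "y \<in> X" for x y n
    proof -
      let ?u = "(F ^^ n) x" and ?v = "(F ^^ n) y"
      note u = X_norm[OF Fn_mem[OF xy(1), of n]] and v = X_norm[OF Fn_mem[OF xy(2), of n]]
      note x' = X_norm[OF xy(1)] and y' = X_norm[OF xy(2)]
      have uv: "?u - ?v \<in> V" by (intro mem u v)
      have "cmod (\<psi> (L ?u) - \<psi> (L ?v)) \<le> c * \<eta> * p (?u - ?v)"
        using \<psi>D[OF uv] u v by (simp add: operator_diff[OF L] \<psi>_diff L_mem)
      also have "\<dots> \<le> c * \<eta> * (t ^ n * (2 * R))"
      proof (intro mult_left_mono order_trans[OF Fn_contr[OF xy]])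
        have "x - y = (x - h) - (y - h)" by simp
        then have "p (x - y) \<le> p (x - h) + p (y - h)"
          using norm_diff[of "x - h" "y - h"] x' y' h by (simp only: mem)
        then show "p (x - y) \<le> 2 * R" using x'(4) y'(4) by linarith
      qed (use c \<eta> t0 in auto)
      also have "\<dots> \<le> t ^ n"
        using mult_right_mono[OF less_imp_le[OF \<eta>R], of "t ^ n"] t0 by (simp add: mult_ac)
      finally show ?thesis .
    qed
    show "\<forall>x\<in>affine_ball \<psi> h R. \<forall>y\<in>affine_ball \<psi> h R. controlled_growth \<psi> L t x y"
      unfolding controlled_growth_def
    proof (intro ballI impI allI)
      fix x y n assume "x \<in> affine_ball \<psi> h R" "y \<in> affine_ball \<psi> h R"
      then have xy: "x \<in> X" "y \<in> X" by (simp_all add: X_def)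
      have "(F ^^ Suc n) x = (F ^^ n) (F x)" by (simp only: funpow_Suc_right o_apply)
      then have "cmod (\<psi> (L ((F ^^ Suc n) x)) - \<psi> (L ((F ^^ n) x))) \<le> t ^ n"
        using ratio_diff[OF F_mem[OF xy(1)] xy(1), of n] by simp
      then show "\<psi> ((L ^^ n) x) \<noteq> 0 \<and> cmod (growth \<psi> L x n - 1) \<le> 1 / 2 \<and>
        cmod (growth \<psi> L x (Suc n) - growth \<psi> L x n) \<le> t ^ n \<and>
        cmod (growth \<psi> L x n - growth \<psi> L y n) \<le> t ^ n"
        using Fn_eq[OF xy(1), of n] s_close[OF Fn_mem[OF xy(1), of n]] \<kappa>0 ratio_diff[OF xy, of n]
        unfolding ratio[OF xy(1)] ratio[OF xy(2)] by simp
    qed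
  qed (rule \<eta>)
qed


text \<open>
  The decay hypothesis makes a power of \<open>P\<close> halve the norm on the kernel of \<open>\<psi>\<close>. In the equivalent norm
  \<open>N x = (\<Sum>j\<le>k. p (P\<^sup>j x))\<close> already \<open>P\<close> itself is a strict contraction there, because passing from \<open>x\<close>
  to \<open>P x\<close> replaces the summand \<open>p x\<close> by \<open>p (P\<^sup>k\<^sup>+\<^sup>1 x)\<close>, which is at most half as large.
\<close>

lemma perturbed_ratios:
  assumes P: "operator P C" and h: "h \<in> V" "P h = h" "\<psi> h = (1::complex)"
    and \<psi>: "\<And>x y. x \<in> V \<Longrightarrow> y \<in> V \<Longrightarrow> \<psi> (x + y) = \<psi> x + \<psi> y"
      "\<And>a x. x \<in> V \<Longrightarrow> \<psi> (a *c x) = a * \<psi> x" "\<And>x. x \<in> V \<Longrightarrow> cmod (\<psi> x) \<le> c * p x"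
    and c: "0 \<le> c" and \<psi>P: "\<And>x. x \<in> V \<Longrightarrow> \<psi> (P x) = \<psi> x"
    and decay: "\<And>n x. x \<in> V \<Longrightarrow> \<psi> x = 0 \<Longrightarrow> real (Suc n) * p ((P ^^ n) x) \<le> D * p x"
  shows "\<exists>t>0. t < 1 \<and> (\<forall>R>0. \<exists>\<eta>>0. \<forall>L. operator_near P \<eta> L \<longrightarrow>
    (\<forall>x\<in>affine_ball \<psi> h R. \<forall>y\<in>affine_ball \<psi> h R. controlled_growth \<psi> L t x y))"
proof -
  define k where "k = nat \<lceil>2 * \<bar>D\<bar>\<rceil>"
  have half: "p ((P ^^ Suc k) x) \<le> p x / 2" if x: "x \<in> V" "\<psi> x = 0" for x
  proof -
    have k: "2 * \<bar>D\<bar> \<le> real k" unfolding k_def by linarith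
    have "real (Suc (Suc k)) * p ((P ^^ Suc k) x) \<le> D * p x" by (rule decay[OF x])
    also have "\<dots> \<le> real (Suc (Suc k)) / 2 * p x" using k by (intro mult_right_mono norm_nonneg x) auto
    finally have "real (Suc (Suc k)) * p ((P ^^ Suc k) x) \<le> real (Suc (Suc k)) * (p x / 2)" by simp
    then show ?thesis by (simp only: mult_le_cancel_left_pos of_nat_0_less_iff zero_less_Suc)
  qed
  define C1 where "C1 = max C 1"
  have P1: "operator P C1" using operator_mono[OF P, of C1] by (simp add: C1_def)
  define N where "N = (\<lambda>x. \<Sum>j\<le>k. p ((P ^^ j) x))"
  define E where "E = (\<Sum>j\<le>k. C1 ^ j)"
  have Pj: "operator (P ^^ j) (C1 ^ j)" for j by (intro operator_funpow P1) (simp add: C1_def)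
  have Pj_mem: "(P ^^ j) x \<in> V" if "x \<in> V" for j x by (rule funpow_mem[OF P that])
  have E1: "1 \<le> E"
  proof -
    have "C1 ^ 0 \<le> E" unfolding E_def by (rule member_le_sum) (auto simp: C1_def)
    then show ?thesis by simp
  qed
  have pN: "p x \<le> N x" if "x \<in> V" for x
    using member_le_sum[of 0 "{..k}" "\<lambda>j. p ((P ^^ j) x)"] that norm_nonneg[OF Pj_mem[OF that]] by (simp add: N_def)
  have NE: "N x \<le> E * p x" if "x \<in> V" for x
    unfolding N_def E_def sum_distrib_right by (intro sum_mono operator_bound[OF Pj] that)
  interpret N: normed_subspace scale V N
  proof unfold_locales
    fix x y and a :: complex assume x: "x \<in> V"
    show "N (a *c x) = cmod a * N x"
      unfolding N_def sum_distrib_left using x by (intro sum.cong) (auto simp: operator_scale[OF Pj] norm_scale Pj_mem)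
    show "x = 0" if "N x = 0" using pN[OF x] norm_nonneg[OF x] that by (intro norm_zeroD x) auto
    assume y: "y \<in> V"
    show "N (x + y) \<le> N x + N y"
      unfolding N_def sum.distrib[symmetric] using x y
      by (intro sum_mono) (auto simp: operator_add[OF Pj] norm_add Pj_mem)
  qed (auto simp: mem)
  have N_op: "N.operator L (E * \<bar>B\<bar>)" if L: "operator L B" for L B
    unfolding N.operator_def
  proof (intro conjI ballI allI)
    fix x assume x: "x \<in> V"
    have "N (L x) \<le> E * p (L x)" by (intro NE operator_mem[OF L] x)
    also have "\<dots> \<le> E * (\<bar>B\<bar> * p x)"
      using E1 operator_bound[OF L x] mult_right_mono[OF abs_ge_self[of B] norm_nonneg[OF x]]
      by (intro mult_left_mono) auto
    also have "\<dots> \<le> E * (\<bar>B\<bar> * N x)" using E1 by (intro mult_left_mono pN x) auto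
    finally show "N (L x) \<le> E * \<bar>B\<bar> * N x" by simp
  qed (use L in \<open>auto simp: operator_mem operator_add operator_scale\<close>)
  define r where "r = 1 - 1 / (2 * E)"
  have r: "0 \<le> r" "r < 1" using E1 by (auto simp: r_def field_simps)
  have contr: "N (P x) \<le> r * N x" if x: "x \<in> V" "\<psi> x = 0" for x
  proof -
    have "N (P x) + p x = (\<Sum>j\<le>k. p ((P ^^ Suc j) x)) + p x"
      by (simp add: N_def funpow_Suc_right del: funpow.simps)
    also have "\<dots> = (\<Sum>j\<le>Suc k. p ((P ^^ j) x))"
      by (simp only: sum.atMost_Suc_shift[of _ k] funpow_0 add.commute)
    also have "\<dots> = N x + p ((P ^^ Suc k) x)" by (simp add: N_def)
    also have "\<dots> \<le> N x + p x / 2" using half[OF x] by simp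
    finally have "N (P x) \<le> N x - p x / 2" by simp
    moreover have "N x / (2 * E) \<le> p x / 2" using NE[OF x(1)] E1 by (simp add: field_simps)
    ultimately show ?thesis by (simp add: r_def algebra_simps)
  qed
  define t where "t = (1 + r) / 2"
  have t: "r < t" "0 < t" "t < 1" using r by (auto simp: t_def)
  have \<psi>N: "cmod (\<psi> x) \<le> c * N x" if "x \<in> V" for x
    using \<psi>(3)[OF that] mult_left_mono[OF pN[OF that] c] by linarith
  show ?thesis
  proof (rule exI[of _ t], intro conjI allI impI t)
    fix R :: real assume "0 < R"
    then have "0 < E * R" using E1 by simp
    have "\<exists>\<eta>>0. \<forall>L. N.operator_near P \<eta> L \<longrightarrow>
        (\<forall>x\<in>N.affine_ball \<psi> h (E * R). \<forall>y\<in>N.affine_ball \<psi> h (E * R). controlled_growth \<psi> L t x y)"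
      by (rule N.perturbed_ratios_of_contraction[OF N_op[OF P] h \<psi>(1,2) \<psi>N c \<psi>P r contr \<open>0 < E * R\<close> t(1)])
    then obtain \<eta> where \<eta>: "\<eta> > 0" and *: "\<forall>L. N.operator_near P \<eta> L \<longrightarrow>
        (\<forall>x\<in>N.affine_ball \<psi> h (E * R). \<forall>y\<in>N.affine_ball \<psi> h (E * R). controlled_growth \<psi> L t x y)"
      by (elim exE conjE) (rule that)
    show "\<exists>\<eta>>0. \<forall>L. operator_near P \<eta> L \<longrightarrow>
    (\<forall>x\<in>affine_ball \<psi> h R. \<forall>y\<in>affine_ball \<psi> h R. controlled_growth \<psi> L t x y)"
    proof (intro exI[of _ "\<eta> / E"] conjI allI impI ballI)
      fix L x y
      assume "operator_near P (\<eta> / E) L" and xy: "x \<in> affine_ball \<psi> h R" "y \<in> affine_ball \<psi> h R"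
      then obtain C' where L: "operator L C'" and cl: "\<forall>x\<in>V. p (L x - P x) \<le> \<eta> / E * p x"
        by (auto simp: operator_near_def)
      have cl': "N (L x - P x) \<le> \<eta> * N x" if x: "x \<in> V" for x
      proof -
        have "N (L x - P x) \<le> E * p (L x - P x)"
          by (intro NE mem operator_mem[OF L] operator_mem[OF P] x)
        also have "\<dots> \<le> E * (\<eta> / E * p x)" using cl x E1 by (intro mult_left_mono) auto
        also have "\<dots> = \<eta> * p x" using E1 by simp
        also have "\<dots> \<le> \<eta> * N x" using \<eta> by (intro mult_left_mono pN x) auto
        finally show ?thesis .
      qed
      have "N.operator_near P \<eta> L" using N_op[OF L] cl' by (auto simp: N.operator_near_def)
      moreover have ball: "z \<in> N.affine_ball \<psi> h (E * R)" if "z \<in> affine_ball \<psi> h R" for z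
        using that order_trans[OF NE mult_left_mono[of "p (z - h)" R E]] E1 h
        by (auto simp: N.affine_ball_def affine_ball_def mem)
      ultimately show "controlled_growth \<psi> L t x y" using * xy by simp
    qed (use \<eta> E1 in auto)
  qed
qed

end

section \<open>Duality for annealed transfer operators\<close>

lemma orbit_case_nat: "orbit T (case_nat \<omega> w) x (Suc k) = orbit T w (T \<omega> x) k"
  by (induction k) auto

lemma birkhoff_sum_case_nat:
  "birkhoff_sum T \<phi> (Suc n) (case_nat \<omega> w, x) = \<phi> x + birkhoff_sum T \<phi> n (w, T \<omega> x)"
  by (simp add: birkhoff_sum_def sum.lessThan_Suc_shift orbit_case_nat del: sum.lessThan_Suc orbit.simps(2))

lemma integrable_mult_bounded:
  fixes f g :: "'a \<Rightarrow> complex"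
  assumes "integrable M f" "g \<in> borel_measurable M" "\<And>x. x \<in> space M \<Longrightarrow> cmod (g x) \<le> C"
  shows "integrable M (\<lambda>x. f x * g x)"
proof (rule Bochner_Integration.integrable_bound[of M "\<lambda>x. C * norm (f x)"])
  show "AE x in M. norm (f x * g x) \<le> norm (C * norm (f x))"
  proof (rule AE_I2)
    fix x assume "x \<in> space M"
    from assms(3)[OF this] show "norm (f x * g x) \<le> norm (C * norm (f x))"
      using mult_left_mono[of "cmod (g x)" "\<bar>C\<bar>" "cmod (f x)"] by (simp add: norm_mult abs_mult mult.commute)
  qed
qed (use assms in \<open>auto intro!: borel_measurable_times\<close>)

lemma AE_eq_of_indicator_tests:
  fixes u v :: "'a \<Rightarrow> complex"
  assumes "sigma_finite_measure M" "integrable M u" "integrable M v"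
    and "\<And>A. A \<in> sets M \<Longrightarrow> (\<integral>x. u x * indicator A x \<partial>M) = (\<integral>x. v x * indicator A x \<partial>M)"
  shows "AE x in M. u x = v x"
proof (rule sigma_finite_measure.density_unique_banach[OF assms(1-3)])
  fix A assume "A \<in> sets M"
  have "indicator A x *\<^sub>R z = z * indicator A x" for x and z :: complex
    by (simp add: indicator_def)
  then show "set_lebesgue_integral M A u = set_lebesgue_integral M A v"
    unfolding set_lebesgue_integral_def using assms(4)[OF \<open>A \<in> sets M\<close>] by simp
qed

text \<open>
  The \<open>L\<^sup>1\<close> norm is attained by testing against a function of modulus at most 1. This is how contraction
  in \<open>L\<^sup>1\<close> follows from duality.
\<close>

lemma norm_integral_eq_sign_test:
  fixes u :: "'a \<Rightarrow> complex"
  assumes "integrable M u"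
  shows "complex_of_real (\<integral>x. cmod (u x) \<partial>M) = (\<integral>x. u x * cnj (sgn (u x)) \<partial>M)"
proof -
  have "u x * cnj (sgn (u x)) = complex_of_real (cmod (u x))" for x
    using complex_norm_square[of "u x"] by (cases "u x = 0") (auto simp: sgn_eq power2_eq_square divide_eq_eq)
  then show ?thesis by simp
qed

lemma norm_integral_le:
  fixes f :: "'a \<Rightarrow> complex"
  assumes "integrable M f" "integrable M g" "\<And>x. x \<in> space M \<Longrightarrow> cmod (f x) \<le> g x"
  shows "cmod (\<integral>x. f x \<partial>M) \<le> (\<integral>x. g x \<partial>M)"
  using assms by (intro order_trans[OF integral_norm_bound integral_mono]) auto

lemma borel_measurable_cnj_sgn:
  assumes [measurable]: "u \<in> borel_measurable M"
  shows "(\<lambda>x. cnj (sgn (u x :: complex))) \<in> borel_measurable M"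
proof -
  have [measurable]: "cnj \<in> borel_measurable borel"
    by (intro borel_measurable_continuous_onI continuous_intros)
  show ?thesis unfolding sgn_eq by measurable
qed

context random_system
begin

sublocale pair_sigma_finite \<Omega> m ..

lemma T_compose_measurable [measurable (raw)]:
  assumes "f \<in> N \<rightarrow>\<^sub>M \<Omega>" "g \<in> N \<rightarrow>\<^sub>M m"
  shows "(\<lambda>y. T (f y) (g y)) \<in> N \<rightarrow>\<^sub>M m"
  using measurable_compose[OF measurable_Pair[OF assms] T_measurable] by simp

lemma T_space: "\<omega> \<in> space \<Omega> \<Longrightarrow> x \<in> space m \<Longrightarrow> T \<omega> x \<in> space m"
  using measurable_space[OF T_compose_measurable[of "\<lambda>x. \<omega>" m "\<lambda>x. x"]] by simp

lemma T_fixed_measurable [measurable]: "\<omega> \<in> space \<Omega> \<Longrightarrow> T \<omega> \<in> m \<rightarrow>\<^sub>M m"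
  using T_compose_measurable[of "\<lambda>x. \<omega>" m "\<lambda>x. x"] by simp

lemma Pw_integrable: "\<omega> \<in> space \<Omega> \<Longrightarrow> integrable m f \<Longrightarrow> integrable m (Pw \<omega> f)"
  using Pw_transfer unfolding is_transfer_operator_def by blast

lemma bounded_in_Linf:
  "g \<in> borel_measurable m \<Longrightarrow> (\<And>x. x \<in> space m \<Longrightarrow> cmod (g x) \<le> C) \<Longrightarrow> g \<in> Linf m"
  unfolding Linf_def by (auto intro!: exI[of _ C])

lemma Pw_duality:
  assumes "\<omega> \<in> space \<Omega>" "integrable m f" "g \<in> borel_measurable m"
    and "\<And>x. x \<in> space m \<Longrightarrow> cmod (g x) \<le> C"
  shows "(\<integral>x. Pw \<omega> f x * g x \<partial>m) = (\<integral>x. f x * g (T \<omega> x) \<partial>m)"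
  using Pw_transfer[OF assms(1)] assms(2) bounded_in_Linf[OF assms(3,4)]
  unfolding is_transfer_operator_def by blast

lemma Pw_contraction:
  assumes \<omega>: "\<omega> \<in> space \<Omega>" and f: "integrable m f"
  shows "(\<integral>x. cmod (Pw \<omega> f x) \<partial>m) \<le> (\<integral>x. cmod (f x) \<partial>m)"
proof -
  define g where "g = (\<lambda>x. cnj (sgn (Pw \<omega> f x)))"
  have u: "integrable m (Pw \<omega> f)" by (rule Pw_integrable[OF \<omega> f])
  have g: "g \<in> borel_measurable m" "cmod (g x) \<le> 1" for x
    unfolding g_def using u by (auto intro!: borel_measurable_cnj_sgn simp: norm_sgn)
  have "complex_of_real (\<integral>x. cmod (Pw \<omega> f x) \<partial>m) = (\<integral>x. f x * g (T \<omega> x) \<partial>m)"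
    unfolding norm_integral_eq_sign_test[OF u] using Pw_duality[OF \<omega> f g] by (simp add: g_def)
  then have "(\<integral>x. cmod (Pw \<omega> f x) \<partial>m) \<le> cmod (\<integral>x. f x * g (T \<omega> x) \<partial>m)"
    by (metis abs_ge_self norm_of_real)
  also have "\<dots> \<le> (\<integral>x. cmod (f x) \<partial>m)"
  proof (rule norm_integral_le)
    have [measurable]: "T \<omega> \<in> m \<rightarrow>\<^sub>M m" "g \<in> borel_measurable m" using \<omega> g by auto
    have "(\<lambda>x. g (T \<omega> x)) \<in> borel_measurable m" by measurable
    then show "integrable m (\<lambda>x. f x * g (T \<omega> x))"
      using f g(2) by (intro integrable_mult_bounded[where C=1]) auto
    show "cmod (f x * g (T \<omega> x)) \<le> cmod (f x)" for x
      using mult_left_mono[OF g(2), of "cmod (f x)"] by (simp add: norm_mult)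
  qed (use f in auto)
  finally show ?thesis .
qed

lemma Pw_joint_integrable:
  assumes f: "integrable m f"
  shows "integrable (\<Omega> \<Otimes>\<^sub>M m) (\<lambda>(\<omega>, x). Pw \<omega> f x)"
proof (rule Fubini_integrable)
  note [measurable] = Pw_measurable[OF f]
  show "(\<lambda>(\<omega>, x). Pw \<omega> f x) \<in> borel_measurable (\<Omega> \<Otimes>\<^sub>M m)" by measurable
  show "integrable \<Omega> (\<lambda>\<omega>. \<integral>x. norm (case (\<omega>, x) of (\<omega>, x) \<Rightarrow> Pw \<omega> f x) \<partial>m)"
  proof (rule Omega.integrable_const_bound[where B = "\<integral>x. cmod (f x) \<partial>m"])
    show "AE \<omega> in \<Omega>. norm (\<integral>x. norm (case (\<omega>, x) of (\<omega>, x) \<Rightarrow> Pw \<omega> f x) \<partial>m) \<le> (\<integral>x. cmod (f x) \<partial>m)"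
      using Pw_contraction[OF _ f] by (intro AE_I2) simp
  qed measurable
  show "AE \<omega> in \<Omega>. integrable m (\<lambda>x. case (\<omega>, x) of (\<omega>, x) \<Rightarrow> Pw \<omega> f x)"
    using Pw_integrable[OF _ f] by (intro AE_I2) simp
qed

lemma annealed_integrable: "integrable m f \<Longrightarrow> integrable m (annealed \<Omega> Pw f)"
  unfolding annealed_def using integrable_snd[OF Pw_joint_integrable] by simp

definition koopman :: "('x \<Rightarrow> complex) \<Rightarrow> 'x \<Rightarrow> complex" where
  "koopman g x = (\<integral>\<omega>. g (T \<omega> x) \<partial>\<Omega>)"

lemma koopman_measurable [measurable]:
  assumes [measurable]: "g \<in> borel_measurable m"
  shows "koopman g \<in> borel_measurable m"
  unfolding koopman_def by measurable

lemma koopman_bound: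
  assumes "\<And>x. x \<in> space m \<Longrightarrow> cmod (g x) \<le> C" "0 \<le> C" "x \<in> space m"
  shows "cmod (koopman g x) \<le> C"
proof -
  have "cmod (koopman g x) \<le> (\<integral>\<omega>. C \<partial>\<Omega>)"
    unfolding koopman_def
    using assms T_space by (intro Bochner_Integration.integral_norm_bound[THEN order_trans] integral_mono') auto
  then show ?thesis by (simp add: Omega.prob_space)
qed

text \<open>
  Versions of \<open>Pw\<close> are only determined up to null sets depending on \<open>\<omega>\<close>, so the properties of the
  annealed operator below are derived from this pairing, which comes from Fubini's theorem.
\<close>

lemma
  assumes f: "integrable m f" and g[measurable]: "g \<in> borel_measurable m"
    and C: "\<And>x. x \<in> space m \<Longrightarrow> cmod (g x) \<le> C"
  shows annealed_duality_fibrewise: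
      "(\<integral>x. annealed \<Omega> Pw f x * g x \<partial>m) = (\<integral>\<omega>. (\<integral>x. f x * g (T \<omega> x) \<partial>m) \<partial>\<Omega>)"
    and annealed_duality: "(\<integral>x. annealed \<Omega> Pw f x * g x \<partial>m) = (\<integral>x. f x * koopman g x \<partial>m)"
proof -
  note [measurable] = Pw_measurable[OF f] borel_measurable_integrable[OF f]
  have I1: "integrable (\<Omega> \<Otimes>\<^sub>M m) (\<lambda>(\<omega>, x). Pw \<omega> f x * g x)"
    using integrable_mult_bounded[OF Pw_joint_integrable[OF f], of "\<lambda>p. g (snd p)" C] C
    by (auto simp: split_beta' space_pair_measure mem_Times_iff)
  have "integrable (\<Omega> \<Otimes>\<^sub>M m) (\<lambda>p. f (snd p))"
    using f Omega.prob_space by (intro Fubini_integrable) auto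
  then have I2: "integrable (\<Omega> \<Otimes>\<^sub>M m) (\<lambda>(\<omega>, x). f x * g (T \<omega> x))"
    using integrable_mult_bounded[of "\<Omega> \<Otimes>\<^sub>M m" "\<lambda>p. f (snd p)" "\<lambda>p. g (T (fst p) (snd p))" C] C T_space
    by (auto simp: split_beta' space_pair_measure mem_Times_iff)
  have "(\<integral>x. annealed \<Omega> Pw f x * g x \<partial>m) = (\<integral>x. (\<integral>\<omega>. Pw \<omega> f x * g x \<partial>\<Omega>) \<partial>m)"
    unfolding annealed_def by simp
  also have "\<dots> = (\<integral>\<omega>. (\<integral>x. Pw \<omega> f x * g x \<partial>m) \<partial>\<Omega>)"
    by (rule Fubini_integral[OF I1])
  also have "\<dots> = (\<integral>\<omega>. (\<integral>x. f x * g (T \<omega> x) \<partial>m) \<partial>\<Omega>)"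
    by (intro Bochner_Integration.integral_cong refl Pw_duality[OF _ f g C])
  finally show fib: "(\<integral>x. annealed \<Omega> Pw f x * g x \<partial>m) = (\<integral>\<omega>. (\<integral>x. f x * g (T \<omega> x) \<partial>m) \<partial>\<Omega>)" .
  also have "\<dots> = (\<integral>x. (\<integral>\<omega>. f x * g (T \<omega> x) \<partial>\<Omega>) \<partial>m)"
    by (rule Fubini_integral[OF I2, symmetric])
  finally show "(\<integral>x. annealed \<Omega> Pw f x * g x \<partial>m) = (\<integral>x. f x * koopman g x \<partial>m)"
    unfolding koopman_def by simp
qed

lemma annealed_contraction:
  assumes f: "integrable m f"
  shows "L1_norm m (annealed \<Omega> Pw f) \<le> L1_norm m f"
proof -
  let ?u = "annealed \<Omega> Pw f"
  define g where "g = (\<lambda>x. cnj (sgn (?u x)))"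
  have u: "integrable m ?u" by (rule annealed_integrable[OF f])
  have g: "g \<in> borel_measurable m" "cmod (g x) \<le> 1" for x
    unfolding g_def using u by (auto intro!: borel_measurable_cnj_sgn simp: norm_sgn)
  have k: "x \<in> space m \<Longrightarrow> cmod (koopman g x) \<le> 1" for x
    using g(2) by (intro koopman_bound) auto
  have "complex_of_real (L1_norm m ?u) = (\<integral>x. f x * koopman g x \<partial>m)"
    unfolding L1_norm_def norm_integral_eq_sign_test[OF u] using annealed_duality[OF f g] by (simp add: g_def)
  then have "L1_norm m ?u \<le> cmod (\<integral>x. f x * koopman g x \<partial>m)"
    by (metis abs_ge_self norm_of_real)
  also have "\<dots> \<le> L1_norm m f"
    unfolding L1_norm_def
  proof (rule norm_integral_le)
    show "integrable m (\<lambda>x. f x * koopman g x)"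
      using f g k by (intro integrable_mult_bounded[where C=1] koopman_measurable) auto
    show "cmod (f x * koopman g x) \<le> cmod (f x)" if "x \<in> space m" for x
      using mult_left_mono[OF k[OF that], of "cmod (f x)"] by (simp add: norm_mult)
  qed (use f in auto)
  finally show ?thesis .
qed

text \<open>
  Linearity holds almost everywhere only: each \<open>Pw \<omega>\<close> is linear up to a null set depending on \<open>\<omega>\<close> and
  on the functions.
\<close>

lemma annealed_lin:
  assumes f: "integrable m f" and g: "integrable m g"
  shows "AE x in m. annealed \<Omega> Pw (\<lambda>x. a * f x + b * g x) x = a * annealed \<Omega> Pw f x + b * annealed \<Omega> Pw g x"
proof (rule AE_eq_of_indicator_tests[OF X.sigma_finite_measure_axioms])
  fix A assume A[measurable]: "A \<in> sets m"
  let ?i = "indicator A :: 'x \<Rightarrow> complex"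
  have I: "?i \<in> borel_measurable m" "cmod (?i x) \<le> 1" for x by (auto simp: indicator_def)
  have K: "koopman ?i \<in> borel_measurable m" "x \<in> space m \<Longrightarrow> cmod (koopman ?i x) \<le> 1" for x
    using I by (auto intro!: koopman_measurable koopman_bound)
  note int = integrable_mult_bounded[OF _ I] integrable_mult_bounded[OF _ K] annealed_integrable f g
  have "(\<integral>x. annealed \<Omega> Pw (\<lambda>x. a * f x + b * g x) x * ?i x \<partial>m) = (\<integral>x. (a * f x + b * g x) * koopman ?i x \<partial>m)"
    using f g by (intro annealed_duality[OF _ I]) auto
  also have "\<dots> = a * (\<integral>x. f x * koopman ?i x \<partial>m) + b * (\<integral>x. g x * koopman ?i x \<partial>m)"
    by (simp add: distrib_right mult.assoc int)
  also have "\<dots> = a * (\<integral>x. annealed \<Omega> Pw f x * ?i x \<partial>m) + b * (\<integral>x. annealed \<Omega> Pw g x * ?i x \<partial>m)"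
    by (simp add: annealed_duality[OF f I] annealed_duality[OF g I])
  also have "\<dots> = (\<integral>x. (a * annealed \<Omega> Pw f x + b * annealed \<Omega> Pw g x) * ?i x \<partial>m)"
    by (simp add: distrib_right mult.assoc int)
  finally show "(\<integral>x. annealed \<Omega> Pw (\<lambda>x. a * f x + b * g x) x * ?i x \<partial>m) = \<dots>" .
qed (use f g annealed_integrable in auto)

end

section \<open>Exponential moments as iterates of twisted operators\<close>

context random_system
begin

definition twisted :: "('x \<Rightarrow> real) \<Rightarrow> complex \<Rightarrow> ('x \<Rightarrow> complex) \<Rightarrow> 'x \<Rightarrow> complex" where
  "twisted \<phi> z f = annealed \<Omega> Pw (\<lambda>x. exp (z * of_real (\<phi> x)) * f x)"

sublocale noise: sequence_space \<Omega>
  by unfold_locales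

lemma noise_eq: "noise \<Omega> = Pi\<^sub>M UNIV (\<lambda>_. \<Omega>)"
  by (simp add: noise_def)

sublocale noise_prob: prob_space "noise \<Omega>"
  unfolding noise_eq by unfold_locales

lemma orbit_measurable [measurable (raw)]:
  assumes f[measurable]: "f \<in> N \<rightarrow>\<^sub>M noise \<Omega>" and g[measurable]: "g \<in> N \<rightarrow>\<^sub>M m"
  shows "(\<lambda>y. orbit T (f y) (g y) k) \<in> N \<rightarrow>\<^sub>M m"
proof (induction k)
  case (Suc k)
  note [measurable] = Suc
  have "(\<lambda>y. f y k) \<in> N \<rightarrow>\<^sub>M \<Omega>"
    using measurable_compose[OF f[unfolded noise_eq] measurable_component_singleton[of k]] by simp
  then show ?case by simp
qed simp

lemma orbit_space: "w \<in> space (noise \<Omega>) \<Longrightarrow> x \<in> space m \<Longrightarrow> orbit T w x k \<in> space m"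
  using measurable_space[OF orbit_measurable[of "\<lambda>x. w" m "\<lambda>x. x"]] by simp

lemma birkhoff_sum_measurable [measurable (raw)]:
  assumes [measurable]: "\<phi> \<in> borel_measurable m" "f \<in> N \<rightarrow>\<^sub>M noise \<Omega>" "g \<in> N \<rightarrow>\<^sub>M m"
  shows "(\<lambda>y. birkhoff_sum T \<phi> n (f y, g y)) \<in> borel_measurable N"
  unfolding birkhoff_sum_def by simp

lemma birkhoff_sum_bound:
  assumes "\<And>x. x \<in> space m \<Longrightarrow> \<bar>\<phi> x\<bar> \<le> b" "w \<in> space (noise \<Omega>)" "x \<in> space m"
  shows "\<bar>birkhoff_sum T \<phi> n (w, x)\<bar> \<le> real n * b"
proof -
  have "\<bar>\<Sum>k<n. \<phi> (orbit T w x k)\<bar> \<le> (\<Sum>k<n. b)"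
    using assms orbit_space by (intro order_trans[OF sum_abs sum_mono]) auto
  then show ?thesis by (simp add: birkhoff_sum_def)
qed

text \<open>
  The \<open>n\<close>-th power of the adjoint of the twisted operator, written as an expectation over noise paths.
\<close>

definition weighted_koopman :: "('x \<Rightarrow> real) \<Rightarrow> complex \<Rightarrow> nat \<Rightarrow> ('x \<Rightarrow> complex) \<Rightarrow> 'x \<Rightarrow> complex" where
  "weighted_koopman \<phi> z n g x =
     (\<integral>w. exp (z * of_real (birkhoff_sum T \<phi> n (w, x))) * g (orbit T w x n) \<partial>noise \<Omega>)"

text \<open>
  The noise is invariant in law under prepending an independent copy of one step.
\<close>

lemma noise_integral_split:
  fixes F :: "(nat \<Rightarrow> 'w) \<Rightarrow> complex"
  assumes F: "F \<in> borel_measurable (noise \<Omega>)" and B: "\<And>w. w \<in> space (noise \<Omega>) \<Longrightarrow> cmod (F w) \<le> C"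
  shows "(\<integral>w. F w \<partial>noise \<Omega>) = (\<integral>\<omega>. (\<integral>w. F (case_nat \<omega> w) \<partial>noise \<Omega>) \<partial>\<Omega>)"
proof -
  interpret pair: pair_prob_space \<Omega> "noise \<Omega>" ..
  have cn: "(\<lambda>(\<omega>, w). case_nat \<omega> w) \<in> \<Omega> \<Otimes>\<^sub>M noise \<Omega> \<rightarrow>\<^sub>M noise \<Omega>"
    unfolding noise_eq by measurable
  have "(\<integral>w. F w \<partial>noise \<Omega>) = (\<integral>p. F (case p of (\<omega>, w) \<Rightarrow> case_nat \<omega> w) \<partial>(\<Omega> \<Otimes>\<^sub>M noise \<Omega>))"
    using integral_distr[OF cn F] noise.PiM_iter by (simp add: noise_eq)
  also have "\<dots> = (\<integral>\<omega>. (\<integral>w. F (case_nat \<omega> w) \<partial>noise \<Omega>) \<partial>\<Omega>)"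
  proof -
    have "(\<lambda>p. F (case p of (\<omega>, w) \<Rightarrow> case_nat \<omega> w)) \<in> borel_measurable (\<Omega> \<Otimes>\<^sub>M noise \<Omega>)"
      by (rule measurable_compose[OF cn F])
    then have "integrable (\<Omega> \<Otimes>\<^sub>M noise \<Omega>) (\<lambda>p. F (case p of (\<omega>, w) \<Rightarrow> case_nat \<omega> w))"
      using B measurable_space[OF cn] by (intro pair.P.integrable_const_bound[of _ C] AE_I2) auto
    from pair.integral_fst'[OF this] show ?thesis by simp
  qed
  finally show ?thesis .
qed

context
  fixes \<phi> :: "'x \<Rightarrow> real" and b :: real
  assumes \<phi>_measurable [measurable]: "\<phi> \<in> borel_measurable m"
    and \<phi>_bound: "\<And>x. x \<in> space m \<Longrightarrow> \<bar>\<phi> x\<bar> \<le> b"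
begin

lemma exp_bound: "\<bar>s\<bar> \<le> c \<Longrightarrow> cmod (exp (z * of_real s)) \<le> exp (cmod z * c)"
  by (smt (verit) abs_mult abs_norm_cancel exp_le_cancel_iff mult_left_mono norm_exp norm_ge_zero norm_mult norm_of_real)

lemma weight_integrable:
  fixes f :: "'x \<Rightarrow> complex"
  shows "integrable m f \<Longrightarrow> integrable m (\<lambda>x. exp (z * of_real (\<phi> x)) * f x)"
  by (subst mult.commute) (rule integrable_mult_bounded[OF _ _ exp_bound[OF \<phi>_bound]], auto)

lemma twisted_integrable: "integrable m f \<Longrightarrow> integrable m (twisted \<phi> z f)"
  unfolding twisted_def by (intro annealed_integrable weight_integrable)

lemma integrand_bound:
  assumes "\<And>x. x \<in> space m \<Longrightarrow> cmod (g x) \<le> C" "w \<in> space (noise \<Omega>)" "x \<in> space m"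
  shows "cmod (exp (z * of_real (birkhoff_sum T \<phi> n (w, x))) * g (orbit T w x n)) \<le> exp (cmod z * (real n * b)) * C"
  unfolding norm_mult
  by (intro mult_mono exp_bound birkhoff_sum_bound \<phi>_bound assms orbit_space) auto

lemma weighted_koopman_measurable [measurable]:
  assumes [measurable]: "g \<in> borel_measurable m"
  shows "weighted_koopman \<phi> z n g \<in> borel_measurable m"
  unfolding weighted_koopman_def by measurable

lemma weighted_koopman_bound:
  assumes g[measurable]: "g \<in> borel_measurable m" and C: "\<And>x. x \<in> space m \<Longrightarrow> cmod (g x) \<le> C" and x: "x \<in> space m"
  shows "cmod (weighted_koopman \<phi> z n g x) \<le> exp (cmod z * (real n * b)) * C"
proof -
  have [measurable]: "(\<lambda>w. exp (z * of_real (birkhoff_sum T \<phi> n (w, x))) * g (orbit T w x n)) \<in> borel_measurable (noise \<Omega>)"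
    using x by measurable
  let ?D = "exp (cmod z * (real n * b)) * C"
  have D: "w \<in> space (noise \<Omega>) \<Longrightarrow> cmod (exp (z * of_real (birkhoff_sum T \<phi> n (w, x))) * g (orbit T w x n)) \<le> ?D" for w
    by (rule integrand_bound[OF C _ x])
  have "cmod (weighted_koopman \<phi> z n g x) \<le> (\<integral>w. ?D \<partial>noise \<Omega>)"
    unfolding weighted_koopman_def
    by (intro norm_integral_le noise_prob.integrable_const D noise_prob.integrable_const_bound[where B="?D", OF AE_I2[OF D]]) auto
  then show ?thesis by (simp add: noise_prob.prob_space)
qed

text \<open>
  Splitting off the first noise coordinate: the orbit then starts afresh at \<open>T \<omega> x\<close>, and the first
  summand \<open>\<phi> x\<close> of the Birkhoff sum contributes a factor that does not depend on the noise.
\<close>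

lemma weighted_koopman_Suc:
  assumes g[measurable]: "g \<in> borel_measurable m" and C: "\<And>x. x \<in> space m \<Longrightarrow> cmod (g x) \<le> C" and x: "x \<in> space m"
  shows "weighted_koopman \<phi> z (Suc n) g x = exp (z * of_real (\<phi> x)) * koopman (weighted_koopman \<phi> z n g) x"
proof -
  let ?F = "\<lambda>w. exp (z * of_real (birkhoff_sum T \<phi> (Suc n) (w, x))) * g (orbit T w x (Suc n))"
  have F: "?F \<in> borel_measurable (noise \<Omega>)" using x by measurable
  have "weighted_koopman \<phi> z (Suc n) g x = (\<integral>\<omega>. (\<integral>w. ?F (case_nat \<omega> w) \<partial>noise \<Omega>) \<partial>\<Omega>)"
    unfolding weighted_koopman_def
    by (rule noise_integral_split[OF F]) (rule integrand_bound[OF C _ x])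
  also have "\<dots> = (\<integral>\<omega>. exp (z * of_real (\<phi> x)) * weighted_koopman \<phi> z n g (T \<omega> x) \<partial>\<Omega>)"
    unfolding weighted_koopman_def orbit_case_nat birkhoff_sum_case_nat
    by (simp add: distrib_left exp_add mult.assoc)
  finally show ?thesis by (simp add: koopman_def)
qed

lemma twisted_duality:
  assumes f: "integrable m f" and g[measurable]: "g \<in> borel_measurable m"
    and C: "\<And>x. x \<in> space m \<Longrightarrow> cmod (g x) \<le> C"
  shows "(\<integral>x. (twisted \<phi> z ^^ n) f x * g x \<partial>m) = (\<integral>x. f x * weighted_koopman \<phi> z n g x \<partial>m)"
  using f
proof (induction n arbitrary: f)
  case 0
  show ?case by (simp add: weighted_koopman_def birkhoff_sum_def noise_prob.prob_space)
next
  case (Suc n)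
  have "(\<integral>x. (twisted \<phi> z ^^ Suc n) f x * g x \<partial>m) = (\<integral>x. twisted \<phi> z f x * weighted_koopman \<phi> z n g x \<partial>m)"
    unfolding funpow_Suc_right o_apply by (rule Suc.IH[OF twisted_integrable[OF Suc.prems]])
  also have "\<dots> = (\<integral>x. (exp (z * of_real (\<phi> x)) * f x) * koopman (weighted_koopman \<phi> z n g) x \<partial>m)"
    unfolding twisted_def
    by (rule annealed_duality[OF weight_integrable[OF Suc.prems] weighted_koopman_measurable[OF g]
        weighted_koopman_bound[OF g C]])
  also have "\<dots> = (\<integral>x. f x * weighted_koopman \<phi> z (Suc n) g x \<partial>m)"
    by (intro Bochner_Integration.integral_cong refl) (simp add: weighted_koopman_Suc[OF g C] mult_ac)
  finally show ?case .
qed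

text \<open>
  The test function \<open>g\<close> serves to read off, at \<open>z = 0\<close>, the law of the position after \<open>n\<close> steps;
  exponential moments are the case \<open>g = 1\<close>.
\<close>

lemma twisted_moment:
  assumes h: "h \<in> borel_measurable m" "\<And>x. x \<in> space m \<Longrightarrow> 0 \<le> (h x :: real)" and \<nu>: "prob_space (density m (\<lambda>x. ennreal (h x)))"
    and hi: "integrable m (\<lambda>x. complex_of_real (h x))"
    and g[measurable]: "g \<in> borel_measurable m" and C: "\<And>x. x \<in> space m \<Longrightarrow> cmod (g x) \<le> C"
  shows "(\<integral>p. exp (z * of_real (birkhoff_sum T \<phi> n p)) * g (orbit T (fst p) (snd p) n) \<partial>(noise \<Omega> \<Otimes>\<^sub>M density m (\<lambda>x. ennreal (h x))))
    = (\<integral>x. (twisted \<phi> z ^^ n) (\<lambda>x. complex_of_real (h x)) x * g x \<partial>m)"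
proof -
  let ?\<nu> = "density m (\<lambda>x. ennreal (h x))"
  interpret \<nu>: prob_space ?\<nu> by (rule \<nu>)
  interpret pair: pair_prob_space "noise \<Omega>" ?\<nu> ..
  let ?F = "\<lambda>w x. exp (z * of_real (birkhoff_sum T \<phi> n (w, x))) * g (orbit T w x n)"
  have [measurable]: "snd \<in> N \<Otimes>\<^sub>M ?\<nu> \<rightarrow>\<^sub>M m" for N :: "(nat \<Rightarrow> 'w) measure" by (simp add: measurable_snd')
  have "(\<lambda>p. ?F (fst p) (snd p)) \<in> borel_measurable (noise \<Omega> \<Otimes>\<^sub>M ?\<nu>)" by measurable
  then have "integrable (noise \<Omega> \<Otimes>\<^sub>M ?\<nu>) (\<lambda>p. ?F (fst p) (snd p))"
    using integrand_bound[OF C]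
    by (intro pair.P.integrable_const_bound[of _ "exp (cmod z * (real n * b)) * C"] AE_I2)
      (auto simp: space_pair_measure)
  then have "integrable (noise \<Omega> \<Otimes>\<^sub>M ?\<nu>) (\<lambda>(w, x). ?F w x)" by (simp add: split_beta')
  from pair.integral_snd[OF this]
  have "(\<integral>p. ?F (fst p) (snd p) \<partial>(noise \<Omega> \<Otimes>\<^sub>M ?\<nu>)) = (\<integral>x. weighted_koopman \<phi> z n g x \<partial>?\<nu>)"
    by (simp add: weighted_koopman_def split_beta')
  also have "\<dots> = (\<integral>x. complex_of_real (h x) * weighted_koopman \<phi> z n g x \<partial>m)"
    using h by (subst integral_density) (auto simp: scaleR_conv_of_real)
  also have "\<dots> = (\<integral>x. (twisted \<phi> z ^^ n) (\<lambda>x. complex_of_real (h x)) x * g x \<partial>m)"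
    by (rule twisted_duality[OF hi g C, symmetric])
  finally show ?thesis by simp
qed

end

end

section \<open>Functions modulo null sets as a normed space\<close>

definition cscale :: "complex \<Rightarrow> ('a \<Rightarrow> complex) \<Rightarrow> 'a \<Rightarrow> complex" where
  "cscale c F = (\<lambda>A. c * F A)"

interpretation cscale: vector_space cscale
  by unfold_locales (auto simp: cscale_def algebra_simps)

text \<open>
  An integrable function modulo null sets is the same thing as its indefinite integral. Representing
  classes by complex set functions makes the quotient a genuine subspace of a vector space, on which
  operators that are linear almost everywhere become linear and \<open>nrm\<close> becomes a norm.
\<close>

definition indefinite_integral :: "'x measure \<Rightarrow> ('x \<Rightarrow> complex) \<Rightarrow> 'x set \<Rightarrow> complex" where
  "indefinite_integral M f A = (if A \<in> sets M then \<integral>x. f x * indicator A x \<partial>M else 0)"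

lemma integrable_times_indicator:
  fixes f :: "'x \<Rightarrow> complex"
  assumes "integrable M f" "A \<in> sets M"
  shows "integrable M (\<lambda>x. f x * indicator A x)"
  using assms by (intro integrable_mult_bounded[where C=1]) (auto simp: indicator_def)

lemma indefinite_integral_eq_iff:
  assumes "sigma_finite_measure M" "integrable M f" "integrable M g"
  shows "indefinite_integral M f = indefinite_integral M g \<longleftrightarrow> (AE x in M. f x = g x)"
proof
  assume eq: "indefinite_integral M f = indefinite_integral M g"
  show "AE x in M. f x = g x"
  proof (rule AE_eq_of_indicator_tests[OF assms])
    fix A assume "A \<in> sets M"
    then show "(\<integral>x. f x * indicator A x \<partial>M) = (\<integral>x. g x * indicator A x \<partial>M)"
      using fun_cong[OF eq, of A] by (simp add: indefinite_integral_def)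
  qed
next
  assume "AE x in M. f x = g x"
  then show "indefinite_integral M f = indefinite_integral M g"
    unfolding indefinite_integral_def using assms
    by (auto intro!: ext integral_cong_AE borel_measurable_times)
qed

lemma indefinite_integral_lin:
  assumes "integrable M f" "integrable M g"
  shows "indefinite_integral M (\<lambda>x. a * f x + b * g x)
    = cscale a (indefinite_integral M f) + cscale b (indefinite_integral M g)"
  using assms by (auto simp: indefinite_integral_def cscale_def distrib_right mult.assoc integrable_times_indicator)

lemma indefinite_integral_space: "indefinite_integral M f (space M) = (\<integral>x. f x \<partial>M)"
  unfolding indefinite_integral_def by (auto intro!: Bochner_Integration.integral_cong)

lemma L1_norm_triangle_ineq:
  assumes "integrable m u" "integrable m v" "integrable m f"
  shows "L1_norm m (\<lambda>x. u x - v x) \<le> L1_norm m (\<lambda>x. u x - f x) + L1_norm m (\<lambda>x. v x - f x)"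
proof -
  have "(\<integral>x. cmod (u x - v x) \<partial>m) \<le> (\<integral>x. cmod (u x - f x) + cmod (v x - f x) \<partial>m)"
  proof (intro integral_mono)
    show "cmod (u x - v x) \<le> cmod (u x - f x) + cmod (v x - f x)" for x
      using norm_triangle_ineq4[of "u x - f x" "v x - f x"] by simp
  qed (use assms in auto)
  then show ?thesis unfolding L1_norm_def using assms by simp
qed

context spectral_random_system
begin

lemma B_lin: "f \<in> B \<Longrightarrow> g \<in> B \<Longrightarrow> (\<lambda>x. a * f x + b * g x) \<in> B"
  by (rule B_add[OF B_scale B_scale])

lemma B_diff: "f \<in> B \<Longrightarrow> g \<in> B \<Longrightarrow> (\<lambda>x. f x - g x) \<in> B"
  using B_lin[of f g 1 "-1"] by simp

lemma B_measurable: "f \<in> B \<Longrightarrow> f \<in> borel_measurable m"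
  by (rule borel_measurable_integrable[OF B_integrable])

lemma nrm_cong:
  assumes "f \<in> B" "g \<in> B" "AE x in m. f x = g x"
  shows "nrm f = nrm g"
proof -
  have le: "nrm f \<le> nrm g" if fg: "f \<in> B" "g \<in> B" "AE x in m. f x = g x" for f g
  proof -
    have "nrm f = nrm (\<lambda>x. g x + (f x - g x))" by simp
    also have "\<dots> \<le> nrm g + nrm (\<lambda>x. f x - g x)" by (intro nrm_triangle B_diff fg)
    also have "nrm (\<lambda>x. f x - g x) = 0" using fg by (subst nrm_zero) (auto simp: B_diff)
    finally show ?thesis by simp
  qed
  have "AE x in m. g x = f x" using assms(3) by (rule eventually_mono) simp
  from le[OF assms] le[OF assms(2,1) this] show ?thesis by simp
qed

abbreviation cls :: "('x \<Rightarrow> complex) \<Rightarrow> 'x set \<Rightarrow> complex" where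
  "cls \<equiv> indefinite_integral m"

lemma cls_eq_iff: "f \<in> B \<Longrightarrow> g \<in> B \<Longrightarrow> cls f = cls g \<longleftrightarrow> (AE x in m. f x = g x)"
  by (intro indefinite_integral_eq_iff B_integrable X.sigma_finite_measure_axioms)

text \<open>
  A choice of representatives. It is not linear, and results are transferred through
  \<open>class_norm_cls\<close> and \<open>lift_cls\<close>, which hold for every representative.
\<close>

definition rep :: "('x set \<Rightarrow> complex) \<Rightarrow> 'x \<Rightarrow> complex" where
  "rep = inv_into B cls"

definition class_norm :: "('x set \<Rightarrow> complex) \<Rightarrow> real" where
  "class_norm F = nrm (rep F)"

definition lift :: "(('x \<Rightarrow> complex) \<Rightarrow> 'x \<Rightarrow> complex) \<Rightarrow> ('x set \<Rightarrow> complex) \<Rightarrow> 'x set \<Rightarrow> complex" where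
  "lift L F = cls (L (rep F))"

lemma rep: "F \<in> cls ` B \<Longrightarrow> rep F \<in> B" "F \<in> cls ` B \<Longrightarrow> cls (rep F) = F"
  by (simp_all add: rep_def inv_into_into f_inv_into_f)

lemma rep_cls: "f \<in> B \<Longrightarrow> AE x in m. rep (cls f) x = f x"
  using rep[of "cls f"] by (subst cls_eq_iff[symmetric]) auto

lemma class_norm_cls: "f \<in> B \<Longrightarrow> class_norm (cls f) = nrm f"
  unfolding class_norm_def using rep[of "cls f"] rep_cls by (intro nrm_cong) auto

lemma cls_lin: "f \<in> B \<Longrightarrow> g \<in> B \<Longrightarrow>
    cls (\<lambda>x. a * f x + b * g x) = cscale a (cls f) + cscale b (cls g)"
  by (intro indefinite_integral_lin B_integrable)

lemma cls_add: "f \<in> B \<Longrightarrow> g \<in> B \<Longrightarrow> cls (\<lambda>x. f x + g x) = cls f + cls g"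
  using cls_lin[of f g 1 1] by simp

lemma cls_diff: "f \<in> B \<Longrightarrow> g \<in> B \<Longrightarrow> cls (\<lambda>x. f x - g x) = cls f - cls g"
  using cls_lin[of f g 1 "-1"] by (simp add: cscale.scale_minus_left)

lemma cls_scale: "f \<in> B \<Longrightarrow> cls (\<lambda>x. a * f x) = cscale a (cls f)"
  using cls_lin[of f f a 0] by simp

lemma cls_zero: "cls (\<lambda>x. 0) = 0"
  using cls_scale[OF B_zero, of 0] by simp

sublocale Q: normed_subspace cscale "cls ` B" class_norm
proof unfold_locales
  show "0 \<in> cls ` B" using imageI[OF B_zero, of cls] by (simp only: cls_zero)
  fix F G and c :: complex assume F: "F \<in> cls ` B"
  then obtain f where f: "f \<in> B" "F = cls f" by auto
  show "cscale c F \<in> cls ` B" unfolding f(2) cls_scale[OF f(1), symmetric] by (intro imageI B_scale f)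
  show "class_norm (cscale c F) = cmod c * class_norm F"
    using f by (simp add: cls_scale[symmetric] class_norm_cls B_scale nrm_scale)
  show "F = 0" if "class_norm F = 0"
    using that f nrm_zero[of f] cls_eq_iff[OF f(1) B_zero] by (simp add: class_norm_cls cls_zero)
  assume "G \<in> cls ` B"
  then obtain g where g: "g \<in> B" "G = cls g" by auto
  show "F + G \<in> cls ` B" unfolding f(2) g(2) cls_add[OF f(1) g(1), symmetric] by (intro imageI B_add f g)
  show "class_norm (F + G) \<le> class_norm F + class_norm G"
    using f g by (simp add: cls_add[symmetric] class_norm_cls B_add nrm_triangle)
qed

text \<open>
  The operators on functions that induce bounded linear operators on classes. Compatibility with
  equality almost everywhere follows from linearity and boundedness (\<open>admissible_cong\<close>).
\<close>

definition admissible :: "(('x \<Rightarrow> complex) \<Rightarrow> 'x \<Rightarrow> complex) \<Rightarrow> real \<Rightarrow> bool" where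
  "admissible L C \<longleftrightarrow> (\<forall>f\<in>B. L f \<in> B \<and> nrm (L f) \<le> C * nrm f) \<and>
     (\<forall>f\<in>B. \<forall>g\<in>B. \<forall>a b. AE x in m. L (\<lambda>x. a * f x + b * g x) x = a * L f x + b * L g x)"

lemma admissible_cong:
  assumes L: "admissible L C" and fg: "f \<in> B" "g \<in> B" "AE x in m. f x = g x"
  shows "AE x in m. L f x = L g x"
proof -
  have d: "(\<lambda>x. f x - g x) \<in> B" "nrm (\<lambda>x. f x - g x) = 0"
    using fg by (auto simp: B_diff nrm_zero)
  have Ld: "L (\<lambda>x. f x - g x) \<in> B" "nrm (L (\<lambda>x. f x - g x)) \<le> 0"
    using L d unfolding admissible_def by force+
  then have "AE x in m. L (\<lambda>x. f x - g x) x = 0"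
    using nrm_zero[OF Ld(1)] nrm_nonneg[OF Ld(1)] by simp
  moreover have "AE x in m. L (\<lambda>x. f x - g x) x = L f x - L g x"
  proof -
    have "AE x in m. L (\<lambda>x. 1 * f x + (- 1) * g x) x = 1 * L f x + (- 1) * L g x"
      using L fg(1,2) unfolding admissible_def by blast
    then show ?thesis by simp
  qed
  ultimately show ?thesis by eventually_elim simp
qed

lemma lift_cls: "admissible L C \<Longrightarrow> f \<in> B \<Longrightarrow> lift L (cls f) = cls (L f)"
  unfolding lift_def using rep[of "cls f"] admissible_cong[of L C "rep (cls f)" f] rep_cls[of f]
  by (subst cls_eq_iff) (auto simp: admissible_def)

lemma funpow_mem_B: "admissible L C \<Longrightarrow> f \<in> B \<Longrightarrow> (L ^^ n) f \<in> B"
  by (induction n) (auto simp: admissible_def)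

lemma lift_funpow: "admissible L C \<Longrightarrow> f \<in> B \<Longrightarrow> (lift L ^^ n) (cls f) = cls ((L ^^ n) f)"
  by (induction n) (auto simp: lift_cls funpow_mem_B)

lemma lift_operator:
  assumes L: "admissible L C"
  shows "Q.operator (lift L) C"
proof -
  have L_B: "L f \<in> B" "nrm (L f) \<le> C * nrm f" if "f \<in> B" for f
    using L that by (auto simp: admissible_def)
  have lin: "lift L (cscale a (cls f) + cscale b (cls g)) = cscale a (lift L (cls f)) + cscale b (lift L (cls g))"
    if "f \<in> B" "g \<in> B" for a b f g
  proof -
    have "lift L (cscale a (cls f) + cscale b (cls g)) = cls (L (\<lambda>x. a * f x + b * g x))"
      using that by (simp add: cls_lin[symmetric] lift_cls[OF L] B_lin)
    also have "\<dots> = cls (\<lambda>x. a * L f x + b * L g x)"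
      using L that by (subst cls_eq_iff) (auto simp: admissible_def B_lin)
    finally show ?thesis using that by (simp add: cls_lin L_B lift_cls[OF L])
  qed
  show ?thesis
    unfolding Q.operator_def
  proof (intro conjI ballI allI)
    fix F G c assume "F \<in> cls ` B"
    then obtain f where f: "f \<in> B" "F = cls f" by auto
    show "lift L F \<in> cls ` B" "class_norm (lift L F) \<le> C * class_norm F"
      using f L_B by (auto simp: lift_cls[OF L] class_norm_cls)
    show "lift L (cscale c F) = cscale c (lift L F)"
      using lin[of f f c 0] f by simp
    assume "G \<in> cls ` B"
    then obtain g where g: "g \<in> B" "G = cls g" by auto
    show "lift L (F + G) = lift L F + lift L G"
      using lin[of f g 1 1] f g by simp
  qed
qed

abbreviation PP :: "('x \<Rightarrow> complex) \<Rightarrow> 'x \<Rightarrow> complex" where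
  "PP \<equiv> annealed \<Omega> Pw"

definition L1_const :: real where
  "L1_const = (SOME C. 0 \<le> C \<and> (\<forall>f\<in>B. L1_norm m f \<le> C * nrm f))"

lemma L1_const: "0 \<le> L1_const" "f \<in> B \<Longrightarrow> L1_norm m f \<le> L1_const * nrm f"
proof -
  obtain C where C: "\<forall>f\<in>B. L1_norm m f \<le> C * nrm f"
    using compact_embedding unfolding compactly_embedded_L1_def by blast
  have "L1_norm m f \<le> \<bar>C\<bar> * nrm f" if "f \<in> B" for f
    using C that mult_right_mono[OF abs_ge_self[of C] nrm_nonneg[OF that]] by force
  then have "0 \<le> \<bar>C\<bar> \<and> (\<forall>f\<in>B. L1_norm m f \<le> \<bar>C\<bar> * nrm f)" by simp
  then have "0 \<le> L1_const \<and> (\<forall>f\<in>B. L1_norm m f \<le> L1_const * nrm f)"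
    unfolding L1_const_def by (rule someI)
  then show "0 \<le> L1_const" "f \<in> B \<Longrightarrow> L1_norm m f \<le> L1_const * nrm f" by auto
qed

definition mass :: "('x set \<Rightarrow> complex) \<Rightarrow> complex" where
  "mass F = F (space m)"

lemma mass_cls: "mass (cls f) = (\<integral>x. f x \<partial>m)"
  by (simp add: mass_def indefinite_integral_space)

lemma mass_lin: "mass (F + G) = mass F + mass G" "mass (cscale c F) = c * mass F" "mass (F - G) = mass F - mass G"
  by (simp_all add: mass_def cscale_def)

lemma mass_bound: "F \<in> cls ` B \<Longrightarrow> cmod (mass F) \<le> L1_const * class_norm F"
proof (elim imageE)
  fix f assume f: "F = cls f" "f \<in> B"
  have "cmod (\<integral>x. f x \<partial>m) \<le> L1_norm m f" unfolding L1_norm_def by (rule integral_norm_bound)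
  also have "\<dots> \<le> L1_const * nrm f" by (rule L1_const(2)[OF f(2)])
  finally show ?thesis using f by (simp add: mass_cls class_norm_cls)
qed

lemma P_admissible: "\<exists>C. admissible PP C"
proof -
  obtain C where "\<forall>f\<in>B. nrm (PP f) \<le> C * nrm f" using P_bounded ..
  then have "admissible PP C"
    unfolding admissible_def by (intro conjI ballI allI P_invariant annealed_lin B_integrable) auto
  then show ?thesis ..
qed

lemma integral_annealed: "integrable m f \<Longrightarrow> (\<integral>x. PP f x \<partial>m) = (\<integral>x. f x \<partial>m)"
  using annealed_duality[of f "\<lambda>_. 1" 1] by (simp add: koopman_def Omega.prob_space)

lemma mass_lift_P: "F \<in> cls ` B \<Longrightarrow> mass (lift PP F) = mass F"
proof -
  obtain C where C: "admissible PP C" using P_admissible ..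
  assume "F \<in> cls ` B"
  then show ?thesis by (auto simp: lift_cls[OF C] mass_cls integral_annealed B_integrable)
qed


end

context spectral_random_system
begin
section \<open>Spectral gap of the annealed operator\<close>

text \<open>
  The abstract results apply to the classes of integral 0 with the \<open>L\<^sup>1\<close> norm as weak norm. An
  eigenvector there with eigenvalue of modulus 1 has eigenvalue 1 because there is no other peripheral
  eigenvalue, so by simplicity it is a multiple of \<open>h\<close>; as \<open>h\<close> has integral 1, the multiple is 0.
\<close>

lemma spectral_gap:
  assumes h: "h \<in> B" "(\<integral>x. h x \<partial>m) = 1" "AE x in m. PP h x = h x"
  shows "\<exists>D. \<forall>n. \<forall>F\<in>cls ` B. mass F = 0 \<longrightarrow>
    real (Suc n) * class_norm ((lift PP ^^ n) F) \<le> D * class_norm F"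
proof -
  define V where "V = {F \<in> cls ` B. mass F = 0}"
  define q where "q = (\<lambda>F. L1_norm m (rep F))"
  obtain C where C: "admissible PP C" using P_admissible ..
  interpret K: normed_subspace cscale V class_norm
  proof unfold_locales
    show "0 \<in> V" using Q.zero_mem by (simp add: V_def mass_def)
  qed (simp_all add: V_def mass_lin Q.add_mem Q.scale_mem Q.norm_add Q.norm_scale Q.norm_zeroD)
  have V_mem: "\<exists>f\<in>B. F = cls f \<and> (\<integral>x. f x \<partial>m) = 0" if "F \<in> V" for F
    using that by (auto simp: V_def mass_cls)
  have q_cls: "q (cls f) = L1_norm m f" if "f \<in> B" for f
  proof -
    note [measurable] = B_measurable[OF that] B_measurable[OF rep(1)[OF imageI[OF that]]]
    show ?thesis
      unfolding q_def L1_norm_def using rep_cls[OF that] by (intro integral_cong_AE) auto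
  qed
  have op: "K.operator (lift PP) C"
    unfolding K.operator_def using lift_operator[OF C] by (auto simp: Q.operator_def V_def mass_lift_P)
  obtain N \<rho>0 K where N: "1 \<le> N" and LY0: "\<rho>0 < 1" "0 \<le> K"
    "\<And>f. f \<in> B \<Longrightarrow> nrm ((PP ^^ N) f) \<le> \<rho>0 * nrm f + K * L1_norm m f"
    using lasota_yorke by auto
  (* The constant of the inequality may be negative; a nonnegative one is wanted for iteration. *)
  define \<rho> where "\<rho> = max \<rho>0 0"
  have \<rho>: "0 \<le> \<rho>" "\<rho> < 1" using LY0 by (auto simp: \<rho>_def)
  have LY: "class_norm ((lift PP ^^ N) F) \<le> \<rho> * class_norm F + K * q F" if F: "F \<in> V" for F
  proof -
    obtain f where f: "f \<in> B" "F = cls f" using V_mem[OF F] by auto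
    have "\<rho>0 * nrm f \<le> \<rho> * nrm f" by (intro mult_right_mono nrm_nonneg f) (simp add: \<rho>_def)
    then show ?thesis
      using LY0(3)[OF f(1)] f by (simp add: lift_funpow[OF C] class_norm_cls funpow_mem_B[OF C] q_cls)
  qed
  have q: "0 \<le> q F" "q F \<le> L1_const * class_norm F" "q (lift PP F) \<le> q F" if F: "F \<in> V" for F
  proof -
    obtain f where f: "f \<in> B" "F = cls f" using V_mem[OF F] by auto
    show "0 \<le> q F" by (simp add: q_def L1_norm_def)
    show "q F \<le> L1_const * class_norm F" using f by (simp add: q_cls class_norm_cls L1_const)
    show "q (lift PP F) \<le> q F"
      using f by (simp add: lift_cls[OF C] q_cls P_invariant annealed_contraction B_integrable)
  qed
  have "\<exists>A\<ge>0. \<forall>n. \<forall>F\<in>V. class_norm ((lift PP ^^ n) F) \<le> A * class_norm F"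
    by (rule K.power_bounded_of_lasota_yorke[where P="lift PP" and q=q and K=K and \<rho>=\<rho> and N=N and Cq=L1_const, OF op N \<rho> LY0(2) LY q])
  then obtain A where A0: "0 \<le> A \<and> (\<forall>n. \<forall>F\<in>V. class_norm ((lift PP ^^ n) F) \<le> A * class_norm F)" ..
  then have A: "0 \<le> A" "\<And>n F. F \<in> V \<Longrightarrow> class_norm ((lift PP ^^ n) F) \<le> A * class_norm F"
    by simp_all
  have compact: "\<exists>r. strict_mono r \<and> (\<forall>e>0. \<exists>M. \<forall>i\<ge>M. \<forall>j\<ge>M. q (u (r i) - u (r (j::nat))) < e)"
    if u: "\<And>n. u n \<in> V" "\<And>n. class_norm (u n) \<le> 1" for u :: "nat \<Rightarrow> 'x set \<Rightarrow> complex"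
  proof -
    define f where "f = (\<lambda>n. rep (u n))"
    have f: "f n \<in> B" "cls (f n) = u n" "nrm (f n) \<le> 1" for n
      using u rep by (auto simp: f_def V_def class_norm_def)
    have "(\<forall>n. f n \<in> B) \<and> (\<exists>C. \<forall>n. nrm (f n) \<le> C)" using f by auto
    with compact_embedding have "\<exists>r g. strict_mono (r :: nat \<Rightarrow> nat) \<and> integrable m g \<and>
        (\<lambda>n. L1_norm m (\<lambda>x. f (r n) x - g x)) \<longlonglongrightarrow> 0"
      unfolding compactly_embedded_L1_def by simp
    then obtain r g where rg: "strict_mono (r :: nat \<Rightarrow> nat) \<and> integrable m g \<and>
        (\<lambda>n. L1_norm m (\<lambda>x. f (r n) x - g x)) \<longlonglongrightarrow> 0"
      by (elim exE) (rule that)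
    then have r: "strict_mono r" and g: "integrable m g"
      and lim: "(\<lambda>n. L1_norm m (\<lambda>x. f (r n) x - g x)) \<longlonglongrightarrow> 0" by auto
    have "\<exists>M. \<forall>i\<ge>M. \<forall>j\<ge>M. q (u (r i) - u (r j)) < e" if "e > 0" for e
    proof -
      obtain M where M: "\<And>n. n \<ge> M \<Longrightarrow> L1_norm m (\<lambda>x. f (r n) x - g x) < e / 2"
        using order_tendstoD(2)[OF lim, of "e / 2"] \<open>e > 0\<close> by (auto simp: eventually_sequentially)
      have "q (u (r i) - u (r j)) < e" if "i \<ge> M" "j \<ge> M" for i j
      proof -
        have "q (u (r i) - u (r j)) = L1_norm m (\<lambda>x. f (r i) x - f (r j) x)"
          unfolding f(2)[symmetric] by (simp add: cls_diff[symmetric] q_cls B_diff f(1))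
        also have "\<dots> \<le> L1_norm m (\<lambda>x. f (r i) x - g x) + L1_norm m (\<lambda>x. f (r j) x - g x)"
          by (intro L1_norm_triangle_ineq B_integrable f g)
        also have "\<dots> < e" using M[OF that(1)] M[OF that(2)] by simp
        finally show ?thesis .
      qed
      then show ?thesis by blast
    qed
    then show ?thesis using r by blast
  qed
  have complete: "\<exists>F\<in>V. (\<lambda>n. class_norm (u n - F)) \<longlonglongrightarrow> 0"
    if u: "\<And>n. u n \<in> V" and Cauchy: "\<forall>e>0. \<exists>M. \<forall>i\<ge>M. \<forall>j\<ge>M. class_norm (u i - u j) < e"
    for u :: "nat \<Rightarrow> 'x set \<Rightarrow> complex"
  proof -
    define f where "f = (\<lambda>n. rep (u n))"
    have f: "f n \<in> B" "u n = cls (f n)" for n using u rep by (auto simp: f_def V_def)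
    have "class_norm (u i - u j) = nrm (\<lambda>x. f i x - f j x)" for i j
      using f by (simp add: cls_diff[symmetric] class_norm_cls B_diff)
    then obtain g where g: "g \<in> B" "(\<lambda>n. nrm (\<lambda>x. f n x - g x)) \<longlonglongrightarrow> 0"
      using B_complete[of f] f(1) Cauchy by auto
    have lim: "(\<lambda>n. class_norm (u n - cls g)) \<longlonglongrightarrow> 0"
      using g f by (simp add: cls_diff[symmetric] class_norm_cls B_diff)
    have "cmod (mass (cls g)) \<le> 0"
    proof (rule tendsto_le[OF sequentially_bot])
      show "(\<lambda>n. L1_const * class_norm (u n - cls g)) \<longlonglongrightarrow> 0"
        using lim by (auto intro!: tendsto_eq_intros)
      show "\<forall>\<^sub>F n in sequentially. cmod (mass (cls g)) \<le> L1_const * class_norm (u n - cls g)"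
        using mass_bound[OF Q.diff_mem] u g by (intro always_eventually) (force simp: V_def mass_lin)
    qed auto
    then have "cls g \<in> V" using g by (simp add: V_def)
    with lim show ?thesis by blast
  qed
  have no_eig: "F = 0" if z: "cmod z = 1" and F: "F \<in> V" and eig: "lift PP F = cscale z F" for z F
  proof (rule ccontr)
    assume "F \<noteq> 0"
    obtain f where f: "f \<in> B" "F = cls f" "(\<integral>x. f x \<partial>m) = 0" using V_mem[OF F] by auto
    have nz: "\<not> (AE x in m. f x = 0)"
      using \<open>F \<noteq> 0\<close> f cls_eq_iff[OF f(1) B_zero] by (simp add: cls_zero)
    have ev: "AE x in m. PP f x = z * f x"
      using eig f by (simp add: lift_cls[OF C] cls_scale[symmetric] cls_eq_iff P_invariant B_scale)
    have "eigenvalue m B PP z" unfolding eigenvalue_def by (intro bexI[OF _ f(1)] conjI nz ev)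
    then have "z = 1" by (rule no_other[OF z])
    obtain h' where h': "h' \<in> B" and uniq: "\<And>k f. f \<in> B \<Longrightarrow>
        (AE x in m. ((\<lambda>g y. PP g y - 1 * g y) ^^ k) f x = 0) \<Longrightarrow> \<exists>c. AE x in m. f x = c * h' x"
      using simple unfolding simple_eigenvalue_def by auto
    obtain c where c: "AE x in m. f x = c * h' x"
      using uniq[of f 1] f ev \<open>z = 1\<close> by auto
    obtain c' where c': "AE x in m. h x = c' * h' x"
      using uniq[of h 1] h by auto
    have I: "(\<integral>x. u x \<partial>m) = a * (\<integral>x. h' x \<partial>m)" if "u \<in> B" "AE x in m. u x = a * h' x" for u a
      using integral_cong_AE[OF _ _ that(2)] B_measurable[OF that(1)] B_measurable[OF h'] by simp
    have "c = 0" using I[OF f(1) c] I[OF h(1) c'] f h by auto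
    then show False using nz c by simp
  qed
  have "\<exists>c>0. \<forall>z. \<forall>F\<in>V. cmod z = 1 \<longrightarrow> c * class_norm F \<le> class_norm (F - cscale z (lift PP F))"
    by (rule K.circle_bound_of_no_peripheral_eigenvalue[where P="lift PP" and q=q and K=K and \<rho>=\<rho> and N=N and A=A, OF op N A \<rho>(2) LY0(2) LY compact complete no_eig])
  then obtain c where c0: "c > 0"
      "\<forall>z. \<forall>F\<in>V. cmod z = 1 \<longrightarrow> c * class_norm F \<le> class_norm (F - cscale z (lift PP F))"
    by metis
  then have c: "c > 0" "\<And>z F. cmod z = 1 \<Longrightarrow> F \<in> V \<Longrightarrow> c * class_norm F \<le> class_norm (F - cscale z (lift PP F))"
    by simp_all
  have "\<exists>D. \<forall>n. \<forall>F\<in>V. real (Suc n) * class_norm ((lift PP ^^ n) F) \<le> D * class_norm F"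
    by (rule K.power_decay_of_circle_bound[where P="lift PP" and A=A and c=c, OF op A c])
  then obtain D where D: "\<forall>n. \<forall>F\<in>V. real (Suc n) * class_norm ((lift PP ^^ n) F) \<le> D * class_norm F" ..
  show ?thesis
    by (rule exI[of _ D]) (use D in \<open>auto simp: V_def\<close>)
qed

end

section \<open>Twisting by a bounded multiplier\<close>

context spectral_random_system
begin

lemma real_part_measurable: "(\<lambda>x. complex_of_real (k x)) \<in> B \<Longrightarrow> k \<in> borel_measurable m"
  using measurable_compose[OF B_measurable[of "\<lambda>x. complex_of_real (k x)"] borel_measurable_Re] by simp

text \<open>
  The real densities that represent the measures of \<open>measures_with_density_in m B\<close>.
\<close>

definition B_density :: "('x \<Rightarrow> real) \<Rightarrow> bool" where
  "B_density k \<longleftrightarrow> (\<forall>x\<in>space m. 0 \<le> k x) \<and> (\<lambda>x. complex_of_real (k x)) \<in> B \<and>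
     prob_space (density m (\<lambda>x. ennreal (k x)))"

lemma B_densityD:
  assumes "B_density k"
  shows "x \<in> space m \<Longrightarrow> 0 \<le> k x" "(\<lambda>x. complex_of_real (k x)) \<in> B"
    "prob_space (density m (\<lambda>x. ennreal (k x)))" "k \<in> borel_measurable m"
  using assms real_part_measurable[of k] by (auto simp: B_density_def)

lemma measures_with_density_inE:
  assumes "\<nu> \<in> measures_with_density_in m B"
  obtains k where "B_density k" "\<nu> = density m (\<lambda>x. ennreal (k x))"
  using assms unfolding measures_with_density_in_def B_density_def by auto

lemma density_mass:
  assumes k: "B_density k"
  shows "(\<integral>x. complex_of_real (k x) \<partial>m) = 1"
proof -
  interpret K: prob_space "density m (\<lambda>x. ennreal (k x))" by (rule B_densityD[OF k])
  have "1 = (\<integral>x. (1::real) \<partial>density m (\<lambda>x. ennreal (k x)))" using K.prob_space by simp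
  also have "\<dots> = (\<integral>x. k x \<partial>m)"
    using B_densityD[OF k] by (subst integral_density) auto
  finally show ?thesis by simp
qed

abbreviation law :: "('x \<Rightarrow> real) \<Rightarrow> ((nat \<Rightarrow> 'w) \<times> 'x) measure" where
  "law k \<equiv> noise \<Omega> \<Otimes>\<^sub>M density m (\<lambda>x. ennreal (k x))"

lemma law_prob:
  assumes "B_density k"
  shows "prob_space (law k)"
proof -
  interpret K: prob_space "density m (\<lambda>x. ennreal (k x))" by (rule B_densityD[OF assms])
  interpret pair: pair_prob_space "noise \<Omega>" "density m (\<lambda>x. ennreal (k x))" ..
  show ?thesis by (rule pair.P.prob_space_axioms)
qed

end

text \<open>
  A bounded multiplier \<open>\<phi>\<close> of \<open>B\<close>, centred with respect to a stationary density \<open>h\<close>; the number \<open>a\<close> bounds the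
  operator norm of multiplication by \<open>\<phi>\<close>.
\<close>

locale observable_system = spectral_random_system \<Omega> m T Pw B nrm
  for \<Omega> :: "'w measure" and m :: "'x measure" and T Pw B nrm +
  fixes \<phi> :: "'x \<Rightarrow> real" and a b :: real and h :: "'x \<Rightarrow> real"
  assumes phi_measurable [measurable]: "\<phi> \<in> borel_measurable m"
    and phi_bound: "\<And>x. x \<in> space m \<Longrightarrow> \<bar>\<phi> x\<bar> \<le> b"
    and a_nonneg: "0 \<le> a"
    and phi_mult: "\<And>f. f \<in> B \<Longrightarrow> (\<lambda>x. complex_of_real (\<phi> x) * f x) \<in> B"
    and phi_mult_norm: "\<And>f. f \<in> B \<Longrightarrow> nrm (\<lambda>x. complex_of_real (\<phi> x) * f x) \<le> a * nrm f"
    and h_density: "B_density h"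
    and h_fixed: "AE x in m. annealed \<Omega> Pw (\<lambda>x. complex_of_real (h x)) x = complex_of_real (h x)"
    and phi_centred: "(\<integral>x. complex_of_real (h x) * complex_of_real (\<phi> x) \<partial>m) = 0"
begin

lemmas h_mem = B_densityD(2)[OF h_density]

lemmas h_mass = density_mass[OF h_density]

text \<open>
  The exponential series of the multiplication operator converges in \<open>B\<close>, with the norms of its terms
  dominated by those of the series for \<open>exp (\<bar>z\<bar> a)\<close>. It also converges pointwise to the product with
  \<open>exp (z \<phi>)\<close>; the two limits agree almost everywhere because a subsequence of an \<open>L\<^sup>1\<close>-convergent
  sequence converges almost everywhere.
\<close>

lemma exp_multiplier:
  assumes f: "f \<in> B"
  shows "(\<lambda>x. exp (z * of_real (\<phi> x)) * f x) \<in> B \<and>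
    nrm (\<lambda>x. exp (z * of_real (\<phi> x)) * f x - f x) \<le> (exp (cmod z * a) - 1) * nrm f"
proof -
  define y where "y = cmod z * a"
  have y: "0 \<le> y" using a_nonneg by (simp add: y_def)
  define e where "e = (\<lambda>x. exp (z * of_real (\<phi> x)) * f x)"
  define t where "t = (\<lambda>k x. (z * of_real (\<phi> x)) ^ k / fact k * f x)"
  define S where "S = (\<lambda>n x. \<Sum>k<n. t k x)"
  define E where "E = (\<lambda>n. \<Sum>k<n. y ^ k / fact k)"
  have t: "t k \<in> B \<and> nrm (t k) \<le> y ^ k / fact k * nrm f" for k
  proof (induction k)
    case 0 show ?case using f by (simp add: t_def)
  next
    case (Suc k)
    let ?c = "z / of_nat (Suc k)"
    have eq: "t (Suc k) = (\<lambda>x. ?c * (of_real (\<phi> x) * t k x))"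
      by (auto simp: t_def field_simps)
    have M: "(\<lambda>x. of_real (\<phi> x) * t k x) \<in> B" "nrm (\<lambda>x. of_real (\<phi> x) * t k x) \<le> a * nrm (t k)"
      using phi_mult phi_mult_norm Suc by auto
    have "nrm (t (Suc k)) = cmod ?c * nrm (\<lambda>x. of_real (\<phi> x) * t k x)"
      unfolding eq by (rule nrm_scale[OF M(1)])
    also have "\<dots> \<le> cmod ?c * (a * (y ^ k / fact k * nrm f))"
      using M(2) mult_left_mono[OF conjunct2[OF Suc] a_nonneg] by (intro mult_left_mono) auto
    also have "\<dots> = y ^ Suc k / fact (Suc k) * nrm f"
      by (simp add: norm_divide y_def field_simps del: of_nat_Suc)
    finally show ?case unfolding eq using B_scale[OF M(1), of ?c] by simp
  qed
  have S_B: "S n \<in> B" for n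
  proof (induction n)
    case 0 show ?case using B_zero by (simp add: S_def)
  next
    case (Suc n)
    have "S (Suc n) = (\<lambda>x. S n x + t n x)" by (auto simp: S_def)
    then show ?case using B_add[OF Suc conjunct1[OF t]] by simp
  qed
  have S_diff: "nrm (\<lambda>x. S (i + d) x - S i x) \<le> (E (i + d) - E i) * nrm f" for i d
  proof (induction d)
    case 0
    have "nrm (\<lambda>x. 0) = 0" using nrm_zero[OF B_zero] by simp
    then show ?case by simp
  next
    case (Suc d)
    have "(\<lambda>x. S (i + Suc d) x - S i x) = (\<lambda>x. (S (i + d) x - S i x) + t (i + d) x)"
      by (auto simp: S_def)
    then have "nrm (\<lambda>x. S (i + Suc d) x - S i x) \<le> nrm (\<lambda>x. S (i + d) x - S i x) + nrm (t (i + d))"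
      using nrm_triangle[OF B_diff[OF S_B S_B] conjunct1[OF t]] by simp
    also have "\<dots> \<le> (E (i + d) - E i) * nrm f + y ^ (i + d) / fact (i + d) * nrm f"
      using Suc t[of "i + d"] by simp
    also have "\<dots> = (E (i + Suc d) - E i) * nrm f" by (simp add: E_def algebra_simps)
    finally show ?case .
  qed
  have E_lim: "E \<longlonglongrightarrow> exp y"
    using exp_converges[of y] by (simp add: sums_def E_def scaleR_conv_of_real divide_inverse mult.commute)
  have E_le: "E n \<le> exp y" for n
    using sum_le_suminf[OF sums_summable[OF exp_converges[of y]], of "{..<n}"] y
    by (simp add: E_def exp_def scaleR_conv_of_real divide_inverse mult.commute)
  have "\<exists>M. \<forall>i\<ge>M. \<forall>j\<ge>M. nrm (\<lambda>x. S i x - S j x) < \<epsilon>" if "\<epsilon> > 0" for \<epsilon>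
  proof -
    define \<delta> where "\<delta> = \<epsilon> / (nrm f + 1)"
    have nf: "0 \<le> nrm f" by (rule nrm_nonneg[OF f])
    have "\<delta> > 0" using that nf by (simp add: \<delta>_def)
    then obtain M where M: "\<And>i. i \<ge> M \<Longrightarrow> exp y - \<delta> < E i"
      using order_tendstoD(1)[OF E_lim, of "exp y - \<delta>"] by (auto simp: eventually_sequentially)
    have main: "nrm (\<lambda>x. S j x - S i x) < \<epsilon>" if "i \<ge> M" "i \<le> j" for i j
    proof -
      have "nrm (\<lambda>x. S j x - S i x) \<le> (E j - E i) * nrm f" using S_diff[of i "j - i"] that by simp
      also have "\<dots> \<le> \<delta> * nrm f" using M[OF that(1)] E_le[of j] nf by (intro mult_right_mono) auto
      also have "\<dots> < \<epsilon>" using \<open>\<epsilon> > 0\<close> nf by (simp add: \<delta>_def field_simps)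
      finally show ?thesis .
    qed
    have "nrm (\<lambda>x. S i x - S j x) < \<epsilon>" if "i \<ge> M" "j \<ge> M" for i j
    proof (cases "i \<le> j")
      case True
      have "(\<lambda>x. S i x - S j x) = (\<lambda>x. (-1) * (S j x - S i x))" by auto
      then have "nrm (\<lambda>x. S i x - S j x) = nrm (\<lambda>x. S j x - S i x)"
        using nrm_scale[OF B_diff[OF S_B S_B], of "-1" j i] by simp
      then show ?thesis using main[OF that(1) True] by simp
    next
      case False then show ?thesis using main[of j i] that by simp
    qed
    then show ?thesis by auto
  qed
  then obtain g where g: "g \<in> B" and lim: "(\<lambda>n. nrm (\<lambda>x. S n x - g x)) \<longlonglongrightarrow> 0"
    using B_complete[of S] S_B by auto
  have "(\<lambda>n. L1_norm m (\<lambda>x. S n x - g x)) \<longlonglongrightarrow> 0"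
  proof (rule tendsto_sandwich[of "\<lambda>_. 0" _ _ "\<lambda>n. L1_const * nrm (\<lambda>x. S n x - g x)"])
    show "(\<lambda>n. L1_const * nrm (\<lambda>x. S n x - g x)) \<longlonglongrightarrow> 0"
      using lim by (auto intro!: tendsto_eq_intros)
  qed (auto simp: L1_norm_def L1_const(2)[OF B_diff[OF S_B g], unfolded L1_norm_def])
  then obtain r where r: "strict_mono r" and sub: "AE x in m. (\<lambda>n. S (r n) x - g x) \<longlonglongrightarrow> 0"
    using tendsto_L1_AE_subseq[of m "\<lambda>n x. S n x - g x"] B_integrable[OF B_diff[OF S_B g]]
    by (auto simp: L1_norm_def)
  have pointwise: "(\<lambda>n. S n x) \<longlonglongrightarrow> e x" for x
  proof -
    have "(\<lambda>n. (\<Sum>k<n. (z * of_real (\<phi> x)) ^ k / fact k) * f x) \<longlonglongrightarrow> exp (z * of_real (\<phi> x)) * f x"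
      using exp_converges[of "z * of_real (\<phi> x)"]
      by (intro tendsto_mult tendsto_const) (simp add: sums_def scaleR_conv_of_real divide_inverse mult.commute)
    then show ?thesis by (simp add: S_def t_def e_def sum_distrib_right)
  qed
  have ge: "AE x in m. g x = e x"
    using sub
  proof eventually_elim
    case (elim x)
    have "(\<lambda>n. S (r n) x) \<longlonglongrightarrow> e x"
      using LIMSEQ_subseq_LIMSEQ[OF pointwise r] by (simp add: o_def)
    moreover have "(\<lambda>n. S (r n) x) \<longlonglongrightarrow> g x" using elim by (rule LIM_zero_cancel)
    ultimately show ?case by (rule LIMSEQ_unique[symmetric])
  qed
  have e_B: "e \<in> B"
  proof (rule B_AE[OF g _ ge])
    show "e \<in> borel_measurable m" unfolding e_def using B_measurable[OF f] by measurable
  qed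
  have "nrm (\<lambda>x. e x - f x) \<le> (exp y - 1) * nrm f"
  proof (rule tendsto_le[OF sequentially_bot])
    show "(\<lambda>n. nrm (\<lambda>x. S n x - g x) + (E n - 1) * nrm f) \<longlonglongrightarrow> (exp y - 1) * nrm f"
      using lim E_lim by (auto intro!: tendsto_eq_intros)
    show "\<forall>\<^sub>F n in sequentially. nrm (\<lambda>x. e x - f x) \<le> nrm (\<lambda>x. S n x - g x) + (E n - 1) * nrm f"
      using eventually_ge_at_top[of 1]
    proof eventually_elim
      case (elim n)
      have S1: "S 1 = f" by (auto simp: S_def t_def)
      have "nrm (\<lambda>x. e x - f x) = nrm (\<lambda>x. (-1) * (S n x - g x) + (S n x - f x))"
      proof (rule nrm_cong)
        show "AE x in m. e x - f x = - 1 * (S n x - g x) + (S n x - f x)"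
          using ge by eventually_elim simp
      qed (rule B_add[OF B_scale[OF B_diff[OF S_B g]] B_diff[OF S_B f]] B_diff[OF e_B f])+
      also have "\<dots> \<le> nrm (\<lambda>x. (-1) * (S n x - g x)) + nrm (\<lambda>x. S n x - f x)"
        by (rule nrm_triangle[OF B_scale[OF B_diff[OF S_B g]] B_diff[OF S_B f]])
      also have "nrm (\<lambda>x. (-1) * (S n x - g x)) = nrm (\<lambda>x. S n x - g x)"
        using nrm_scale[OF B_diff[OF S_B g], of "-1" n] by simp
      also have "nrm (\<lambda>x. S n x - f x) \<le> (E n - 1) * nrm f"
        using S_diff[of 1 "n - 1"] elim by (simp add: S1[unfolded One_nat_def] E_def)
      finally show ?case by simp
    qed
  qed auto
  then show ?thesis using e_B by (simp add: e_def y_def)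
qed

end

context observable_system
begin

lemma twisted_admissible:
  assumes C: "admissible PP C" "0 \<le> C"
  shows "admissible (twisted \<phi> z) (C * exp (cmod z * a))"
    and "f \<in> B \<Longrightarrow> nrm (\<lambda>x. twisted \<phi> z f x - PP f x) \<le> C * (exp (cmod z * a) - 1) * nrm f"
proof -
  define e where "e = (\<lambda>f x. exp (z * of_real (\<phi> x)) * f x)"
  have e_B: "e f \<in> B" and e_diff: "nrm (\<lambda>x. e f x - f x) \<le> (exp (cmod z * a) - 1) * nrm f" if "f \<in> B" for f
    using exp_multiplier[OF that, of z] by (auto simp: e_def)
  have tw: "twisted \<phi> z f = PP (e f)" for f by (simp add: twisted_def e_def)
  have P: "PP f \<in> B" "nrm (PP f) \<le> C * nrm f" if "f \<in> B" for f
    using C that by (auto simp: admissible_def)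
  have P_lin: "AE x in m. PP (\<lambda>x. c * f x + d * g x) x = c * PP f x + d * PP g x" if "f \<in> B" "g \<in> B" for f g c d
    using that by (intro annealed_lin B_integrable)
  have e_norm: "nrm (e f) \<le> exp (cmod z * a) * nrm f" if f: "f \<in> B" for f
  proof -
    have "nrm (e f) = nrm (\<lambda>x. f x + (e f x - f x))" by simp
    also have "\<dots> \<le> nrm f + nrm (\<lambda>x. e f x - f x)" by (rule nrm_triangle[OF f B_diff[OF e_B[OF f] f]])
    finally show ?thesis using e_diff[OF f] by (simp add: algebra_simps)
  qed
  show "admissible (twisted \<phi> z) (C * exp (cmod z * a))"
    unfolding admissible_def tw
  proof (intro conjI ballI allI)
    fix f g c d assume f: "f \<in> B"
    show "PP (e f) \<in> B" by (rule P[OF e_B[OF f]])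
    show "nrm (PP (e f)) \<le> C * exp (cmod z * a) * nrm f"
      using order_trans[OF P(2)[OF e_B[OF f]] mult_left_mono[OF e_norm[OF f] C(2)]] by (simp add: mult.assoc)
    assume g: "g \<in> B"
    have "e (\<lambda>x. c * f x + d * g x) = (\<lambda>x. c * e f x + d * e g x)"
      by (auto simp: e_def algebra_simps)
    then show "AE x in m. PP (e (\<lambda>x. c * f x + d * g x)) x = c * PP (e f) x + d * PP (e g) x"
      using P_lin[OF e_B[OF f] e_B[OF g], of c d] by simp
  qed
  show "nrm (\<lambda>x. twisted \<phi> z f x - PP f x) \<le> C * (exp (cmod z * a) - 1) * nrm f" if f: "f \<in> B"
  proof -
    have "nrm (\<lambda>x. PP (e f) x - PP f x) = nrm (PP (\<lambda>x. e f x - f x))"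
    proof (rule nrm_cong[OF B_diff[OF P(1)[OF e_B[OF f]] P(1)[OF f]] P(1)[OF B_diff[OF e_B[OF f] f]]])
      show "AE x in m. PP (e f) x - PP f x = PP (\<lambda>x. e f x - f x) x"
        using P_lin[OF e_B[OF f] f, of 1 "-1"] by eventually_elim simp
    qed
    also have "\<dots> \<le> C * nrm (\<lambda>x. e f x - f x)" by (rule P(2)[OF B_diff[OF e_B[OF f] f]])
    also have "\<dots> \<le> C * ((exp (cmod z * a) - 1) * nrm f)" by (intro mult_left_mono e_diff f C)
    finally show ?thesis by (simp add: tw mult.assoc)
  qed
qed

abbreviation hc :: "'x \<Rightarrow> complex" where
  "hc \<equiv> \<lambda>x. complex_of_real (h x)"

definition unit_mass_ball :: "real \<Rightarrow> ('x \<Rightarrow> complex) set" where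
  "unit_mass_ball R = {f \<in> B. (\<integral>x. f x \<partial>m) = 1 \<and> nrm (\<lambda>x. f x - hc x) \<le> R}"

text \<open>
  The perturbation theorem on classes, with the integral as functional: \<open>twisted \<phi> z\<close> differs from the
  annealed operator by at most \<open>C (exp (\<bar>z\<bar> a) - 1)\<close> in operator norm. The rate \<open>t\<close> is the same for all
  radii \<open>R\<close>; only \<open>\<delta>\<close> depends on \<open>R\<close>.
\<close>

theorem twisted_controlled_growth:
  "\<exists>t>0. t < 1 \<and> (\<forall>R>0. \<exists>\<delta>>0. \<forall>z. cmod z < \<delta> \<longrightarrow>
    (\<forall>f\<in>unit_mass_ball R. \<forall>g\<in>unit_mass_ball R. controlled_growth (integral\<^sup>L m) (twisted \<phi> z) t f g))"
proof -
  obtain C0 where C0: "admissible PP C0" using P_admissible ..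
  define C where "C = \<bar>C0\<bar>"
  have C: "admissible PP C" "0 \<le> C"
    using C0 nrm_nonneg mult_right_mono[OF abs_ge_self[of C0]]
    unfolding admissible_def C_def by (auto intro: order_trans)
  have P_op: "Q.operator (lift PP) C" by (rule lift_operator[OF C(1)])
  have hV: "cls hc \<in> cls ` B" by (rule imageI[OF h_mem])
  have "cls (PP hc) = cls hc"
    using h_fixed by (subst cls_eq_iff) (auto simp: h_mem P_invariant)
  then have Ph: "lift PP (cls hc) = cls hc" by (simp add: lift_cls[OF C(1) h_mem])
  have mh: "mass (cls hc) = 1" by (simp only: mass_cls h_mass)
  obtain D where D: "\<forall>n. \<forall>F\<in>cls ` B. mass F = 0 \<longrightarrow> real (Suc n) * class_norm ((lift PP ^^ n) F) \<le> D * class_norm F"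
    using spectral_gap[OF h_mem h_mass h_fixed] ..
  have D': "real (Suc n) * class_norm ((lift PP ^^ n) F) \<le> D * class_norm F" if "F \<in> cls ` B" "mass F = 0" for n F
    using D[rule_format, OF that] .
  have "\<exists>t>0. t < 1 \<and> (\<forall>R>0. \<exists>\<eta>>0. \<forall>L. Q.operator_near (lift PP) \<eta> L \<longrightarrow>
      (\<forall>x\<in>Q.affine_ball mass (cls hc) R. \<forall>y\<in>Q.affine_ball mass (cls hc) R. controlled_growth mass L t x y))"
    by (rule Q.perturbed_ratios[where P="lift PP" and h="cls hc" and \<psi>=mass and c=L1_const and D=D,
      OF P_op hV Ph mh mass_lin(1) mass_lin(2) mass_bound L1_const(1) mass_lift_P D'])
  then obtain t where t: "t > 0" "t < 1" and main: "\<forall>R>0. \<exists>\<eta>>0. \<forall>L. Q.operator_near (lift PP) \<eta> L \<longrightarrow>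
      (\<forall>x\<in>Q.affine_ball mass (cls hc) R. \<forall>y\<in>Q.affine_ball mass (cls hc) R. controlled_growth mass L t x y)"
    by (elim exE conjE) (rule that)
  show ?thesis
  proof (rule exI[of _ t], intro conjI allI impI t)
    fix R :: real assume "R > 0"
    from main[rule_format, OF this] obtain \<eta> where \<eta>: "\<eta> > 0" and
      est: "\<forall>L. Q.operator_near (lift PP) \<eta> L \<longrightarrow>
      (\<forall>x\<in>Q.affine_ball mass (cls hc) R. \<forall>y\<in>Q.affine_ball mass (cls hc) R. controlled_growth mass L t x y)"
      by (elim exE conjE) (rule that)
    have "((\<lambda>r. C * (exp (r * a) - 1)) \<longlongrightarrow> C * (exp (0 * a) - 1)) (nhds 0)"
      by (intro tendsto_intros filterlim_ident)
    from order_tendstoD(2)[OF this, of \<eta>] obtain \<delta> where \<delta>: "\<delta> > 0" "\<And>r. \<bar>r\<bar> < \<delta> \<Longrightarrow> C * (exp (r * a) - 1) < \<eta>"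
      using \<eta> by (auto simp: eventually_nhds_metric dist_real_def)
    show "\<exists>\<delta>>0. \<forall>z. cmod z < \<delta> \<longrightarrow>
      (\<forall>f\<in>unit_mass_ball R. \<forall>g\<in>unit_mass_ball R. controlled_growth (integral\<^sup>L m) (twisted \<phi> z) t f g)"
    proof (rule exI[of _ \<delta>], intro conjI \<delta>(1) allI ballI impI)
      fix z f g assume z: "cmod z < \<delta>" and fg: "f \<in> unit_mass_ball R" "g \<in> unit_mass_ball R"
      let ?L = "lift (twisted \<phi> z)"
      have adm: "admissible (twisted \<phi> z) (C * exp (cmod z * a))" by (rule twisted_admissible(1)[OF C])
      have close: "\<forall>x\<in>cls ` B. class_norm (?L x - lift PP x) \<le> \<eta> * class_norm x"
      proof (intro ballI, elim imageE)
        fix F u assume u: "F = cls u" "u \<in> B"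
        have tB: "twisted \<phi> z u \<in> B" using adm u by (simp add: admissible_def)
        have "class_norm (?L F - lift PP F) = nrm (\<lambda>x. twisted \<phi> z u x - PP u x)"
          using u by (simp add: lift_cls[OF adm] lift_cls[OF C(1)] cls_diff[OF tB P_invariant, symmetric]
            class_norm_cls[OF B_diff[OF tB P_invariant]])
        also have "\<dots> \<le> C * (exp (cmod z * a) - 1) * nrm u" by (rule twisted_admissible(2)[OF C u(2)])
        also have "\<dots> \<le> \<eta> * nrm u" using \<delta>(2)[of "cmod z"] z by (intro mult_right_mono nrm_nonneg u) auto
        finally show "class_norm (?L F - lift PP F) \<le> \<eta> * class_norm F" using u by (simp add: class_norm_cls)
      qed
      have mom: "mass ((?L ^^ n) (cls u)) = integral\<^sup>L m ((twisted \<phi> z ^^ n) u)" if "u \<in> B" for u n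
        using that by (simp add: lift_funpow[OF adm] mass_cls)
      have ball: "u \<in> B \<and> cls u \<in> Q.affine_ball mass (cls hc) R" if "u \<in> unit_mass_ball R" for u
        using that by (auto simp: unit_mass_ball_def Q.affine_ball_def mass_cls
          cls_diff[OF _ h_mem, symmetric] class_norm_cls[OF B_diff[OF _ h_mem]])
      have "Q.operator_near (lift PP) \<eta> ?L"
        using lift_operator[OF adm] close by (auto simp: Q.operator_near_def)
      then have "controlled_growth mass ?L t (cls f) (cls g)"
        using est ball[OF fg(1)] ball[OF fg(2)] by simp
      then show "controlled_growth (integral\<^sup>L m) (twisted \<phi> z) t f g"
        unfolding controlled_growth_def growth_def mom[OF conjunct1[OF ball[OF fg(1)]]] mom[OF conjunct1[OF ball[OF fg(2)]]] .
    qed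
  qed
qed

end

section \<open>Legendre transform and local large deviations\<close>

text \<open>
  A differentiable function with strictly increasing derivative on a neighbourhood of 0.
  Nonnegativity and strict convexity of its Legendre transform come from the strict tangent inequality (\<open>above_tangent\<close>).
\<close>

locale pressure =
  fixes \<Lambda> \<Lambda>' :: "real \<Rightarrow> real" and r :: real
  assumes r_pos: "0 < r"
    and deriv: "\<And>\<theta>. \<bar>\<theta>\<bar> < r \<Longrightarrow> (\<Lambda> has_real_derivative \<Lambda>' \<theta>) (at \<theta>)"
    and deriv_cont: "continuous_on {-r<..<r} \<Lambda>'"
    and deriv_mono: "strict_mono_on {-r<..<r} \<Lambda>'"
    and at_zero: "\<Lambda> 0 = 0" "\<Lambda>' 0 = 0"
begin

lemma mvt:
  assumes "-r < x" "x < y" "y < r"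
  shows "\<exists>\<xi>. x < \<xi> \<and> \<xi> < y \<and> \<Lambda> y - \<Lambda> x = (y - x) * \<Lambda>' \<xi>"
  using MVT2[of x y \<Lambda> \<Lambda>'] assms deriv by force

lemma above_tangent:
  assumes "\<bar>x\<bar> < r" "\<bar>y\<bar> < r" "x \<noteq> y"
  shows "\<Lambda> x + (y - x) * \<Lambda>' x < \<Lambda> y"
proof (cases "x < y")
  case True
  then obtain \<xi> where \<xi>: "x < \<xi>" "\<xi> < y" "\<Lambda> y - \<Lambda> x = (y - x) * \<Lambda>' \<xi>" using mvt[of x y] assms by (auto simp: abs_less_iff)
  have "\<Lambda>' x < \<Lambda>' \<xi>" using \<xi> assms by (intro strict_mono_onD[OF deriv_mono]) (auto simp: abs_less_iff)
  then have "(y - x) * \<Lambda>' x < (y - x) * \<Lambda>' \<xi>" using True by simp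
  then show ?thesis using \<xi>(3) by linarith
next
  case False
  then have "y < x" using assms by simp
  then obtain \<xi> where \<xi>: "y < \<xi>" "\<xi> < x" "\<Lambda> x - \<Lambda> y = (x - y) * \<Lambda>' \<xi>" using mvt[of y x] assms by (auto simp: abs_less_iff)
  have "\<Lambda>' \<xi> < \<Lambda>' x" using \<xi> assms by (intro strict_mono_onD[OF deriv_mono]) (auto simp: abs_less_iff)
  then have "(x - y) * \<Lambda>' \<xi> < (x - y) * \<Lambda>' x" using \<open>y < x\<close> by simp
  then show ?thesis using \<xi>(3) by (simp add: algebra_simps)
qed

text \<open>
  The inverse of \<open>\<Lambda>'\<close>, which is injective on the interval of radius \<open>r\<close>.
\<close>

definition tilt :: "real \<Rightarrow> real" where
  "tilt x = (SOME \<theta>. \<bar>\<theta>\<bar> < r \<and> \<Lambda>' \<theta> = x)"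

text \<open>
  The Legendre transform of \<open>\<Lambda>\<close>: the supremum over \<open>\<bar>\<theta>\<bar> < r\<close> of \<open>\<theta> x - \<Lambda> \<theta>\<close> is attained at \<open>tilt x\<close> (\<open>rate_ge\<close>).
\<close>

definition rate :: "real \<Rightarrow> real" where
  "rate x = x * tilt x - \<Lambda> (tilt x)"

text \<open>
  Halving the radius keeps the endpoints inside the region where \<open>\<Lambda>'\<close> is known to be continuous and
  strictly increasing, so that the intermediate value theorem applies.
\<close>

definition rate_domain :: "real set" where
  "rate_domain = {\<Lambda>' (- r / 2)<..<\<Lambda>' (r / 2)}"

lemma deriv_inj: "\<bar>x\<bar> < r \<Longrightarrow> \<bar>y\<bar> < r \<Longrightarrow> \<Lambda>' x = \<Lambda>' y \<Longrightarrow> x = y"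
  using strict_mono_onD[OF deriv_mono, of x y] strict_mono_onD[OF deriv_mono, of y x]
  by (cases x y rule: linorder_cases) (auto simp: abs_less_iff)

lemma tilt_deriv: "\<bar>\<theta>\<bar> < r \<Longrightarrow> tilt (\<Lambda>' \<theta>) = \<theta>"
  unfolding tilt_def by (rule some_equality) (auto intro: deriv_inj)

lemma deriv_attains:
  assumes "-r < u" "u < v" "v < r" "\<Lambda>' u < x" "x < \<Lambda>' v"
  obtains \<theta> where "u < \<theta>" "\<theta> < v" "\<Lambda>' \<theta> = x"
proof -
  have "continuous_on {u..v} \<Lambda>'" using assms by (intro continuous_on_subset[OF deriv_cont]) auto
  then obtain \<theta> where "u \<le> \<theta>" "\<theta> \<le> v" "\<Lambda>' \<theta> = x"
    using IVT'[of \<Lambda>' u x v] assms by auto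
  then show ?thesis using that assms by (metis less_eq_real_def order_less_irrefl)
qed

lemma tilt:
  assumes "x \<in> rate_domain"
  shows "\<bar>tilt x\<bar> < r" "\<Lambda>' (tilt x) = x"
proof -
  obtain \<theta> where "- r / 2 < \<theta>" "\<theta> < r / 2" "\<Lambda>' \<theta> = x"
    using deriv_attains[of "- r / 2" "r / 2" x] assms r_pos by (auto simp: rate_domain_def)
  then have "\<bar>\<theta>\<bar> < r" "tilt x = \<theta>" "\<Lambda>' \<theta> = x" using tilt_deriv[of \<theta>] r_pos by auto
  then show "\<bar>tilt x\<bar> < r" "\<Lambda>' (tilt x) = x" by auto
qed

lemma rate_ge:
  assumes "x \<in> rate_domain" "\<bar>\<theta>\<bar> < r"
  shows "\<theta> * x - \<Lambda> \<theta> \<le> rate x" and "\<theta> \<noteq> tilt x \<Longrightarrow> \<theta> * x - \<Lambda> \<theta> < rate x"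
proof -
  show strict: "\<theta> * x - \<Lambda> \<theta> < rate x" if "\<theta> \<noteq> tilt x"
    using above_tangent[of "tilt x" \<theta>] tilt[OF assms(1)] assms(2) that
    by (simp add: rate_def algebra_simps)
  then show "\<theta> * x - \<Lambda> \<theta> \<le> rate x"
    by (cases "\<theta> = tilt x") (auto simp: rate_def mult.commute)
qed

lemma zero_in_domain: "0 \<in> rate_domain"
  using strict_mono_onD[OF deriv_mono, of "- r / 2" 0] strict_mono_onD[OF deriv_mono, of 0 "r / 2"] r_pos at_zero
  by (auto simp: rate_domain_def)

lemma rate_nonneg: "x \<in> rate_domain \<Longrightarrow> 0 \<le> rate x"
  using rate_ge(1)[of x 0] r_pos at_zero by simp

lemma rate_eq_zero_iff: "x \<in> rate_domain \<Longrightarrow> rate x = 0 \<longleftrightarrow> x = 0"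
proof
  assume x: "x \<in> rate_domain"
  { assume "rate x = 0"
    then have "tilt x = 0" using rate_ge(2)[OF x, of 0] r_pos at_zero by auto
    then show "x = 0" using tilt(2)[OF x] at_zero by simp }
  { assume "x = 0"
    then show "rate x = 0" using tilt_deriv[of 0] r_pos at_zero by (simp add: rate_def) }
qed

text \<open>
  At a convex combination \<open>z\<close> of \<open>x\<close> and \<open>y\<close>, the affine function with slope \<open>tilt z\<close> agrees with the rate
  at \<open>z\<close>, and lies strictly below the rate at \<open>x\<close> and \<open>y\<close>, whose maximisers are different.
\<close>

lemma rate_strictly_convex: "strictly_convex_on rate_domain rate"
  unfolding strictly_convex_on_def
proof (intro conjI ballI allI impI)
  show conv: "convex rate_domain" by (simp add: rate_domain_def)
  fix x y t :: real assume xy: "x \<in> rate_domain" "y \<in> rate_domain" and t: "x \<noteq> y \<and> 0 < t \<and> t < 1"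
  define z where "z = (1 - t) * x + t * y"
  have z: "z \<in> rate_domain"
    using convexD_alt[OF conv xy, of t] t by (simp add: z_def)
  note \<theta> = tilt[OF z]
  have "z - x = t * (y - x)" "z - y = (1 - t) * (x - y)" by (simp_all add: z_def algebra_simps)
  then have "x \<noteq> z" "y \<noteq> z" using t by auto
  then have "tilt z \<noteq> tilt x" "tilt z \<noteq> tilt y" using tilt xy z by metis+
  then have "tilt z * x - \<Lambda> (tilt z) < rate x" "tilt z * y - \<Lambda> (tilt z) < rate y"
    using rate_ge(2) xy \<theta> by auto
  then have "(1 - t) * (tilt z * x - \<Lambda> (tilt z)) + t * (tilt z * y - \<Lambda> (tilt z)) < (1 - t) * rate x + t * rate y"
    using t by (intro add_strict_mono mult_strict_left_mono) auto
  also have "(1 - t) * (tilt z * x - \<Lambda> (tilt z)) + t * (tilt z * y - \<Lambda> (tilt z)) = rate z"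
    by (simp add: rate_def z_def algebra_simps)
  finally show "rate ((1 - t) * x + t * y) < (1 - t) * rate x + t * rate y" by (simp add: z_def)
qed

lemma rate_continuous: "continuous_on rate_domain rate"
proof (rule convex_on_continuous)
  show "open rate_domain" by (simp add: rate_domain_def)
  show "convex_on rate_domain rate"
  proof (rule convex_onI)
    show "convex rate_domain" by (simp add: rate_domain_def)
    fix t x y :: real assume t: "0 < t" "t < 1" and xy: "x \<in> rate_domain" "y \<in> rate_domain"
    show "rate ((1 - t) *\<^sub>R x + t *\<^sub>R y) \<le> (1 - t) * rate x + t * rate y"
    proof (cases "x = y")
      case True then show ?thesis by (simp add: algebra_simps)
    next
      case False
      then show ?thesis using rate_strictly_convex t xy unfolding strictly_convex_on_def by force
    qed
  qed
qed

end

text \<open>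
  Convergence of the scaled cumulant generating functions is only assumed for \<open>\<bar>\<theta>\<bar> < s\<close>, where \<open>s\<close> may be
  smaller than the radius \<open>r\<close> of the limit function: the same \<open>\<Lambda>\<close> serves for all initial measures.
\<close>

locale scaled_cumulants = pressure \<Lambda> \<Lambda>' r + prob_space M
  for \<Lambda> \<Lambda>' r and M :: "'a measure" +
  fixes S :: "nat \<Rightarrow> 'a \<Rightarrow> real" and s :: real
  assumes S_measurable [measurable]: "S n \<in> borel_measurable M"
    and S_bounded: "\<exists>c. \<forall>\<omega>\<in>space M. \<bar>S n \<omega>\<bar> \<le> c"
    and s: "0 < s" "s \<le> r"
    and limit: "\<bar>\<theta>\<bar> < s \<Longrightarrow> (\<lambda>n. ln (\<integral>\<omega>. exp (\<theta> * S n \<omega>) \<partial>M) / real n) \<longlonglongrightarrow> \<Lambda> \<theta>"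
begin

definition mgf :: "nat \<Rightarrow> real \<Rightarrow> real" where
  "mgf n \<theta> = (\<integral>\<omega>. exp (\<theta> * S n \<omega>) \<partial>M)"

lemma exp_integrable [simp]: "integrable M (\<lambda>\<omega>. exp (\<theta> * S n \<omega>))"
proof -
  obtain c where c: "\<forall>\<omega>\<in>space M. \<bar>S n \<omega>\<bar> \<le> c" using S_bounded ..
  show ?thesis
  proof (rule integrable_const_bound[of _ "exp (\<bar>\<theta>\<bar> * c)"])
    show "AE \<omega> in M. norm (exp (\<theta> * S n \<omega>)) \<le> exp (\<bar>\<theta>\<bar> * c)"
    proof (rule AE_I2)
      fix \<omega> assume "\<omega> \<in> space M"
      have "\<theta> * S n \<omega> \<le> \<bar>\<theta>\<bar> * \<bar>S n \<omega>\<bar>" by (metis abs_ge_self abs_mult)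
      also have "\<dots> \<le> \<bar>\<theta>\<bar> * c" using c \<open>\<omega> \<in> space M\<close> by (intro mult_left_mono) auto
      finally show "norm (exp (\<theta> * S n \<omega>)) \<le> exp (\<bar>\<theta>\<bar> * c)" by simp
    qed
  qed measurable
qed

lemma mgf_pos: "0 < mgf n \<theta>"
proof -
  obtain c where c: "\<forall>\<omega>\<in>space M. \<bar>S n \<omega>\<bar> \<le> c" using S_bounded ..
  have "0 < (\<integral>\<omega>. exp (- (\<bar>\<theta>\<bar> * c)) \<partial>M)" by (simp add: prob_space)
  also have "\<dots> \<le> mgf n \<theta>"
    unfolding mgf_def
  proof (rule integral_mono)
    fix \<omega> assume "\<omega> \<in> space M"
    have "- (\<theta> * S n \<omega>) \<le> \<bar>\<theta>\<bar> * \<bar>S n \<omega>\<bar>" by (metis abs_ge_minus_self abs_mult)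
    also have "\<dots> \<le> \<bar>\<theta>\<bar> * c" using c \<open>\<omega> \<in> space M\<close> by (intro mult_left_mono) auto
    finally show "exp (- (\<bar>\<theta>\<bar> * c)) \<le> exp (\<theta> * S n \<omega>)" by simp
  qed auto
  finally show ?thesis .
qed

definition tail :: "nat \<Rightarrow> real \<Rightarrow> real" where
  "tail n \<epsilon> = prob {\<omega> \<in> space M. S n \<omega> > real n * \<epsilon>}"

lemma tail_le: "0 \<le> \<theta> \<Longrightarrow> tail n \<epsilon> \<le> exp (- (\<theta> * (real n * \<epsilon>))) * mgf n \<theta>"
proof -
  assume \<theta>: "0 \<le> \<theta>"
  let ?A = "{\<omega> \<in> space M. S n \<omega> > real n * \<epsilon>}"
  have "tail n \<epsilon> = (\<integral>\<omega>. indicator ?A \<omega> \<partial>M)" by (simp add: tail_def)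
  also have "\<dots> \<le> (\<integral>\<omega>. exp (- (\<theta> * (real n * \<epsilon>))) * exp (\<theta> * S n \<omega>) \<partial>M)"
  proof (rule integral_mono)
    show "indicator ?A \<omega> \<le> exp (- (\<theta> * (real n * \<epsilon>))) * exp (\<theta> * S n \<omega>)" for \<omega>
      using mult_left_mono[of "real n * \<epsilon>" "S n \<omega>", OF _ \<theta>] by (simp add: indicator_def exp_add[symmetric])
  qed (auto simp: emeasure_eq_measure)
  finally show ?thesis by (simp add: mgf_def)
qed

text \<open>
  Change of measure in one inequality. According to whether \<open>S n\<close> lies below the window from \<open>n \<epsilon>\<close>
  to \<open>n \<epsilon>2\<close>, inside it or above it, \<open>exp (\<theta>1 S)\<close> is dominated by the first, second or third summand
  before integration; the second summand is where the tail probability enters.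
\<close>

lemma mgf_split:
  assumes "0 \<le> \<theta>" "\<theta> \<le> \<theta>1" "\<theta>1 \<le> \<theta>2"
  shows "mgf n \<theta>1 \<le> exp ((\<theta>1 - \<theta>) * (real n * \<epsilon>)) * mgf n \<theta> + exp (\<theta>1 * (real n * \<epsilon>2)) * tail n \<epsilon>
    + exp (- ((\<theta>2 - \<theta>1) * (real n * \<epsilon>2))) * mgf n \<theta>2"
proof -
  let ?A = "{\<omega> \<in> space M. S n \<omega> > real n * \<epsilon>}"
  have [measurable]: "?A \<in> sets M" by measurable
  let ?g = "\<lambda>\<omega>. exp ((\<theta>1 - \<theta>) * (real n * \<epsilon>)) * exp (\<theta> * S n \<omega>) + exp (\<theta>1 * (real n * \<epsilon>2)) * indicator ?A \<omega>
    + exp (- ((\<theta>2 - \<theta>1) * (real n * \<epsilon>2))) * exp (\<theta>2 * S n \<omega>)"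
  have "mgf n \<theta>1 \<le> (\<integral>\<omega>. ?g \<omega> \<partial>M)"
    unfolding mgf_def
  proof (rule integral_mono)
    fix \<omega> assume \<omega>: "\<omega> \<in> space M"
    let ?s = "S n \<omega>"
    consider "?s \<le> real n * \<epsilon>" | "?s > real n * \<epsilon>" "?s \<le> real n * \<epsilon>2" | "?s > real n * \<epsilon>2" by linarith
    then show "exp (\<theta>1 * ?s) \<le> ?g \<omega>"
    proof cases
      case 1
      have "exp (\<theta>1 * ?s) \<le> exp ((\<theta>1 - \<theta>) * (real n * \<epsilon>) + \<theta> * ?s)"
        using mult_left_mono[OF 1, of "\<theta>1 - \<theta>"] assms by (simp add: algebra_simps)
      also have "\<dots> \<le> ?g \<omega>" by (simp add: exp_add)
      finally show ?thesis .
    next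
      case 2
      have "exp (\<theta>1 * ?s) \<le> exp (\<theta>1 * (real n * \<epsilon>2))"
        using mult_left_mono[OF 2(2), of \<theta>1] assms by simp
      also have "\<dots> = exp (\<theta>1 * (real n * \<epsilon>2)) * indicator ?A \<omega>" using 2(1) \<omega> by simp
      also have "\<dots> \<le> ?g \<omega>" by simp
      finally show ?thesis .
    next
      case 3
      have "exp (\<theta>1 * ?s) \<le> exp (- ((\<theta>2 - \<theta>1) * (real n * \<epsilon>2)) + \<theta>2 * ?s)"
        using mult_left_mono[OF less_imp_le[OF 3], of "\<theta>2 - \<theta>1"] assms by (simp add: algebra_simps)
      also have "\<dots> = exp (- ((\<theta>2 - \<theta>1) * (real n * \<epsilon>2))) * exp (\<theta>2 * ?s)" by (rule exp_add)
      also have "\<dots> \<le> ?g \<omega>" by simp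
      finally show ?thesis .
    qed
  qed (auto simp: emeasure_eq_measure)
  also have "\<dots> = exp ((\<theta>1 - \<theta>) * (real n * \<epsilon>)) * mgf n \<theta> + exp (\<theta>1 * (real n * \<epsilon>2)) * tail n \<epsilon>
    + exp (- ((\<theta>2 - \<theta>1) * (real n * \<epsilon>2))) * mgf n \<theta>2"
    by (simp add: mgf_def tail_def emeasure_eq_measure)
  finally show ?thesis .
qed

lemma exponentially_small:
  assumes "f \<longlonglongrightarrow> l" "l < 0"
  shows "\<forall>\<^sub>F n in sequentially. exp (real n * f n) < 1 / 4"
proof -
  have "\<forall>\<^sub>F n in sequentially. f n < l / 2" using assms by (intro order_tendstoD) auto
  moreover have "\<forall>\<^sub>F n in sequentially. real n * (l / 2) < - ln 4"
  proof -
    have "\<forall>\<^sub>F n in sequentially. ln 4 / (- (l / 2)) < real n"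
      using filterlim_real_sequentially by (simp add: filterlim_at_top_dense)
    then show ?thesis by eventually_elim (use assms(2) in \<open>simp add: field_simps\<close>)
  qed
  ultimately show ?thesis
    using eventually_gt_at_top[of 0]
  proof eventually_elim
    case (elim n)
    have "real n * f n \<le> real n * (l / 2)" using elim by (intro mult_left_mono) auto
    then have "real n * f n < - ln 4" using elim(2) by linarith
    then have "exp (real n * f n) < exp (- ln 4)" by simp
    then show ?case by (simp add: exp_minus)
  qed
qed

text \<open>
  With \<open>\<epsilon> = \<Lambda>' \<theta>\<close> and \<open>\<epsilon>2 = \<Lambda>' \<theta>2\<close>, the strict tangent inequalities at \<open>\<theta>\<close> and at \<open>\<theta>2\<close> say that under the
  measure tilted by \<open>\<theta>1\<close> the complement of the window is exponentially unlikely. So the outer two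
  summands of \<open>mgf_split\<close> are eventually at most a quarter of \<open>mgf n \<theta>1\<close> each. The conclusion includes
  positivity of the tail, because \<open>ln 0 = 0\<close> would spoil the upper bound.
\<close>

lemma lower_bound:
  assumes "0 < \<theta>" "\<theta> < \<theta>1" "\<theta>1 < \<theta>2" "\<theta>2 < s"
  shows "\<forall>\<^sub>F n in sequentially. 0 < tail n (\<Lambda>' \<theta>) \<and>
    ln (mgf n \<theta>1) / real n - ln 2 / real n - \<theta>1 * \<Lambda>' \<theta>2 \<le> ln (tail n (\<Lambda>' \<theta>)) / real n"
proof -
  define \<epsilon> where "\<epsilon> = \<Lambda>' \<theta>"
  define \<epsilon>2 where "\<epsilon>2 = \<Lambda>' \<theta>2"
  define A where "A = (\<lambda>n. (\<theta>1 - \<theta>) * \<epsilon> + ln (mgf n \<theta>) / real n - ln (mgf n \<theta>1) / real n)"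
  define C where "C = (\<lambda>n. - ((\<theta>2 - \<theta>1) * \<epsilon>2) + ln (mgf n \<theta>2) / real n - ln (mgf n \<theta>1) / real n)"
  have lim: "(\<lambda>n. ln (mgf n \<theta>') / real n) \<longlonglongrightarrow> \<Lambda> \<theta>'" if "\<theta>' \<in> {\<theta>, \<theta>1, \<theta>2}" for \<theta>'
    using limit[of \<theta>'] that assms by (auto simp: mgf_def)
  have "A \<longlonglongrightarrow> (\<theta>1 - \<theta>) * \<epsilon> + \<Lambda> \<theta> - \<Lambda> \<theta>1" unfolding A_def by (intro tendsto_intros lim) auto
  moreover have "(\<theta>1 - \<theta>) * \<epsilon> + \<Lambda> \<theta> - \<Lambda> \<theta>1 < 0"
    using above_tangent[of \<theta> \<theta>1] assms s by (simp add: \<epsilon>_def)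
  ultimately have A: "\<forall>\<^sub>F n in sequentially. exp (real n * A n) < 1 / 4" by (rule exponentially_small)
  have "C \<longlonglongrightarrow> - ((\<theta>2 - \<theta>1) * \<epsilon>2) + \<Lambda> \<theta>2 - \<Lambda> \<theta>1" unfolding C_def by (intro tendsto_intros lim) auto
  moreover have "- ((\<theta>2 - \<theta>1) * \<epsilon>2) + \<Lambda> \<theta>2 - \<Lambda> \<theta>1 < 0"
    using above_tangent[of \<theta>2 \<theta>1] assms s by (simp add: \<epsilon>2_def algebra_simps)
  ultimately have C: "\<forall>\<^sub>F n in sequentially. exp (real n * C n) < 1 / 4" by (rule exponentially_small)
  show ?thesis
    using A C eventually_gt_at_top[of 0]
  proof eventually_elim
    case (elim n)
    let ?W = "mgf n \<theta>1"
    have W: "0 < ?W" by (rule mgf_pos)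
    have W_exp: "mgf n \<theta>' = exp (ln (mgf n \<theta>'))" for \<theta>' using mgf_pos[of n \<theta>'] by simp
    have a: "exp ((\<theta>1 - \<theta>) * (real n * \<epsilon>)) * mgf n \<theta> = exp (real n * A n) * ?W"
      using elim by (subst (1 2) W_exp) (simp add: exp_add[symmetric] A_def field_simps)
    have c: "exp (- ((\<theta>2 - \<theta>1) * (real n * \<epsilon>2))) * mgf n \<theta>2 = exp (real n * C n) * ?W"
      using elim by (subst (1 2) W_exp) (simp add: exp_add[symmetric] C_def field_simps)
    have "?W \<le> exp (real n * A n) * ?W + exp (\<theta>1 * (real n * \<epsilon>2)) * tail n \<epsilon> + exp (real n * C n) * ?W"
      using mgf_split[of \<theta> \<theta>1 \<theta>2 n \<epsilon> \<epsilon>2] assms by (simp add: a c)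
    moreover have "exp (real n * A n) * ?W \<le> 1 / 4 * ?W" "exp (real n * C n) * ?W \<le> 1 / 4 * ?W"
      using elim W by (auto intro!: mult_right_mono)
    ultimately have "?W / 2 \<le> exp (\<theta>1 * (real n * \<epsilon>2)) * tail n \<epsilon>" by linarith
    then have "exp (- (\<theta>1 * (real n * \<epsilon>2))) * (?W / 2) \<le> exp (- (\<theta>1 * (real n * \<epsilon>2))) * (exp (\<theta>1 * (real n * \<epsilon>2)) * tail n \<epsilon>)"
      by (intro mult_left_mono) auto
    also have "\<dots> = tail n \<epsilon>" by (simp add: mult.assoc[symmetric] exp_add[symmetric])
    finally have low: "exp (- (\<theta>1 * (real n * \<epsilon>2))) * (?W / 2) \<le> tail n \<epsilon>" .
    have pos: "0 < exp (- (\<theta>1 * (real n * \<epsilon>2))) * (?W / 2)" using W by simp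
    have "- (\<theta>1 * (real n * \<epsilon>2)) + (ln ?W - ln 2) = ln (exp (- (\<theta>1 * (real n * \<epsilon>2))) * (?W / 2))"
      using W by (simp add: ln_mult ln_div)
    also have "\<dots> \<le> ln (tail n \<epsilon>)" using low pos by (intro ln_mono) auto
    finally have "(- (\<theta>1 * (real n * \<epsilon>2)) + (ln ?W - ln 2)) / real n \<le> ln (tail n \<epsilon>) / real n"
      by (rule divide_right_mono) simp
    moreover have "(- (\<theta>1 * (real n * \<epsilon>2)) + (ln ?W - ln 2)) / real n = ln ?W / real n - ln 2 / real n - \<theta>1 * \<epsilon>2"
      using elim by (simp add: field_simps)
    ultimately show ?case using low pos by (simp add: \<epsilon>_def \<epsilon>2_def)
  qed
qed

text \<open>
  The exponential Chebyshev inequality at \<open>\<theta>\<close> is the upper bound. For the lower bound, the estimate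
  above holds for all \<open>\<theta> < \<theta>1 < \<theta>2\<close> and becomes sharp as \<open>\<theta>2\<close> decreases to \<open>\<theta>\<close>, by continuity of \<open>\<Lambda>\<close> and \<open>\<Lambda>'\<close>;
  \<open>\<theta>1\<close> is taken to be the midpoint.
\<close>

theorem large_deviations:
  assumes \<theta>: "0 < \<theta>" "\<theta> < s"
  shows "(\<lambda>n. ln (tail n (\<Lambda>' \<theta>)) / real n) \<longlonglongrightarrow> - (\<theta> * \<Lambda>' \<theta> - \<Lambda> \<theta>)"
proof (rule order_tendstoI)
  fix y assume "y < - (\<theta> * \<Lambda>' \<theta> - \<Lambda> \<theta>)"
  have \<theta>r: "\<theta> \<in> {-r<..<r}" using \<theta> s by auto
  have "isCont \<Lambda> \<theta>" using \<theta>r by (intro DERIV_isCont[OF deriv]) auto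
  then have c\<Lambda>: "(\<Lambda> \<longlongrightarrow> \<Lambda> \<theta>) (at_right \<theta>)"
    unfolding isCont_def by (rule tendsto_mono[OF at_le[OF subset_UNIV]])
  have "isCont \<Lambda>' \<theta>" using deriv_cont \<theta>r by (simp add: continuous_on_eq_continuous_at)
  then have c\<Lambda>': "(\<Lambda>' \<longlongrightarrow> \<Lambda>' \<theta>) (at_right \<theta>)"
    unfolding isCont_def by (rule tendsto_mono[OF at_le[OF subset_UNIV]])
  have half: "filterlim (\<lambda>\<theta>2. (\<theta> + \<theta>2) / 2) (at_right \<theta>) (at_right \<theta>)"
  proof (rule filterlim_at_withinI)
    show "((\<lambda>\<theta>2. (\<theta> + \<theta>2) / 2) \<longlongrightarrow> \<theta>) (at_right \<theta>)" by (auto intro!: tendsto_eq_intros)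
    show "\<forall>\<^sub>F \<theta>2 in at_right \<theta>. (\<theta> + \<theta>2) / 2 \<in> {\<theta><..} - {\<theta>}"
      by (auto simp: eventually_at_right_field intro!: exI[of _ "\<theta> + 1"])
  qed
  have "((\<lambda>\<theta>2. \<Lambda> ((\<theta> + \<theta>2) / 2) - (\<theta> + \<theta>2) / 2 * \<Lambda>' \<theta>2) \<longlongrightarrow> \<Lambda> \<theta> - (\<theta> + \<theta>) / 2 * \<Lambda>' \<theta>) (at_right \<theta>)"
    by (intro tendsto_intros filterlim_compose[OF c\<Lambda> half] c\<Lambda>') auto
  then have "\<forall>\<^sub>F \<theta>2 in at_right \<theta>. y < \<Lambda> ((\<theta> + \<theta>2) / 2) - (\<theta> + \<theta>2) / 2 * \<Lambda>' \<theta>2"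
    by (rule order_tendstoD) (use \<open>y < _\<close> in simp)
  moreover have "\<forall>\<^sub>F \<theta>2 in at_right \<theta>. \<theta> < \<theta>2 \<and> \<theta>2 < s"
    using \<theta> by (auto simp: eventually_at_right_field)
  ultimately have "\<forall>\<^sub>F \<theta>2 in at_right \<theta>. y < \<Lambda> ((\<theta> + \<theta>2) / 2) - (\<theta> + \<theta>2) / 2 * \<Lambda>' \<theta>2 \<and> \<theta> < \<theta>2 \<and> \<theta>2 < s"
    by eventually_elim simp
  then obtain \<theta>2 where \<theta>2: "y < \<Lambda> ((\<theta> + \<theta>2) / 2) - (\<theta> + \<theta>2) / 2 * \<Lambda>' \<theta>2" "\<theta> < \<theta>2" "\<theta>2 < s"
    using eventually_happens[of _ "at_right \<theta>"] by auto
  define \<theta>1 where "\<theta>1 = (\<theta> + \<theta>2) / 2"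
  have \<theta>1: "\<theta> < \<theta>1" "\<theta>1 < \<theta>2" using \<theta>2 by (auto simp: \<theta>1_def)
  have "(\<lambda>n. ln (mgf n \<theta>1) / real n - ln 2 / real n - \<theta>1 * \<Lambda>' \<theta>2) \<longlonglongrightarrow> \<Lambda> \<theta>1 - 0 - \<theta>1 * \<Lambda>' \<theta>2"
    using limit[of \<theta>1] \<theta> \<theta>1 \<theta>2 by (intro tendsto_intros lim_const_over_n) (auto simp: mgf_def)
  then have "\<forall>\<^sub>F n in sequentially. y < ln (mgf n \<theta>1) / real n - ln 2 / real n - \<theta>1 * \<Lambda>' \<theta>2"
    by (rule order_tendstoD) (use \<theta>2 in \<open>simp add: \<theta>1_def\<close>)
  then show "\<forall>\<^sub>F n in sequentially. y < ln (tail n (\<Lambda>' \<theta>)) / real n"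
    using lower_bound[OF \<theta>(1) \<theta>1 \<theta>2(3)] by eventually_elim simp
next
  fix y assume y: "- (\<theta> * \<Lambda>' \<theta> - \<Lambda> \<theta>) < y"
  have "(\<lambda>n. ln (mgf n \<theta>) / real n - \<theta> * \<Lambda>' \<theta>) \<longlonglongrightarrow> \<Lambda> \<theta> - \<theta> * \<Lambda>' \<theta>"
    using limit[of \<theta>] \<theta> by (intro tendsto_intros) (auto simp: mgf_def)
  then have "\<forall>\<^sub>F n in sequentially. ln (mgf n \<theta>) / real n - \<theta> * \<Lambda>' \<theta> < y"
    by (rule order_tendstoD) (use y in simp)
  moreover have "\<forall>\<^sub>F n in sequentially. 0 < tail n (\<Lambda>' \<theta>)"
    using lower_bound[of \<theta> "\<theta> + (s - \<theta>) / 3" "\<theta> + 2 * (s - \<theta>) / 3"] \<theta>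
    by (auto simp: field_simps elim: eventually_mono)
  ultimately show "\<forall>\<^sub>F n in sequentially. ln (tail n (\<Lambda>' \<theta>)) / real n < y"
    using eventually_gt_at_top[of 0]
  proof eventually_elim
    case (elim n)
    have "ln (tail n (\<Lambda>' \<theta>)) \<le> ln (exp (- (\<theta> * (real n * \<Lambda>' \<theta>))) * mgf n \<theta>)"
      using tail_le[of \<theta> n "\<Lambda>' \<theta>"] elim \<theta> by (intro ln_mono) auto
    also have "\<dots> = - (\<theta> * (real n * \<Lambda>' \<theta>)) + ln (mgf n \<theta>)"
      using mgf_pos[of n \<theta>] by (simp add: ln_mult)
    finally have "ln (tail n (\<Lambda>' \<theta>)) / real n \<le> (- (\<theta> * (real n * \<Lambda>' \<theta>)) + ln (mgf n \<theta>)) / real n"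
      by (rule divide_right_mono) simp
    also have "\<dots> = ln (mgf n \<theta>) / real n - \<theta> * \<Lambda>' \<theta>"
      using elim by (simp add: field_simps)
    finally have "ln (tail n (\<Lambda>' \<theta>)) / real n \<le> ln (mgf n \<theta>) / real n - \<theta> * \<Lambda>' \<theta>" .
    then show ?case using elim by linarith
  qed
qed

end

section \<open>Entire moment generating functions and geometric limits\<close>

text \<open>
  Integrating the exponential series term by term exhibits the moment generating function as an
  everywhere convergent power series, with the moments divided by factorials as coefficients.
\<close>

lemma (in prob_space) moment_generating_function_derivatives:
  fixes X :: "'a \<Rightarrow> real"
  assumes [measurable]: "X \<in> borel_measurable M" and c: "\<And>\<omega>. \<omega> \<in> space M \<Longrightarrow> \<bar>X \<omega>\<bar> \<le> c"
  defines "F \<equiv> \<lambda>z. \<integral>\<omega>. exp (z * complex_of_real (X \<omega>)) \<partial>M"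
  shows "F holomorphic_on UNIV" "deriv F 0 = of_real (expectation X)"
    "deriv (deriv F) 0 = of_real (expectation (\<lambda>\<omega>. (X \<omega>)\<^sup>2))"
proof -
  define a where "a = (\<lambda>k. complex_of_real (expectation (\<lambda>\<omega>. X \<omega> ^ k)) / fact k)"
  have int: "integrable M (\<lambda>\<omega>. X \<omega> ^ k)" for k
    using c by (intro integrable_const_bound[of _ "c ^ k"] AE_I2) (simp_all add: power_abs power_mono)
  have sums: "(\<lambda>k. a k * z ^ k) sums F z" for z
  proof -
    let ?f = "\<lambda>k \<omega>. (z * complex_of_real (X \<omega>)) ^ k /\<^sub>R fact k"
    have f_eq: "?f k \<omega> = (z ^ k / fact k) * complex_of_real (X \<omega> ^ k)" for k \<omega>
      by (simp add: scaleR_conv_of_real power_mult_distrib field_simps)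
    have "(\<lambda>k. integral\<^sup>L M (?f k)) sums (\<integral>\<omega>. (\<Sum>k. ?f k \<omega>) \<partial>M)"
    proof (rule sums_integral)
      show intf: "integrable M (?f k)" for k
        unfolding f_eq by (intro integrable_mult_right integrable_of_real int)
      show "AE \<omega> in M. summable (\<lambda>k. norm (?f k \<omega>))" by (intro AE_I2 summable_norm_exp)
      show "summable (\<lambda>k. \<integral>\<omega>. norm (?f k \<omega>) \<partial>M)"
      proof (rule summable_comparison_test'[OF summable_exp_generic[of "cmod z * c"]])
        fix k :: nat
        have "norm (?f k \<omega>) \<le> (cmod z * c) ^ k /\<^sub>R fact k" if "\<omega> \<in> space M" for \<omega>
        proof -
          have "norm (?f k \<omega>) = (cmod z * \<bar>X \<omega>\<bar>) ^ k /\<^sub>R fact k" by (simp add: norm_power norm_mult)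
          also have "\<dots> \<le> (cmod z * c) ^ k /\<^sub>R fact k"
            by (intro scaleR_left_mono power_mono mult_left_mono c that) auto
          finally show ?thesis .
        qed
        then have "(\<integral>\<omega>. norm (?f k \<omega>) \<partial>M) \<le> (\<integral>\<omega>. (cmod z * c) ^ k /\<^sub>R fact k \<partial>M)"
          using intf[of k] by (intro integral_mono integrable_norm) auto
        then show "norm (\<integral>\<omega>. norm (?f k \<omega>) \<partial>M) \<le> (cmod z * c) ^ k /\<^sub>R fact k"
          by (simp add: prob_space)
      qed
    qed
    moreover have "integral\<^sup>L M (?f k) = a k * z ^ k" for k
      unfolding f_eq by (simp add: a_def del: of_real_power)
    moreover have "(\<integral>\<omega>. (\<Sum>k. ?f k \<omega>) \<partial>M) = F z"
      unfolding F_def by (simp add: exp_def)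
    ultimately show ?thesis by simp
  qed
  have F_eq: "F = (\<lambda>z. \<Sum>k. a k * z ^ k)" using sums by (auto simp: sums_iff)
  have sm: "summable (\<lambda>k. a k * z ^ k)" for z using sums by (rule sums_summable)
  have sm1: "summable (\<lambda>k. diffs a k * z ^ k)" for z by (rule termdiff_converges_all[OF sm])
  have d1: "(F has_field_derivative (\<Sum>k. diffs a k * z ^ k)) (at z)" for z
    unfolding F_eq by (rule termdiffs_strong_converges_everywhere[OF sm])
  have d2: "((\<lambda>z. \<Sum>k. diffs a k * z ^ k) has_field_derivative (\<Sum>k. diffs (diffs a) k * z ^ k)) (at z)" for z
    by (rule termdiffs_strong_converges_everywhere[OF sm1])
  show "F holomorphic_on UNIV" using d1 by (auto simp: holomorphic_on_open)
  have D: "deriv F = (\<lambda>z. \<Sum>k. diffs a k * z ^ k)" using DERIV_imp_deriv[OF d1] by auto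
  show "deriv F 0 = of_real (expectation X)" unfolding D powser_zero by (simp add: diffs_def a_def)
  show "deriv (deriv F) 0 = of_real (expectation (\<lambda>\<omega>. (X \<omega>)\<^sup>2))"
    unfolding D DERIV_imp_deriv[OF d2] powser_zero
    by (simp add: diffs_def a_def numeral_2_eq_2)
qed

lemma geometrically_Cauchy:
  fixes g :: "nat \<Rightarrow> 'b::banach"
  assumes "0 < t" "t < 1" and step: "\<And>n. norm (g (Suc n) - g n) \<le> K * t ^ n"
  shows "\<exists>l. \<forall>n. norm (g n - l) \<le> K / (1 - t) * t ^ n"
proof -
  have sg: "(\<lambda>k. K * t ^ (n + k)) sums (K / (1 - t) * t ^ n)" for n
  proof -
    have eq: "K / (1 - t) * t ^ n = K * t ^ n * (1 / (1 - t))" by simp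
    show ?thesis
      unfolding power_add mult.assoc[symmetric] eq using assms by (intro sums_mult geometric_sums) auto
  qed
  have sm: "summable (\<lambda>k. g (Suc (n + k)) - g (n + k))" for n
    by (rule summable_comparison_test'[OF sums_summable[OF sg[of n]], of 0]) (rule step)
  have "summable (\<lambda>k. g (Suc k) - g k)" using sm[of 0] by simp
  then have "convergent (\<lambda>n. \<Sum>k<n. g (Suc k) - g k)" by (simp add: summable_iff_convergent)
  then have "convergent (\<lambda>n. g n - g 0)" by (simp add: sum_lessThan_telescope)
  then have "convergent g" by (simp add: convergent_diff_const_right_iff)
  then obtain l where l: "g \<longlonglongrightarrow> l" by (auto simp: convergent_def)
  have "norm (g n - l) \<le> K / (1 - t) * t ^ n" for n
  proof -
    have "(\<lambda>k. g (n + k)) \<longlonglongrightarrow> l" using LIMSEQ_ignore_initial_segment[OF l, of n] by (simp add: add.commute)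
    then have "(\<lambda>k. g (n + Suc k) - g (n + k)) sums (l - g (n + 0))" by (rule telescope_sums)
    then have eq: "(\<Sum>k. g (Suc (n + k)) - g (n + k)) = l - g n" by (simp add: sums_iff)
    have "norm (l - g n) \<le> (\<Sum>k. K * t ^ (n + k))"
      unfolding eq[symmetric] by (rule norm_suminf_le[OF step sums_summable[OF sg]])
    then show ?thesis using sg[of n] by (simp add: sums_iff norm_minus_commute)
  qed
  then show ?thesis by blast
qed

text \<open>
  The errors have a bounded sum, so the averages converge at rate \<open>1/n\<close> with a constant depending only
  on \<open>K\<close> and \<open>t\<close>. This is what makes convergence uniform in a parameter.
\<close>

lemma average_of_geometric_limit:
  fixes g :: "nat \<Rightarrow> 'b::real_normed_field"
  assumes "0 < t" "t < 1" "0 \<le> K" and g: "\<And>n. norm (g n - l) \<le> K * t ^ n" and n: "0 < n"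
  shows "norm ((\<Sum>k<n. g k) / of_nat n - l) \<le> K / (1 - t) / real n"
proof -
  have "(\<Sum>k<n. g k) / of_nat n - l = (\<Sum>k<n. g k - l) / of_nat n"
    using n by (simp add: sum_subtractf diff_divide_distrib)
  moreover have "norm (\<Sum>k<n. g k - l) \<le> K / (1 - t)"
  proof -
    have "norm (\<Sum>k<n. g k - l) \<le> (\<Sum>k<n. K * t ^ k)" by (intro sum_norm_le g)
    also have "\<dots> \<le> (\<Sum>k. K * t ^ k)"
      using assms by (intro sum_le_suminf summable_mult summable_geometric) auto
    also have "\<dots> = K / (1 - t)" using sums_mult[OF geometric_sums[of t], of K] assms by (simp add: sums_iff)
    finally show ?thesis .
  qed
  ultimately show ?thesis by (simp only: norm_divide norm_of_nat) (rule divide_right_mono, simp_all)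
qed

lemma Ln_lipschitz:
  assumes u: "cmod (u - 1) \<le> 1 / 2" and v: "cmod (v - 1) \<le> 1 / 2"
  shows "cmod (Ln u - Ln v) \<le> 2 * cmod (u - v)"
proof (rule field_differentiable_bound[of "cball 1 (1/2)" Ln inverse 2 u v])
  fix z :: complex assume "z \<in> cball 1 (1 / 2)"
  then have z: "cmod (z - 1) \<le> 1 / 2" by (simp add: dist_norm norm_minus_commute)
  have "Re (z - 1) \<ge> - (1 / 2)" using abs_Re_le_cmod[of "z - 1"] z by linarith
  then have re: "1 / 2 \<le> Re z" by simp
  then have "z \<notin> \<real>\<^sub>\<le>\<^sub>0" by (simp add: complex_nonpos_Reals_iff)
  then show "(Ln has_field_derivative inverse z) (at z within cball 1 (1 / 2))"
    by (rule has_field_derivative_at_within[OF has_field_derivative_Ln])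
  have "1 / 2 \<le> cmod z" using re complex_Re_le_cmod[of z] by linarith
  then have "inverse (cmod z) \<le> inverse (1 / 2)" by (intro le_imp_inverse_le) auto
  then show "cmod (inverse z) \<le> 2" by (simp add: norm_inverse)
qed (use u v in \<open>simp_all add: dist_norm norm_minus_commute[of 1]\<close>)

lemma has_real_derivative_Re_on_reals:
  assumes "(f has_field_derivative d) (at (complex_of_real x))"
  shows "((\<lambda>x. Re (f (complex_of_real x))) has_real_derivative Re d) (at x)"
  using bounded_linear.has_vector_derivative[OF bounded_linear_Re has_vector_derivative_real_field[OF assms]]
  by (simp add: has_real_derivative_iff_has_vector_derivative)

context observable_system
begin

section \<open>Analyticity of the pressure\<close>

definition moment :: "('x \<Rightarrow> complex) \<Rightarrow> nat \<Rightarrow> complex \<Rightarrow> complex" where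
  "moment f n z = (\<integral>x. (twisted \<phi> z ^^ n) f x \<partial>m)"

definition moment_ratio :: "('x \<Rightarrow> complex) \<Rightarrow> nat \<Rightarrow> complex \<Rightarrow> complex" where
  "moment_ratio f n z = moment f (Suc n) z / moment f n z"

lemma controlled_moments:
  assumes "controlled_growth (integral\<^sup>L m) (twisted \<phi> z) t f g"
  shows "moment f n z \<noteq> 0 \<and> cmod (moment_ratio f n z - 1) \<le> 1 / 2 \<and>
    cmod (moment_ratio f (Suc n) z - moment_ratio f n z) \<le> t ^ n \<and>
    cmod (moment_ratio f n z - moment_ratio g n z) \<le> t ^ n"
  using assms unfolding controlled_growth_def growth_def moment_def moment_ratio_def by (rule spec)

lemma birkhoff_sum_rv:
  fixes k :: "'x \<Rightarrow> real"
  defines "N \<equiv> law k"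
  shows "birkhoff_sum T \<phi> n \<in> borel_measurable N"
    and "p \<in> space N \<Longrightarrow> \<bar>birkhoff_sum T \<phi> n p\<bar> \<le> real n * b"
proof -
  have [measurable]: "fst \<in> N \<rightarrow>\<^sub>M noise \<Omega>" "snd \<in> N \<rightarrow>\<^sub>M m"
    unfolding N_def by (auto simp: measurable_snd')
  have "(\<lambda>p. birkhoff_sum T \<phi> n (fst p, snd p)) \<in> borel_measurable N" by measurable
  then show "birkhoff_sum T \<phi> n \<in> borel_measurable N" by simp
  show "\<bar>birkhoff_sum T \<phi> n p\<bar> \<le> real n * b" if "p \<in> space N"
    using that birkhoff_sum_bound[where \<phi>=\<phi> and b=b and w="fst p" and x="snd p" and n=n, OF phi_bound] by (auto simp: N_def space_pair_measure)
qed

lemma moment_expectation: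
  assumes k: "B_density k"
  shows "moment (\<lambda>x. complex_of_real (k x)) n z = (\<integral>p. exp (z * of_real (birkhoff_sum T \<phi> n p)) \<partial>law k)"
  using twisted_moment[OF phi_measurable phi_bound B_densityD(4,1,3)[OF k] B_integrable[OF B_densityD(2)[OF k]],
      of "\<lambda>_. 1" 1 z n]
  by (simp add: moment_def)

lemma iterate_fixed: "AE x in m. (PP ^^ n) hc x = hc x"
proof -
  obtain C where C: "admissible PP C" using P_admissible ..
  have "cls (PP hc) = cls hc" using h_fixed by (subst cls_eq_iff) (auto simp: h_mem P_invariant)
  then have "(lift PP ^^ n) (cls hc) = cls hc" by (induction n) (auto simp: lift_cls[OF C h_mem])
  then have "cls ((PP ^^ n) hc) = cls hc" by (simp add: lift_funpow[OF C h_mem])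
  then show ?thesis using cls_eq_iff[OF funpow_mem_B[OF C h_mem] h_mem] by simp
qed

text \<open>
  Under the stationary initial law every orbit point has law \<open>\<mu>\<close>: at \<open>z = 0\<close> the twisted operator is the
  annealed operator, which fixes \<open>h\<close>.
\<close>

lemma birkhoff_sum_centred: "(\<integral>p. birkhoff_sum T \<phi> n p \<partial>law h) = 0"
proof -
  interpret N: prob_space "law h" by (rule law_prob[OF h_density])
  have [measurable]: "fst \<in> law h \<rightarrow>\<^sub>M noise \<Omega>" "snd \<in> law h \<rightarrow>\<^sub>M m" by (auto simp: measurable_snd')
  have tw0: "twisted \<phi> 0 = PP" by (rule ext) (simp add: twisted_def)
  have int: "integrable (law h) (\<lambda>p. \<phi> (orbit T (fst p) (snd p) k))" for k
    using phi_bound orbit_space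
    by (intro N.integrable_const_bound[of _ b] AE_I2) (auto simp: space_pair_measure)
  have "(\<integral>p. \<phi> (orbit T (fst p) (snd p) k) \<partial>law h) = 0" for k
  proof -
    have "complex_of_real (\<integral>p. \<phi> (orbit T (fst p) (snd p) k) \<partial>law h)
        = (\<integral>p. exp (0 * of_real (birkhoff_sum T \<phi> k p)) * of_real (\<phi> (orbit T (fst p) (snd p) k)) \<partial>law h)"
      by simp
    also have "\<dots> = (\<integral>x. (twisted \<phi> 0 ^^ k) hc x * of_real (\<phi> x) \<partial>m)"
      by (rule twisted_moment[OF phi_measurable phi_bound B_densityD(4,1,3)[OF h_density] B_integrable[OF h_mem]]) (use phi_bound in auto)
    also have "\<dots> = (\<integral>x. hc x * of_real (\<phi> x) \<partial>m)"
      unfolding tw0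
    proof (rule integral_cong_AE)
      obtain C where C: "admissible PP C" using P_admissible ..
      note [measurable] = B_measurable[OF funpow_mem_B[OF C h_mem]] B_measurable[OF h_mem]
      show "(\<lambda>x. (PP ^^ k) hc x * of_real (\<phi> x)) \<in> borel_measurable m" by measurable
      show "(\<lambda>x. hc x * of_real (\<phi> x)) \<in> borel_measurable m" by measurable
      show "AE x in m. (PP ^^ k) hc x * of_real (\<phi> x) = hc x * of_real (\<phi> x)"
        using iterate_fixed[of k] by eventually_elim simp
    qed
    finally show ?thesis using phi_centred by simp
  qed
  then show ?thesis using int by (simp add: birkhoff_sum_def split_beta')
qed

lemma moment_derivatives:
  shows moment_holomorphic: "moment hc n holomorphic_on UNIV"
    and moment_deriv: "deriv (moment hc n) 0 = 0"
    and moment_deriv2: "deriv (deriv (moment hc n)) 0 = of_real (\<integral>p. (birkhoff_sum T \<phi> n p)\<^sup>2 \<partial>law h)"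
proof -
  interpret N: prob_space "law h" by (rule law_prob[OF h_density])
  have eq: "moment hc n = (\<lambda>z. \<integral>p. exp (z * of_real (birkhoff_sum T \<phi> n p)) \<partial>law h)"
    by (rule ext) (rule moment_expectation[OF h_density])
  note D = N.moment_generating_function_derivatives[of "birkhoff_sum T \<phi> n" "real n * b", OF birkhoff_sum_rv]
  show "moment hc n holomorphic_on UNIV" unfolding eq by (rule D)
  show "deriv (moment hc n) 0 = 0" unfolding eq using D(2) by (simp add: birkhoff_sum_centred)
  show "deriv (deriv (moment hc n)) 0 = of_real (\<integral>p. (birkhoff_sum T \<phi> n p)\<^sup>2 \<partial>law h)" unfolding eq by (rule D)
qed

lemma moment_0: "(\<integral>x. f x \<partial>m) = 1 \<Longrightarrow> moment f 0 z = 1"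
  by (simp add: moment_def)

text \<open>
  The neighbourhood on which the limit exists may depend on the initial density.
\<close>

definition is_pressure :: "(complex \<Rightarrow> complex) \<Rightarrow> bool" where
  "is_pressure G \<longleftrightarrow> (\<forall>k. B_density k \<longrightarrow> (\<exists>s>0. \<forall>\<theta>. \<bar>\<theta>\<bar> < s \<longrightarrow>
     (\<lambda>n. ln (\<integral>p. exp (\<theta> * birkhoff_sum T \<phi> n p) \<partial>law k) / real n) \<longlonglongrightarrow> Re (G (complex_of_real \<theta>))))"

text \<open>
  The function \<open>G\<close> is the limit of the logarithms of the growth factors of the moments started from \<open>h\<close>.
  Their averages \<open>L n\<close> satisfy \<open>E exp (z S\<^sub>n) = exp (n L n z)\<close> and converge uniformly to \<open>G\<close>, so derivatives at
  0 converge: the first derivatives are 0 as \<open>S\<^sub>n\<close> is centred, and the second ones are \<open>E (S\<^sub>n\<^sup>2) / n\<close>. For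
  another density \<open>k\<close> the growth factors differ from those of \<open>h\<close> by at most \<open>t\<^sup>n\<close>, so the limit is the
  same.
\<close>

theorem analytic_pressure:
  "\<exists>G \<delta>. 0 < \<delta> \<and> G holomorphic_on ball 0 \<delta> \<and> G 0 = 0 \<and> deriv G 0 = 0 \<and>
    (\<lambda>n. complex_of_real ((\<integral>p. (birkhoff_sum T \<phi> n p)\<^sup>2 \<partial>law h) / real n)) \<longlonglongrightarrow> deriv (deriv G) 0 \<and>
    is_pressure G"
proof -
  obtain t where t: "0 < t" "t < 1" and main: "\<forall>R>0. \<exists>\<delta>>0. \<forall>z. cmod z < \<delta> \<longrightarrow>
      (\<forall>f\<in>unit_mass_ball R. \<forall>g\<in>unit_mass_ball R. controlled_growth (integral\<^sup>L m) (twisted \<phi> z) t f g)"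
    using twisted_controlled_growth by (elim exE conjE) (rule that)
  have nrm0: "nrm (\<lambda>x. hc x - hc x) = 0" using nrm_zero[OF B_zero] by simp
  have h_ball: "hc \<in> unit_mass_ball R" if "0 < R" for R
    using that nrm0 by (simp only: unit_mass_ball_def mem_Collect_eq h_mem h_mass) simp
  obtain \<delta> where \<delta>: "\<delta> > 0" and est0: "\<forall>z. cmod z < \<delta> \<longrightarrow>
      (\<forall>f\<in>unit_mass_ball 1. \<forall>g\<in>unit_mass_ball 1. controlled_growth (integral\<^sup>L m) (twisted \<phi> z) t f g)"
    using main[rule_format, OF zero_less_one] by (elim exE conjE) (rule that)
  have est: "moment hc n z \<noteq> 0 \<and> cmod (moment_ratio hc n z - 1) \<le> 1 / 2 \<and>
      cmod (moment_ratio hc (Suc n) z - moment_ratio hc n z) \<le> t ^ n \<and>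
      cmod (moment_ratio hc n z - moment_ratio hc n z) \<le> t ^ n" if "z \<in> ball 0 \<delta>" for z n
    by (rule controlled_moments, rule est0[rule_format, OF _ h_ball h_ball]) (use that in auto)
  define U where "U = ball (0::complex) \<delta>"
  have U: "open U" "0 \<in> U" using \<delta> by (auto simp: U_def)
  define g where "g = (\<lambda>n z. Ln (moment_ratio hc n z))"
  define K where "K = 2 / (1 - t)"
  have K: "0 \<le> K" using t by (simp add: K_def)
  have "\<exists>l. \<forall>n. cmod (g n z - l) \<le> K * t ^ n" if "z \<in> U" for z
    unfolding K_def
  proof (rule geometrically_Cauchy[OF t])
    fix n
    have "cmod (g (Suc n) z - g n z) \<le> 2 * cmod (moment_ratio hc (Suc n) z - moment_ratio hc n z)"
      unfolding g_def using est[of z] that by (intro Ln_lipschitz) (auto simp: U_def)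
    also have "\<dots> \<le> 2 * t ^ n" using est[of z n] that by (auto simp: U_def)
    finally show "cmod (g (Suc n) z - g n z) \<le> 2 * t ^ n" .
  qed
  then have "\<forall>z\<in>U. \<exists>l. \<forall>n. cmod (g n z - l) \<le> K * t ^ n" by simp
  from bchoice[OF this] obtain G where G0: "\<forall>z\<in>U. \<forall>n. cmod (g n z - G z) \<le> K * t ^ n" ..
  have G: "cmod (g n z - G z) \<le> K * t ^ n" if "z \<in> U" for z n using G0 that by simp
  define L where "L = (\<lambda>n z. (\<Sum>k<n. g k z) / of_nat n)"
  have L_close: "cmod (L n z - G z) \<le> K / (1 - t) / real n" if "z \<in> U" "0 < n" for z n
    unfolding L_def by (rule average_of_geometric_limit[OF t K G[OF that(1)] that(2)])
  have ulim: "uniform_limit U L G sequentially"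
  proof (rule uniform_limitI)
    fix e :: real assume "e > 0"
    have "(\<lambda>n. K / (1 - t) / real n) \<longlonglongrightarrow> 0" by (rule lim_const_over_n)
    then have "\<forall>\<^sub>F n in sequentially. K / (1 - t) / real n < e" using \<open>e > 0\<close> by (rule order_tendstoD)
    then show "\<forall>\<^sub>F n in sequentially. \<forall>z\<in>U. dist (L n z) (G z) < e"
      using eventually_gt_at_top[of 0]
    proof eventually_elim
      case (elim n)
      show ?case
      proof
        fix z assume "z \<in> U"
        from L_close[OF this elim(2)] elim(1) show "dist (L n z) (G z) < e" by (simp add: dist_norm)
      qed
    qed
  qed
  have ratio_nonpos: "moment_ratio hc n z \<notin> \<real>\<^sub>\<le>\<^sub>0" "moment_ratio hc n z \<noteq> 0" if "z \<in> U" for n z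
  proof -
    have "cmod (moment_ratio hc n z - 1) \<le> 1 / 2" using est that by (simp add: U_def)
    then have "Re (moment_ratio hc n z) > 0"
      using abs_Re_le_cmod[of "moment_ratio hc n z - 1"] by simp
    then show "moment_ratio hc n z \<notin> \<real>\<^sub>\<le>\<^sub>0" "moment_ratio hc n z \<noteq> 0"
      by (auto simp: complex_nonpos_Reals_iff)
  qed
  have holM: "moment hc n holomorphic_on U" for n
    by (rule holomorphic_on_subset[OF moment_holomorphic]) simp
  have holL: "L n holomorphic_on U" for n
  proof -
    have "moment_ratio hc k holomorphic_on U" for k
      unfolding moment_ratio_def using est by (intro holomorphic_on_divide holM) (simp add: U_def)
    then have "g k holomorphic_on U" for k
      unfolding g_def using ratio_nonpos by (intro holomorphic_on_Ln') auto
    then show ?thesis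
      unfolding L_def by (cases "n = 0") (auto intro!: holomorphic_on_divide holomorphic_on_sum)
  qed
  have holG: "G holomorphic_on U"
  proof (rule holomorphic_uniform_sequence[OF U(1) holL])
    fix z assume "z \<in> U"
    then obtain d where "d > 0" "cball z d \<subseteq> U" using U(1) open_contains_cball by blast
    then show "\<exists>d>0. cball z d \<subseteq> U \<and> uniform_limit (cball z d) L G sequentially"
      using uniform_limit_on_subset[OF ulim] by blast
  qed
  have momL: "moment hc n z = exp (of_nat n * L n z)" if "z \<in> U" "0 < n" for n z
  proof -
    have "moment hc n z = exp (\<Sum>k<n. g k z)" for n
    proof (induction n)
      case 0 show ?case using moment_0[OF h_mass] by simp
    next
      case (Suc n)
      have "exp (g n z) = moment_ratio hc n z" unfolding g_def by (rule exp_Ln[OF ratio_nonpos(2)[OF that(1)]])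
      then show ?case using Suc est[of z n] that by (simp add: exp_add moment_ratio_def U_def field_simps)
    qed
    then show ?thesis using that by (simp add: L_def)
  qed
  have L_derivs: "deriv (L n) 0 = 0 \<and>
      deriv (deriv (L n)) 0 = of_real ((\<integral>p. (birkhoff_sum T \<phi> n p)\<^sup>2 \<partial>law h) / real n)" if n: "0 < n" for n
  proof -
    have dL: "(L n has_field_derivative deriv (L n) z) (at z)" if "z \<in> U" for z
      using holL U(1) that by (rule holomorphic_derivI)
    have ddL: "(deriv (L n) has_field_derivative deriv (deriv (L n)) 0) (at 0)"
      using holomorphic_deriv[OF holL U(1)] U by (rule holomorphic_derivI)
    have dM: "(moment hc n has_field_derivative exp (of_nat n * L n z) * (of_nat n * deriv (L n) z)) (at z)" if "z \<in> U" for z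
    proof (rule has_field_derivative_transform_within_open[OF _ U(1) that])
      show "((\<lambda>z. exp (of_nat n * L n z)) has_field_derivative exp (of_nat n * L n z) * (of_nat n * deriv (L n) z)) (at z)"
        by (auto intro!: derivative_eq_intros dL[OF that])
    qed (use momL n in simp)
    have dM': "deriv (moment hc n) z = exp (of_nat n * L n z) * (of_nat n * deriv (L n) z)" if "z \<in> U" for z
      by (rule DERIV_imp_deriv[OF dM[OF that]])
    have M0: "exp (of_nat n * L n 0) = 1"
      using momL[OF U(2) n] moment_expectation[OF h_density, of n 0]
        prob_space.prob_space[OF law_prob[OF h_density]] by simp
    have L0: "deriv (L n) 0 = 0" using dM'[OF U(2)] moment_deriv[of n] M0 n by simp
    have "(deriv (moment hc n) has_field_derivative of_nat n * deriv (deriv (L n)) 0) (at 0)"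
    proof (rule has_field_derivative_transform_within_open[OF _ U])
      show "((\<lambda>z. exp (of_nat n * L n z) * (of_nat n * deriv (L n) z)) has_field_derivative of_nat n * deriv (deriv (L n)) 0) (at 0)"
        by (rule derivative_eq_intros dL[OF U(2)] ddL refl)+ (simp add: L0 M0)
    qed (simp add: dM')
    then have "deriv (deriv (moment hc n)) 0 = of_nat n * deriv (deriv (L n)) 0" by (rule DERIV_imp_deriv)
    then show ?thesis using L0 n by (simp add: moment_deriv2 field_simps)
  qed
  have lim1: "(\<lambda>n. (deriv ^^ j) (L n) 0) \<longlonglongrightarrow> (deriv ^^ j) G 0" for j
    by (rule higher_deriv_complex_uniform_limit[OF ulim _ _ U]) (auto simp: holL)
  have "(\<lambda>n. deriv (L n) 0) \<longlonglongrightarrow> deriv G 0" using lim1[of 1] by simp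
  moreover have "(\<lambda>n. deriv (L n) 0) \<longlonglongrightarrow> 0"
  proof (rule tendsto_eventually)
    show "\<forall>\<^sub>F n in sequentially. deriv (L n) 0 = 0"
      using eventually_gt_at_top[of 0] by (rule eventually_mono) (use L_derivs in simp)
  qed
  ultimately have G1: "deriv G 0 = 0" by (rule LIMSEQ_unique)
  have "(\<lambda>n. deriv (deriv (L n)) 0) \<longlonglongrightarrow> deriv (deriv G) 0" using lim1[of 2] by (simp add: numeral_2_eq_2)
  moreover have "\<forall>\<^sub>F n in sequentially. deriv (deriv (L n)) 0 = of_real ((\<integral>p. (birkhoff_sum T \<phi> n p)\<^sup>2 \<partial>law h) / real n)"
    using eventually_gt_at_top[of 0] by (rule eventually_mono) (use L_derivs in simp)
  ultimately have G2: "(\<lambda>n. complex_of_real ((\<integral>p. (birkhoff_sum T \<phi> n p)\<^sup>2 \<partial>law h) / real n)) \<longlonglongrightarrow> deriv (deriv G) 0"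
    by (rule Lim_transform_eventually)
  have G0: "G 0 = 0"
  proof -
    have "moment hc n 0 = 1" for n
      using moment_expectation[OF h_density, of n 0]
        prob_space.prob_space[OF law_prob[OF h_density]] by simp
    then have "g n 0 = 0" for n by (simp add: g_def moment_ratio_def)
    then have "cmod (G 0) \<le> K * t ^ n" for n using G[OF U(2), of n] by simp
    moreover have "(\<lambda>n. K * t ^ n) \<longlonglongrightarrow> 0" using t by (auto intro!: tendsto_eq_intros LIMSEQ_power_zero)
    ultimately have "cmod (G 0) \<le> 0" by (intro LIMSEQ_le_const[of _ 0]) auto
    then show ?thesis by simp
  qed
  have limits: "\<exists>s>0. \<forall>\<theta>. \<bar>\<theta>\<bar> < s \<longrightarrow> (\<lambda>n. ln (\<integral>p. exp (\<theta> * birkhoff_sum T \<phi> n p) \<partial>law k) / real n)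
      \<longlonglongrightarrow> Re (G (complex_of_real \<theta>))" if k: "B_density k" for k
  proof -
    interpret N: prob_space "law k" by (rule law_prob[OF k])
    let ?k = "\<lambda>x. complex_of_real (k x)"
    note k1 = density_mass[OF k]
    define R where "R = nrm (\<lambda>x. ?k x - hc x) + 1"
    have R: "R > 0" using nrm_nonneg[OF B_diff[OF B_densityD(2)[OF k] h_mem]] by (simp add: R_def)
    have k_ball: "?k \<in> unit_mass_ball R"
      using B_densityD(2)[OF k] k1 by (simp only: unit_mass_ball_def mem_Collect_eq) (simp add: R_def)
    obtain \<delta>' where \<delta>': "\<delta>' > 0" and est': "\<forall>z. cmod z < \<delta>' \<longrightarrow>
      (\<forall>f\<in>unit_mass_ball R. \<forall>g\<in>unit_mass_ball R. controlled_growth (integral\<^sup>L m) (twisted \<phi> z) t f g)"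
      using main[rule_format, OF R] by (elim exE conjE) (rule that)
    show ?thesis
    proof (rule exI[of _ "min \<delta> \<delta>'"], intro conjI allI impI)
      show "min \<delta> \<delta>' > 0" using \<delta> \<delta>' by simp
      fix \<theta> :: real assume \<theta>: "\<bar>\<theta>\<bar> < min \<delta> \<delta>'"
      let ?z = "complex_of_real \<theta>"
      have zU: "?z \<in> U" using \<theta> by (simp add: U_def)
      have e: "moment ?k n ?z \<noteq> 0 \<and> cmod (moment_ratio ?k n ?z - 1) \<le> 1 / 2 \<and>
          cmod (moment_ratio ?k (Suc n) ?z - moment_ratio ?k n ?z) \<le> t ^ n \<and>
          cmod (moment_ratio ?k n ?z - moment_ratio hc n ?z) \<le> t ^ n" for n
        by (rule controlled_moments, rule est'[rule_format, OF _ k_ball h_ball[OF R]]) (use \<theta> in simp)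
      define W where "W = (\<lambda>n. \<integral>p. exp (\<theta> * birkhoff_sum T \<phi> n p) \<partial>law k)"
      have mW: "moment ?k n ?z = of_real (W n)" for n
      proof -
        have "moment ?k n ?z = (\<integral>p. exp (?z * of_real (birkhoff_sum T \<phi> n p)) \<partial>law k)"
          by (rule moment_expectation[OF k])
        also have "\<dots> = (\<integral>p. complex_of_real (exp (\<theta> * birkhoff_sum T \<phi> n p)) \<partial>law k)"
          by (simp only: of_real_mult[symmetric] exp_of_real)
        also have "\<dots> = of_real (W n)" unfolding W_def by (rule integral_complex_of_real)
        finally show ?thesis .
      qed
      have W0: "W 0 = 1" using moment_0[OF k1, of ?z] by (simp add: mW)
      have W: "0 < W n" for n
      proof -
        have "0 \<le> W n" unfolding W_def by (intro Bochner_Integration.integral_nonneg) auto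
        moreover have "W n \<noteq> 0" using e[of n] by (simp add: mW)
        ultimately show ?thesis by simp
      qed
      have ratioW: "moment_ratio ?k n ?z = of_real (W (Suc n) / W n)" for n
        by (simp add: moment_ratio_def mW)
      have lnW: "norm (ln (W (Suc n) / W n) - Re (G ?z)) \<le> (2 + K) * t ^ n" for n
      proof -
        have "W (Suc n) / W n > 0" using W by simp
        then have "ln (W (Suc n) / W n) = Re (Ln (moment_ratio ?k n ?z))"
          unfolding ratioW by (simp only: Ln_of_real Re_complex_of_real)
        then have "norm (ln (W (Suc n) / W n) - Re (G ?z)) \<le> cmod (Ln (moment_ratio ?k n ?z) - G ?z)"
          using abs_Re_le_cmod[of "Ln (moment_ratio ?k n ?z) - G ?z"] by simp
        also have "\<dots> \<le> cmod (Ln (moment_ratio ?k n ?z) - g n ?z) + cmod (g n ?z - G ?z)"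
          using norm_triangle_ineq[of "Ln (moment_ratio ?k n ?z) - g n ?z" "g n ?z - G ?z"] by simp
        also have "cmod (Ln (moment_ratio ?k n ?z) - g n ?z) \<le> 2 * cmod (moment_ratio ?k n ?z - moment_ratio hc n ?z)"
          unfolding g_def using e[of n] est[of ?z n] zU by (intro Ln_lipschitz) (auto simp: U_def)
        also have "\<dots> \<le> 2 * t ^ n" using e[of n] by simp
        finally show ?thesis using G[OF zU, of n] by (simp add: algebra_simps)
      qed
      have sumW: "(\<Sum>i<n. ln (W (Suc i) / W i)) = ln (W n)" for n
      proof -
        have "W i \<noteq> 0" for i using W[of i] by simp
        then show ?thesis using W0 by (induction n) (simp_all add: ln_div)
      qed
      have avg: "norm (ln (W n) / real n - Re (G ?z)) \<le> (2 + K) / (1 - t) / real n" if "0 < n" for n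
        using average_of_geometric_limit[OF t _ lnW that] K by (simp add: sumW)
      have "(\<lambda>n. ln (W n) / real n - Re (G ?z)) \<longlonglongrightarrow> 0"
      proof (rule Lim_null_comparison)
        show "\<forall>\<^sub>F n in sequentially. norm (ln (W n) / real n - Re (G ?z)) \<le> (2 + K) / (1 - t) / real n"
          using eventually_gt_at_top[of 0] by (rule eventually_mono) (rule avg)
        show "(\<lambda>n. (2 + K) / (1 - t) / real n) \<longlonglongrightarrow> 0" by (rule lim_const_over_n)
      qed
      then show "(\<lambda>n. ln (\<integral>p. exp (\<theta> * birkhoff_sum T \<phi> n p) \<partial>law k) / real n) \<longlonglongrightarrow> Re (G ?z)"
        unfolding W_def by (rule LIM_zero_cancel)
    qed
  qed
  have "is_pressure G" using limits by (simp only: is_pressure_def) blast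
  with \<delta> holG G0 G1 G2 show ?thesis unfolding U_def by (intro exI conjI)
qed

end

section \<open>Large deviations for Birkhoff sums\<close>

context spectral_random_system
begin

lemma density_integral:
  assumes k: "\<And>x. x \<in> space m \<Longrightarrow> 0 \<le> k x" "k \<in> borel_measurable m" and A: "A \<in> sets m"
  shows "(\<integral>x. complex_of_real (k x) * indicator A x \<partial>m) = of_real (measure (density m (\<lambda>x. ennreal (k x))) A)"
proof -
  have "measure (density m (\<lambda>x. ennreal (k x))) A = (\<integral>x. indicator A x \<partial>density m (\<lambda>x. ennreal (k x)))"
    using A sets.sets_into_space[OF A] by (simp add: Int_absorb2)
  also have "\<dots> = (\<integral>x. k x * indicator A x \<partial>m)"
    using k A by (subst integral_density) auto
  finally have "of_real (measure (density m (\<lambda>x. ennreal (k x))) A) = (\<integral>x. complex_of_real (k x * indicator A x) \<partial>m)"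
    by (simp only: integral_complex_of_real)
  also have "\<dots> = (\<integral>x. complex_of_real (k x) * indicator A x \<partial>m)"
    by (intro Bochner_Integration.integral_cong) (auto simp: indicator_def)
  finally show ?thesis ..
qed

text \<open>
  Stationarity is the equality of the integrals of \<open>k\<close> and of its annealed image over every measurable
  set, by duality with the indicator function of that set.
\<close>

lemma stationary_density_fixed:
  assumes k: "B_density k" and st: "stationary \<Omega> m T (density m (\<lambda>x. ennreal (k x)))"
  shows "AE x in m. PP (\<lambda>x. complex_of_real (k x)) x = complex_of_real (k x)"
proof (rule AE_eq_of_indicator_tests[OF X.sigma_finite_measure_axioms annealed_integrable[OF B_integrable[OF B_densityD(2)[OF k]]] B_integrable[OF B_densityD(2)[OF k]]])
  fix A assume A: "A \<in> sets m"
  let ?\<mu> = "density m (\<lambda>x. ennreal (k x))"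
  have I: "indicator A \<in> borel_measurable m" "cmod (indicator A x) \<le> 1" for x
    using A by (auto simp: indicator_def)
  have "(\<integral>x. PP (\<lambda>x. complex_of_real (k x)) x * indicator A x \<partial>m)
      = (\<integral>\<omega>. (\<integral>x. complex_of_real (k x) * indicator A (T \<omega> x) \<partial>m) \<partial>\<Omega>)"
    by (rule annealed_duality_fibrewise[OF B_integrable[OF B_densityD(2)[OF k]] I])
  also have "\<dots> = (\<integral>\<omega>. complex_of_real (measure ?\<mu> (T \<omega> -` A \<inter> space m)) \<partial>\<Omega>)"
  proof (rule Bochner_Integration.integral_cong[OF refl])
    fix \<omega> assume \<omega>: "\<omega> \<in> space \<Omega>"
    have TA: "T \<omega> -` A \<inter> space m \<in> sets m" by (rule measurable_sets[OF T_fixed_measurable[OF \<omega>] A])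
    have "(\<integral>x. complex_of_real (k x) * indicator A (T \<omega> x) \<partial>m)
        = (\<integral>x. complex_of_real (k x) * indicator (T \<omega> -` A \<inter> space m) x \<partial>m)"
      by (intro Bochner_Integration.integral_cong) (auto simp: indicator_def)
    then show "(\<integral>x. complex_of_real (k x) * indicator A (T \<omega> x) \<partial>m) = complex_of_real (measure ?\<mu> (T \<omega> -` A \<inter> space m))"
      using density_integral[OF B_densityD(1,4)[OF k] TA] by simp
  qed
  also have "\<dots> = complex_of_real (measure ?\<mu> A)"
    using st A unfolding stationary_def by simp
  also have "\<dots> = (\<integral>x. complex_of_real (k x) * indicator A x \<partial>m)"
    by (rule density_integral[OF B_densityD(1,4)[OF k] A, symmetric])
  finally show "(\<integral>x. PP (\<lambda>x. complex_of_real (k x)) x * indicator A x \<partial>m)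
      = (\<integral>x. complex_of_real (k x) * indicator A x \<partial>m)" .
qed

end

theorem theorem3p6:
  fixes \<Omega> :: "'w measure" and m :: "'x measure"
    and T :: "'w \<Rightarrow> 'x \<Rightarrow> 'x"
    and Pw :: "'w \<Rightarrow> ('x \<Rightarrow> complex) \<Rightarrow> 'x \<Rightarrow> complex"
    and B B0 :: "('x \<Rightarrow> complex) set"
    and nrm nrm0 :: "('x \<Rightarrow> complex) \<Rightarrow> real"
    and \<mu> :: "'x measure" and \<phi> :: "'x \<Rightarrow> real"
  assumes system: "spectral_random_system \<Omega> m T Pw B nrm"
    and mult: "multiplier_space m B nrm B0 nrm0"
    and mu: "stationary \<Omega> m T \<mu>" "\<mu> \<in> measures_with_density_in m B"
    and phi: "(\<lambda>x. complex_of_real (\<phi> x)) \<in> B0" "bounded (\<phi> ` space m)" "(\<integral>x. \<phi> x \<partial>\<mu>) = 0"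
    and sigma: "asymptotic_variance \<Omega> T \<mu> \<phi> > 0"
  shows "\<exists>(I :: real set) (c :: real \<Rightarrow> real).
    open I \<and> is_interval I \<and> 0 \<in> I \<and>
    (\<forall>x\<in>I. 0 \<le> c x) \<and> continuous_on I c \<and> strictly_convex_on I c \<and>
    (\<forall>x\<in>I. c x = 0 \<longleftrightarrow> x = 0) \<and>
    (\<forall>\<nu> \<in> measures_with_density_in m B. \<exists>\<epsilon>0>0. \<forall>\<epsilon>. 0 < \<epsilon> \<and> \<epsilon> < \<epsilon>0 \<longrightarrow>
       \<epsilon> \<in> I \<and>
       (\<lambda>n. (1 / real n) * ln (measure (noise \<Omega> \<Otimes>\<^sub>M \<nu>)
              {p \<in> space (noise \<Omega> \<Otimes>\<^sub>M \<nu>). birkhoff_sum T \<phi> n p > real n * \<epsilon>}))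
         \<longlonglongrightarrow> - c \<epsilon>)"
proof -
  interpret S: spectral_random_system \<Omega> m T Pw B nrm by (rule system)
  interpret M: multiplier_space m B nrm B0 nrm0 by (rule mult)
  obtain h where h: "S.B_density h" and \<mu>: "\<mu> = density m (\<lambda>x. ennreal (h x))"
    by (rule S.measures_with_density_inE[OF mu(2)], rule that)
  obtain b where b: "\<And>x. x \<in> space m \<Longrightarrow> \<bar>\<phi> x\<bar> \<le> b"
    using phi(2) by (auto simp: bounded_iff)
  obtain C where C: "C > 0" "\<forall>f\<in>B0. \<forall>g\<in>B. (\<lambda>x. f x * g x) \<in> B \<and> nrm (\<lambda>x. f x * g x) \<le> C * nrm0 f * nrm g"
    using M.multiplier by auto
  define a where "a = C * nrm0 (\<lambda>x. complex_of_real (\<phi> x))"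
  have \<phi>m: "\<phi> \<in> borel_measurable m"
    using measurable_compose[OF borel_measurable_integrable[OF M.B_integrable[OF phi(1)]] borel_measurable_Re] by simp
  have "(\<integral>x. h x * \<phi> x \<partial>m) = 0"
    using phi(3) S.B_densityD[OF h] \<phi>m unfolding \<mu> by (subst (asm) integral_density) auto
  then have "(\<integral>x. complex_of_real (h x * \<phi> x) \<partial>m) = 0" by (simp only: integral_complex_of_real of_real_0)
  then have cent: "(\<integral>x. complex_of_real (h x) * complex_of_real (\<phi> x) \<partial>m) = 0" by simp
  interpret O: observable_system \<Omega> m T Pw B nrm \<phi> a b h
  proof (intro observable_system.intro observable_system_axioms.intro system)
    show "0 \<le> a" using C(1) M.nrm_nonneg[OF phi(1)] by (simp add: a_def)
    show "AE x in m. annealed \<Omega> Pw (\<lambda>x. complex_of_real (h x)) x = complex_of_real (h x)"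
      using S.stationary_density_fixed[OF h] mu(1) unfolding \<mu> by simp
  qed (use C phi(1) b h \<phi>m cent in \<open>simp_all add: a_def\<close>)
  obtain G \<delta> where \<delta>: "0 < \<delta>" and G: "G holomorphic_on ball 0 \<delta>" "G 0 = 0" "deriv G 0 = 0"
    and G2: "(\<lambda>n. complex_of_real ((\<integral>p. (birkhoff_sum T \<phi> n p)\<^sup>2 \<partial>S.law h) / real n)) \<longlonglongrightarrow> deriv (deriv G) 0"
    and lims: "O.is_pressure G"
    using O.analytic_pressure by (elim exE conjE) (rule that)
  define \<Lambda> where "\<Lambda> = (\<lambda>\<theta>. Re (G (complex_of_real \<theta>)))"
  define \<Lambda>' where "\<Lambda>' = (\<lambda>\<theta>. Re (deriv G (complex_of_real \<theta>)))"
  define \<Lambda>'' where "\<Lambda>'' = (\<lambda>\<theta>. Re (deriv (deriv G) (complex_of_real \<theta>)))"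
  have U: "open (ball (0::complex) \<delta>)" by simp
  note G' = holomorphic_deriv[OF G(1) U]
  note G'' = holomorphic_deriv[OF G' U]
  have d1: "(\<Lambda> has_real_derivative \<Lambda>' \<theta>) (at \<theta>)" if "\<bar>\<theta>\<bar> < \<delta>" for \<theta>
    unfolding \<Lambda>_def \<Lambda>'_def using that
    by (intro has_real_derivative_Re_on_reals holomorphic_derivI[OF G(1) U]) simp
  have d2: "(\<Lambda>' has_real_derivative \<Lambda>'' \<theta>) (at \<theta>)" if "\<bar>\<theta>\<bar> < \<delta>" for \<theta>
    unfolding \<Lambda>'_def \<Lambda>''_def using that
    by (intro has_real_derivative_Re_on_reals holomorphic_derivI[OF G' U]) simp
  have "(\<lambda>n. 1 / real n * (\<integral>p. (birkhoff_sum T \<phi> n p)\<^sup>2 \<partial>(noise \<Omega> \<Otimes>\<^sub>M \<mu>))) \<longlonglongrightarrow> \<Lambda>'' 0"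
    using tendsto_Re[OF G2] by (simp add: \<Lambda>''_def \<mu>)
  then have "asymptotic_variance \<Omega> T \<mu> \<phi> = \<Lambda>'' 0"
    unfolding asymptotic_variance_def by (rule limI)
  then have pos0: "0 < \<Lambda>'' 0" using sigma by simp
  have "isCont \<Lambda>'' 0"
    unfolding \<Lambda>''_def using \<delta>
    by (intro DERIV_isCont[OF has_real_derivative_Re_on_reals[OF holomorphic_derivI[OF G'' U]]]) simp
  then have "\<forall>\<^sub>F \<theta> in at 0. 0 < \<Lambda>'' \<theta>" using pos0 by (simp add: isCont_def order_tendstoD(1))
  then obtain d where d: "d > 0" "\<And>\<theta>. \<theta> \<noteq> 0 \<Longrightarrow> \<bar>\<theta>\<bar> < d \<Longrightarrow> 0 < \<Lambda>'' \<theta>"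
    by (auto simp: eventually_at dist_real_def)
  (* The second derivative is continuous and positive at 0, so it is positive for arguments below d. *)
  define r where "r = min d \<delta>"
  have r: "0 < r" "r \<le> \<delta>" using d \<delta> by (auto simp: r_def)
  have pos: "0 < \<Lambda>'' \<theta>" if "\<bar>\<theta>\<bar> < r" for \<theta>
    using d(2)[of \<theta>] pos0 that by (cases "\<theta> = 0") (auto simp: r_def)
  interpret pressure \<Lambda> \<Lambda>' r
  proof
    show "0 < r" by (rule r)
    show "(\<Lambda> has_real_derivative \<Lambda>' \<theta>) (at \<theta>)" if "\<bar>\<theta>\<bar> < r" for \<theta> using d1 that r by simp
    show "continuous_on {- r<..<r} \<Lambda>'"
      using r by (intro continuous_at_imp_continuous_on ballI DERIV_isCont[OF d2]) auto
    show "strict_mono_on {- r<..<r} \<Lambda>'"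
    proof (rule strict_mono_onI)
      fix x y assume xy: "x \<in> {- r<..<r}" "y \<in> {- r<..<r}" "x < y"
      show "\<Lambda>' x < \<Lambda>' y"
      proof (rule DERIV_pos_imp_increasing[OF xy(3)])
        fix z assume "x \<le> z" "z \<le> y"
        then have "\<bar>z\<bar> < r" using xy by auto
        then show "\<exists>D. (\<Lambda>' has_real_derivative D) (at z) \<and> D > 0" using d2[of z] pos[of z] r by auto
      qed
    qed
    show "\<Lambda> 0 = 0" "\<Lambda>' 0 = 0" using G by (simp_all add: \<Lambda>_def \<Lambda>'_def)
  qed
  show ?thesis
  proof (intro exI[of _ rate_domain] exI[of _ rate] conjI ballI)
    show "open rate_domain" "is_interval rate_domain" by (simp_all add: rate_domain_def is_interval_oo)
    show "0 \<in> rate_domain" by (rule zero_in_domain)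
    show "0 \<le> rate x" if "x \<in> rate_domain" for x using that by (rule rate_nonneg)
    show "continuous_on rate_domain rate" by (rule rate_continuous)
    show "strictly_convex_on rate_domain rate" by (rule rate_strictly_convex)
    show "rate x = 0 \<longleftrightarrow> x = 0" if "x \<in> rate_domain" for x using that by (rule rate_eq_zero_iff)
    fix \<nu> assume \<nu>_mem: "\<nu> \<in> measures_with_density_in m B"
    obtain k where k: "S.B_density k" and \<nu>: "\<nu> = density m (\<lambda>x. ennreal (k x))"
      by (rule S.measures_with_density_inE[OF \<nu>_mem], rule that)
    obtain s0 where s0: "s0 > 0" "\<forall>\<theta>. \<bar>\<theta>\<bar> < s0 \<longrightarrow> (\<lambda>n. ln (\<integral>p. exp (\<theta> * birkhoff_sum T \<phi> n p)
        \<partial>(noise \<Omega> \<Otimes>\<^sub>M \<nu>)) / real n) \<longlonglongrightarrow> \<Lambda> \<theta>"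
      using lims k unfolding O.is_pressure_def \<nu> \<Lambda>_def by blast
    define s where "s = min s0 r"
    have s: "0 < s" "s \<le> r" "s \<le> s0" using s0 r by (auto simp: s_def)
    interpret N: prob_space "noise \<Omega> \<Otimes>\<^sub>M \<nu>" unfolding \<nu> by (rule S.law_prob[OF k])
    interpret LD: scaled_cumulants \<Lambda> \<Lambda>' r "noise \<Omega> \<Otimes>\<^sub>M \<nu>" "birkhoff_sum T \<phi>" s
    proof
      show "birkhoff_sum T \<phi> n \<in> borel_measurable (noise \<Omega> \<Otimes>\<^sub>M \<nu>)" for n
        unfolding \<nu> by (rule O.birkhoff_sum_rv)
      show "\<exists>c. \<forall>p\<in>space (noise \<Omega> \<Otimes>\<^sub>M \<nu>). \<bar>birkhoff_sum T \<phi> n p\<bar> \<le> c" for n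
        unfolding \<nu> using O.birkhoff_sum_rv(2) by blast
      show "(\<lambda>n. ln (\<integral>p. exp (\<theta> * birkhoff_sum T \<phi> n p) \<partial>(noise \<Omega> \<Otimes>\<^sub>M \<nu>)) / real n) \<longlonglongrightarrow> \<Lambda> \<theta>"
        if "\<bar>\<theta>\<bar> < s" for \<theta> using s0(2) that s by simp
    qed (use s in auto)
    show "\<exists>\<epsilon>0>0. \<forall>\<epsilon>. 0 < \<epsilon> \<and> \<epsilon> < \<epsilon>0 \<longrightarrow> \<epsilon> \<in> rate_domain \<and>
       (\<lambda>n. (1 / real n) * ln (measure (noise \<Omega> \<Otimes>\<^sub>M \<nu>)
              {p \<in> space (noise \<Omega> \<Otimes>\<^sub>M \<nu>). birkhoff_sum T \<phi> n p > real n * \<epsilon>})) \<longlonglongrightarrow> - rate \<epsilon>"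
    (* As s is at most r, tilts below s / 2 stay inside the rate domain. *)
    proof (intro exI[of _ "\<Lambda>' (s / 2)"] conjI allI impI)
      have mono: "\<Lambda>' x < \<Lambda>' y" if "-r < x" "x < y" "y < r" for x y
        using that by (intro strict_mono_onD[OF deriv_mono]) auto
      show "0 < \<Lambda>' (s / 2)" using mono[of 0 "s / 2"] s at_zero by simp
      fix \<epsilon> assume \<epsilon>: "0 < \<epsilon> \<and> \<epsilon> < \<Lambda>' (s / 2)"
      have "\<Lambda>' (s / 2) \<le> \<Lambda>' (r / 2)" using mono[of "s / 2" "r / 2"] s r by (cases "s = r") auto
      moreover have "\<Lambda>' (- r / 2) < 0" using mono[of "- r / 2" 0] r at_zero by simp
      ultimately show "\<epsilon> \<in> rate_domain" using \<epsilon> by (simp add: rate_domain_def)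
      obtain \<theta> where \<theta>: "0 < \<theta>" "\<theta> < s / 2" "\<Lambda>' \<theta> = \<epsilon>"
        using deriv_attains[of 0 "s / 2" \<epsilon>] s r \<epsilon> at_zero by auto
      have "tilt \<epsilon> = \<theta>" using tilt_deriv[of \<theta>] \<theta> s by simp
      then have "rate \<epsilon> = \<theta> * \<Lambda>' \<theta> - \<Lambda> \<theta>" using \<theta>(3) by (simp add: rate_def mult.commute)
      moreover have "(\<lambda>n. ln (LD.tail n (\<Lambda>' \<theta>)) / real n) \<longlonglongrightarrow> - (\<theta> * \<Lambda>' \<theta> - \<Lambda> \<theta>)"
        using \<theta> s by (intro LD.large_deviations) auto
      ultimately show "(\<lambda>n. (1 / real n) * ln (measure (noise \<Omega> \<Otimes>\<^sub>M \<nu>)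
              {p \<in> space (noise \<Omega> \<Otimes>\<^sub>M \<nu>). birkhoff_sum T \<phi> n p > real n * \<epsilon>})) \<longlonglongrightarrow> - rate \<epsilon>"
        by (simp add: LD.tail_def \<theta>(3))
    qed
  qed
qed

end
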